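(* Let $\nu\in\{3,4\}$ and consider AM$\nu$. Assume that $\mathcal V_h$ consists of continuous piecewise affine functions on a shape-regular quasi-uniform mesh $\mathcal T_h$ and that $G$ has constant coefficients, so that $GV_h|_K\in[\mathbb P_0(K)]^{n_{\rm sys}}$ for all $V_h\in\mathcal V_h$, $K\in\mathcal T_h$. Assume $$\tau\le C_{\tau\delta}\delta,\qquad 0<\delta\le C_\delta h,\qquad \tau\le c_0C_G^{-1}h,$$ with $c_0$ sufficiently small, where $C_G$ is the constant of the inverse inequality $\|GV_h\|_\Omega\le C_Gh^{-1}\|V_h\|_\Omega$ on $\mathcal V_h$. If $V_h^n\in\mathcal V_h$, $0\le n\le N$, solves $(A_\tau V_h^n,T_\delta W)_\Omega=(R^n,T_\delta W)_\Omega$ for all $W\in\mathcal V_h$, $n_0(\nu)\le n\le N$, with $R^n\in\mathcal H$, then $$\|V_h\|_{\mathcal E_\nu,N}^2\lesssim\mathcal I_\tau(V_h)+\|R\|_{\mathcal E_\nu^*,N}^2+\tau\|R\|_{\ell_\tau^2(n_0(\nu),N;\mathcal H)}^2,$$ without the strengthened conditions $\tau\le C_{4/3}h^{4/3}$ (AM3) or $\tau\le C_{6/5}h^{6/5}$ (AM4). In particular this includes the standard hyperbolic regime $\tau\lesssim\delta\lesssim h$, subject to the stated smallness of $\tau/h$.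
   Context: Setting. $\Omega\subset\mathbb R^d$ is a Lipschitz domain, $\mathcal H=[L^2(\Omega)]^{n_{\rm sys}}$ with inner product $(\cdot,\cdot)_\Omega$ and norm $\|\cdot\|_\Omega$; $\mathcal V\subset[H^1(\Omega)]^{n_{\rm sys}}$ is dense in $\mathcal H$; $G:\mathcal V\to\mathcal H$ is a time-independent linear first-order differential operator with $(GU,V)_\Omega=-(U,GV)_\Omega$ for all $U,V\in\mathcal V$; $\mathcal V_h\subset\mathcal V$ is a conforming finite element space with mesh size $h$. $\mathbb P_0(K)$ denotes constants on $K$. $\tau>0$, $t^n=n\tau$ ($0\le n\le N$), $t^N\le T$, $\delta>0$. AM$\nu$: $D_\tau^-V^n=\tau^{-1}(V^n-V^{n-1})$ and $\mathcal M_\tau V^n=\sum_{j=0}^{\nu-1}b_jV^{n-j}$ with AM3: $(b_0,b_1,b_2)=(\frac5{12},\frac23,-\frac1{12})$; AM4: $(b_0,\dots,b_3)=(\frac38,\frac{19}{24},-\frac5{24},\frac1{24})$. First computed indices: $n_0(3)=2$, $n_0(4)=3$; $N\ge n_0(\nu)$. Operators: $T_\delta=\mathrm{Id}+\delta G$, $S_\delta=\mathcal M_\tau+\delta D_\tau^-$, $A_\tau=D_\tau^-+G\mathcal M_\tau$, $P_\delta=T_\delta S_\delta$. Norms. $\mathcal I_\tau(V)=\sum_{j=0}^{n_0(\nu)-1}\|T_\delta V^j\|_\Omega^2$; $\|R\|_{\ell_\tau^2(a,b;\mathcal H)}^2=\tau\sum_{n=a}^b\|R^n\|_\Omega^2$;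 for $n_0(\nu)\le m\le N$, $$\|V\|_{\mathcal E_\nu,m}^2=\max_{n_0(\nu)\le n\le m}\|T_\delta V^n\|_\Omega^2+\tau\delta\sum_{n=n_0(\nu)}^m\|A_\tau V^n\|_\Omega^2,$$ $$\|R\|_{\mathcal E_\nu^*,N}=\max_{n_0(\nu)\le m\le N}\ \sup_V\ \frac{\tau\sum_{n=n_0(\nu)}^m(R^n,P_\delta V^n)_\Omega}{\bigl(\mathcal I_\tau(V)+\|V\|_{\mathcal E_\nu,m}^2\bigr)^{1/2}},$$ the supremum being over $\mathcal V_h$-valued sequences with $V^n=0$ for $n\notin\{0,\dots,m\}$ and positive denominator. Conventions: $a\lesssim b$ means $a\le Cb$ with $C>0$ independent of $h$, $\tau$, $N$ and of the sequences; "$c_0$ sufficiently small" means below a positive threshold independent of $h$, $\tau$, $N$ (it may depend on the constants $C_{\tau\delta}$, $C_\delta$, $C_G$ and the mesh regularity). *)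

theory Defs
  imports "HOL-Analysis.Analysis"
begin

section \<open>Function spaces\<close>

text \<open>
  Elements of \<open>[L\<^sup>2(\<Omega>)]\<^sup>n\<close> are represented by functions on the whole space; only their values
  on \<open>\<Omega>\<close> matter, and they are not identified when they agree almost everywhere.
\<close>

definition L2_space :: "(real^'d) set \<Rightarrow> (real^'d \<Rightarrow> real^'s) set" where
  "L2_space \<Omega> = {U. U \<in> borel_measurable (lebesgue_on \<Omega>) \<and>
                    integrable (lebesgue_on \<Omega>) (\<lambda>x. (norm (U x))\<^sup>2)}"

definition L2_inner :: "(real^'d) set \<Rightarrow> (real^'d \<Rightarrow> real^'s) \<Rightarrow> (real^'d \<Rightarrow> real^'s) \<Rightarrow> real" where
  "L2_inner \<Omega> U W = (LINT x | lebesgue_on \<Omega>. U x \<bullet> W x)"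

definition L2_norm :: "(real^'d) set \<Rightarrow> (real^'d \<Rightarrow> real^'s) \<Rightarrow> real" where
  "L2_norm \<Omega> U = sqrt (L2_inner \<Omega> U U)"

definition partial_deriv :: "'d \<Rightarrow> (real^'d \<Rightarrow> real) \<Rightarrow> real^'d \<Rightarrow> real" where
  "partial_deriv i f x = frechet_derivative f (at x) (axis i 1)"

primrec C_k :: "nat \<Rightarrow> (real^'d \<Rightarrow> real) \<Rightarrow> bool" where
  "C_k 0 f \<longleftrightarrow> continuous_on UNIV f"
| "C_k (Suc k) f \<longleftrightarrow> (\<forall>x. f differentiable (at x)) \<and> (\<forall>i. C_k k (partial_deriv i f))"

definition test_function :: "(real^'d) set \<Rightarrow> (real^'d \<Rightarrow> real) \<Rightarrow> bool" where
  "test_function \<Omega> \<phi> \<longleftrightarrow>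
     (\<forall>k. C_k k \<phi>) \<and> compact (closure {x. \<phi> x \<noteq> 0}) \<and> closure {x. \<phi> x \<noteq> 0} \<subseteq> \<Omega>"

definition has_weak_partial ::
    "(real^'d) set \<Rightarrow> 'd \<Rightarrow> (real^'d \<Rightarrow> real^'s) \<Rightarrow> (real^'d \<Rightarrow> real^'s) \<Rightarrow> bool" where
  "has_weak_partial \<Omega> i U W \<longleftrightarrow>
     (\<forall>\<phi>. test_function \<Omega> \<phi> \<longrightarrow>
        (LINT x | lebesgue_on \<Omega>. partial_deriv i \<phi> x *\<^sub>R U x) =
        - (LINT x | lebesgue_on \<Omega>. \<phi> x *\<^sub>R W x))"

definition H1_space :: "(real^'d) set \<Rightarrow> (real^'d \<Rightarrow> real^'s) set" where
  "H1_space \<Omega> = {U \<in> L2_space \<Omega>. \<forall>i. \<exists>W \<in> L2_space \<Omega>. has_weak_partial \<Omega> i U W}"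

text \<open>For \<open>U\<close> in \<open>H1_space \<Omega>\<close> this is determined up to a null set of \<open>\<Omega>\<close>.\<close>

definition weak_partial ::
    "(real^'d) set \<Rightarrow> 'd \<Rightarrow> (real^'d \<Rightarrow> real^'s) \<Rightarrow> (real^'d \<Rightarrow> real^'s)" where
  "weak_partial \<Omega> i U = (SOME W. W \<in> L2_space \<Omega> \<and> has_weak_partial \<Omega> i U W)"

definition fun_subspace :: "('a \<Rightarrow> 'b::real_vector) set \<Rightarrow> bool" where
  "fun_subspace X \<longleftrightarrow> (\<lambda>_. 0) \<in> X \<and>
     (\<forall>U\<in>X. \<forall>W\<in>X. (\<lambda>x. U x + W x) \<in> X) \<and>
     (\<forall>c. \<forall>U\<in>X. (\<lambda>x. c *\<^sub>R U x) \<in> X)"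

definition dense_in_L2 :: "(real^'d) set \<Rightarrow> (real^'d \<Rightarrow> real^'s) set \<Rightarrow> bool" where
  "dense_in_L2 \<Omega> X \<longleftrightarrow>
     (\<forall>U \<in> L2_space \<Omega>. \<forall>\<epsilon>>0. \<exists>W\<in>X. L2_norm \<Omega> (\<lambda>x. U x - W x) < \<epsilon>)"

section \<open>Domain, operator and meshes\<close>

text \<open>
  Near every boundary point the domain is the strict epigraph, in some unit direction \<open>e\<close>, of a
  Lipschitz function on the hyperplane orthogonal to \<open>e\<close>.
\<close>

definition lipschitz_domain :: "(real^'d) set \<Rightarrow> bool" where
  "lipschitz_domain \<Omega> \<longleftrightarrow>
     open \<Omega> \<and> connected \<Omega> \<and> bounded \<Omega> \<and> \<Omega> \<noteq> {} \<and>
     (\<forall>z \<in> frontier \<Omega>. \<exists>r>0. \<exists>e. \<exists>\<gamma> :: real^'d \<Rightarrow> real. \<exists>L.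
        norm e = 1 \<and> lipschitz_on L {y. y \<bullet> e = 0} \<gamma> \<and>
        (\<forall>x \<in> ball z r. x \<in> \<Omega> \<longleftrightarrow> \<gamma> (x - (x \<bullet> e) *\<^sub>R e) < x \<bullet> e))"

text \<open>
  The operator \<open>\<Sum>\<^sub>i A\<^sub>i \<partial>\<^sub>i\<close> with constant coefficient matrices. There is no zeroth-order
  term, so that it maps functions that are affine on an element to constants there.
\<close>

definition const_coeff_op ::
    "(real^'d) set \<Rightarrow> ('d \<Rightarrow> real^'s^'s) \<Rightarrow> (real^'d \<Rightarrow> real^'s) \<Rightarrow> (real^'d \<Rightarrow> real^'s)" where
  "const_coeff_op \<Omega> A U = (\<lambda>x. \<Sum>i\<in>UNIV. A i *v weak_partial \<Omega> i U x)"

definition skew_on ::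
    "(real^'d) set \<Rightarrow> (real^'d \<Rightarrow> real^'s) set \<Rightarrow>
     ((real^'d \<Rightarrow> real^'s) \<Rightarrow> (real^'d \<Rightarrow> real^'s)) \<Rightarrow> bool" where
  "skew_on \<Omega> X G \<longleftrightarrow> (\<forall>U\<in>X. \<forall>W\<in>X. L2_inner \<Omega> (G U) W = - L2_inner \<Omega> U (G W))"

definition simplicial_mesh :: "(real^'d) set \<Rightarrow> (real^'d) set set \<Rightarrow> bool" where
  "simplicial_mesh \<Omega> \<T> \<longleftrightarrow>
     triangulation \<T> \<and> (\<forall>K\<in>\<T>. int CARD('d) simplex K) \<and> \<Union>\<T> = closure \<Omega>"

definition mesh_size :: "(real^'d) set set \<Rightarrow> real" where
  "mesh_size \<T> = Max (diameter ` \<T>)"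

text \<open>Diameter of the largest ball contained in \<open>K\<close>.\<close>

definition inscribed_diameter :: "(real^'d) set \<Rightarrow> real" where
  "inscribed_diameter K = Sup {2 * r | r. 0 \<le> r \<and> (\<exists>x. cball x r \<subseteq> K)}"

definition shape_regular :: "real \<Rightarrow> (real^'d) set set \<Rightarrow> bool" where
  "shape_regular \<sigma> \<T> \<longleftrightarrow> (\<forall>K\<in>\<T>. diameter K \<le> \<sigma> * inscribed_diameter K)"

definition quasi_uniform :: "real \<Rightarrow> (real^'d) set set \<Rightarrow> bool" where
  "quasi_uniform \<rho> \<T> \<longleftrightarrow> (\<forall>K\<in>\<T>. mesh_size \<T> \<le> \<rho> * diameter K)"

definition continuous_piecewise_affine ::
    "(real^'d) set \<Rightarrow> (real^'d) set set \<Rightarrow> (real^'d \<Rightarrow> real^'s) set" where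
  "continuous_piecewise_affine \<Omega> \<T> =
     {U. continuous_on (closure \<Omega>) U \<and>
         (\<forall>K\<in>\<T>. \<exists>(B :: real^'d^'s) b. \<forall>x\<in>K. U x = B *v x + b)}"

section \<open>Adams--Moulton operators\<close>

definition am_coeff :: "nat \<Rightarrow> nat \<Rightarrow> real" where
  "am_coeff \<nu> j =
     (if \<nu> = 3 then [5/12, 2/3, -1/12] ! j else [3/8, 19/24, -5/24, 1/24] ! j)"

definition first_index :: "nat \<Rightarrow> nat" where
  "first_index \<nu> = (if \<nu> = 3 then 2 else 3)"

text \<open>
  The natural-number subtractions below are exact for \<open>n \<ge> first_index \<nu> = \<nu> - 1\<close>, the only
  indices at which these operators are used.
\<close>

definition D_op :: "real \<Rightarrow> (nat \<Rightarrow> 'a \<Rightarrow> 'b::real_vector) \<Rightarrow> nat \<Rightarrow> 'a \<Rightarrow> 'b" where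
  "D_op \<tau> V n = (\<lambda>x. (V n x - V (n - 1) x) /\<^sub>R \<tau>)"

definition M_op :: "nat \<Rightarrow> (nat \<Rightarrow> 'a \<Rightarrow> 'b::real_vector) \<Rightarrow> nat \<Rightarrow> 'a \<Rightarrow> 'b" where
  "M_op \<nu> V n = (\<lambda>x. \<Sum>j<\<nu>. am_coeff \<nu> j *\<^sub>R V (n - j) x)"

definition T_op ::
    "(('a \<Rightarrow> 'b) \<Rightarrow> 'a \<Rightarrow> 'b) \<Rightarrow> real \<Rightarrow> ('a \<Rightarrow> 'b::real_vector) \<Rightarrow> 'a \<Rightarrow> 'b" where
  "T_op G \<delta> U = (\<lambda>x. U x + \<delta> *\<^sub>R G U x)"

definition S_op ::
    "nat \<Rightarrow> real \<Rightarrow> real \<Rightarrow> (nat \<Rightarrow> 'a \<Rightarrow> 'b::real_vector) \<Rightarrow> nat \<Rightarrow> 'a \<Rightarrow> 'b" where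
  "S_op \<nu> \<tau> \<delta> V n = (\<lambda>x. M_op \<nu> V n x + \<delta> *\<^sub>R D_op \<tau> V n x)"

definition A_op ::
    "(('a \<Rightarrow> 'b) \<Rightarrow> 'a \<Rightarrow> 'b) \<Rightarrow> nat \<Rightarrow> real \<Rightarrow>
     (nat \<Rightarrow> 'a \<Rightarrow> 'b::real_vector) \<Rightarrow> nat \<Rightarrow> 'a \<Rightarrow> 'b" where
  "A_op G \<nu> \<tau> V n = (\<lambda>x. D_op \<tau> V n x + G (M_op \<nu> V n) x)"

definition P_op ::
    "(('a \<Rightarrow> 'b) \<Rightarrow> 'a \<Rightarrow> 'b) \<Rightarrow> nat \<Rightarrow> real \<Rightarrow> real \<Rightarrow>
     (nat \<Rightarrow> 'a \<Rightarrow> 'b::real_vector) \<Rightarrow> nat \<Rightarrow> 'a \<Rightarrow> 'b" where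
  "P_op G \<nu> \<tau> \<delta> V n = T_op G \<delta> (S_op \<nu> \<tau> \<delta> V n)"

section \<open>Norms\<close>

definition init_energy ::
    "(real^'d) set \<Rightarrow> ((real^'d \<Rightarrow> real^'s) \<Rightarrow> real^'d \<Rightarrow> real^'s) \<Rightarrow> nat \<Rightarrow> real \<Rightarrow>
     (nat \<Rightarrow> real^'d \<Rightarrow> real^'s) \<Rightarrow> real" where
  "init_energy \<Omega> G \<nu> \<delta> V = (\<Sum>j<first_index \<nu>. (L2_norm \<Omega> (T_op G \<delta> (V j)))\<^sup>2)"

definition l2_norm_time ::
    "(real^'d) set \<Rightarrow> real \<Rightarrow> nat \<Rightarrow> nat \<Rightarrow> (nat \<Rightarrow> real^'d \<Rightarrow> real^'s) \<Rightarrow> real" where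
  "l2_norm_time \<Omega> \<tau> a b R = sqrt (\<tau> * (\<Sum>n=a..b. (L2_norm \<Omega> (R n))\<^sup>2))"

definition E_norm ::
    "(real^'d) set \<Rightarrow> ((real^'d \<Rightarrow> real^'s) \<Rightarrow> real^'d \<Rightarrow> real^'s) \<Rightarrow> nat \<Rightarrow> real \<Rightarrow> real \<Rightarrow>
     nat \<Rightarrow> (nat \<Rightarrow> real^'d \<Rightarrow> real^'s) \<Rightarrow> real" where
  "E_norm \<Omega> G \<nu> \<tau> \<delta> m V =
     sqrt ((MAX n\<in>{first_index \<nu>..m}. (L2_norm \<Omega> (T_op G \<delta> (V n)))\<^sup>2) +
           \<tau> * \<delta> * (\<Sum>n=first_index \<nu>..m. (L2_norm \<Omega> (A_op G \<nu> \<tau> V n))\<^sup>2))"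

definition test_energy ::
    "(real^'d) set \<Rightarrow> ((real^'d \<Rightarrow> real^'s) \<Rightarrow> real^'d \<Rightarrow> real^'s) \<Rightarrow> nat \<Rightarrow> real \<Rightarrow> real \<Rightarrow>
     nat \<Rightarrow> (nat \<Rightarrow> real^'d \<Rightarrow> real^'s) \<Rightarrow> real" where
  "test_energy \<Omega> G \<nu> \<tau> \<delta> m V = sqrt (init_energy \<Omega> G \<nu> \<delta> V + (E_norm \<Omega> G \<nu> \<tau> \<delta> m V)\<^sup>2)"

text \<open>
  The supremum is taken in the extended reals, so that no boundedness is presupposed. It is over
  the empty set only if every element of \<open>X\<close> has vanishing norm.
\<close>

definition E_dual_norm ::
    "(real^'d) set \<Rightarrow> (real^'d \<Rightarrow> real^'s) set \<Rightarrow>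
     ((real^'d \<Rightarrow> real^'s) \<Rightarrow> real^'d \<Rightarrow> real^'s) \<Rightarrow> nat \<Rightarrow> real \<Rightarrow> real \<Rightarrow>
     nat \<Rightarrow> (nat \<Rightarrow> real^'d \<Rightarrow> real^'s) \<Rightarrow> ereal" where
  "E_dual_norm \<Omega> X G \<nu> \<tau> \<delta> N R =
     (MAX m\<in>{first_index \<nu>..N}.
        SUP V\<in>{V. (\<forall>n. V n \<in> X) \<and> (\<forall>n>m. V n = (\<lambda>_. 0)) \<and> 0 < test_energy \<Omega> G \<nu> \<tau> \<delta> m V}.
          ereal (\<tau> * (\<Sum>n=first_index \<nu>..m. L2_inner \<Omega> (R n) (P_op G \<nu> \<tau> \<delta> V n)) /
                 test_energy \<Omega> G \<nu> \<tau> \<delta> m V))"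

end

theory Submission
  imports Defs
begin

text \<open>
  Write \<open>d\<close> for the backward difference, \<open>U = T\<^sub>\<delta> V\<close>, and test the scheme at step \<open>n\<close> with
  \<open>S\<^sub>\<delta> V\<^sup>n\<close>. Since \<open>G\<close> is skew, the mixed terms cancel and
  \<open>\<tau> (A\<^sub>\<tau> V, P\<^sub>\<delta> V) = \<tau>\<delta> \<parallel>A\<^sub>\<tau> V\<parallel>\<^sup>2 + (d U, M\<^sub>\<tau> U)\<close> (lemma \<open>energy_balance\<close>). For the Adams--Moulton
  means, \<open>(d U, M\<^sub>\<tau> U)\<close> is the increment of a quadratic energy up to products of
  second differences \<open>d d U\<close> (lemma \<open>am_energy_identity\<close>). Neither method is A-stable, so these second
  differences enter with the wrong sign and have to be absorbed.

  A generic bound is \<open>\<parallel>d d V\<parallel> \<lesssim> (\<tau>/h)\<^sup>2 \<parallel>V\<parallel>\<close> plus residual terms; summing its square over the order of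
  \<open>1/\<tau>\<close> steps forces \<open>\<tau> \<lesssim> h\<^sup>4\<^sup>/\<^sup>3\<close> for \<open>\<nu> = 3\<close>. For affine elements there is a better way. The residual at a step is
  \<open>\<tau> A\<^sub>\<tau> V = d V + \<tau> G M\<^sub>\<tau> V\<close>. On each element \<open>d V\<close> is affine and \<open>G M\<^sub>\<tau> V\<close> is constant, and no
  constant can cancel the oscillation of an affine function, which is of size \<open>h\<close> times its
  gradient. Hence \<open>\<parallel>G d V\<parallel> \<le> K (\<tau>/h) \<parallel>A\<^sub>\<tau> V\<parallel>\<close> (lemma \<open>inverse_estimate_by_residual\<close>): the dissipated
  quantity itself controls the time difference of \<open>G V\<close>. Writing
  \<open>d d V = \<tau> d A\<^sub>\<tau> V - \<tau> M\<^sub>\<tau> (G d V)\<close> and replacing \<open>A\<^sub>\<tau> V\<close> by the data \<open>R\<close> against test functions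
  \<open>T\<^sub>\<delta> W\<close>, the sum of \<open>\<parallel>d d U\<parallel>\<^sup>2\<close> is at most a multiple of \<open>\<tau>/h\<close> times the dissipation plus a
  multiple of \<open>\<tau>\<^sup>2 \<Sum> \<parallel>R\<parallel>\<^sup>2\<close> (lemma \<open>second_difference_sum\<close>). For small \<open>\<tau>/h\<close> it is absorbed, without
  a Gronwall argument.

  The second difference at step \<open>n\<close> involves residuals from step \<open>n - \<nu> + 1\<close> on. They exist only when
  \<open>n\<close> is at least twice the first computed index, and the boundedly many earlier steps are handled
  one at a time at the price of a fixed constant (lemma \<open>startup\<close>). The load term is bounded by the
  dual norm, truncating the solution at the current step to obtain an admissible test sequence.

  The estimate only uses finitely many vectors and their inner products, so it is proved in an
  arbitrary inner product space (locale \<open>am_supg_sequences\<close>) and then transferred to the quotient of the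
  square integrable functions by equality almost everywhere. This quotient is also where \<open>G\<close> becomes linear:
  weak derivatives are chosen representatives, and linearity of \<open>G\<close> up to null functions follows
  from skewness and density. Finally, that \<open>G\<close> has constant values on elements needs the weak
  derivative of a function that is affine on an open set to be its matrix almost everywhere
  (lemma \<open>weak_partial_affine\<close>), a case of the fundamental lemma of the calculus of variations.
\<close>

section \<open>Adams--Moulton energy identities\<close>

definition am_mean :: "nat \<Rightarrow> (nat \<Rightarrow> 'a::real_vector) \<Rightarrow> nat \<Rightarrow> 'a" where
  "am_mean \<nu> x n = (\<Sum>j<\<nu>. am_coeff \<nu> j *\<^sub>R x (n - j))"

definition bdiff :: "(nat \<Rightarrow> 'a::real_vector) \<Rightarrow> nat \<Rightarrow> 'a" where
  "bdiff x n = x n - x (n - 1)"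

text \<open>
  The weight of the third difference in the mean: the means are \<open>(u n + u (n - 1)) / 2\<close> minus a
  twelfth of the second difference and minus, for \<open>\<nu> = 4\<close>, a twenty-fourth of the third one.
\<close>

definition am_kappa :: "nat \<Rightarrow> real" where
  "am_kappa \<nu> = (if \<nu> = 3 then 0 else 1/24)"

text \<open>
  The quadratic form whose increments appear when the mean is tested with the backward
  difference. Its two corrections to \<open>(norm (u n))\<^sup>2 / 2\<close> come from summing the second and third
  difference parts of the mean by parts.
\<close>

definition am_energy :: "nat \<Rightarrow> (nat \<Rightarrow> 'a::real_inner) \<Rightarrow> nat \<Rightarrow> real" where
  "am_energy \<nu> u n = (norm (u n))\<^sup>2 / 2 - (norm (bdiff u n))\<^sup>2 / 24
     - am_kappa \<nu> * inner (bdiff u n) (bdiff (bdiff u) n)"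

lemma am_mean_3: "am_mean 3 x n = (5/12) *\<^sub>R x n + (2/3) *\<^sub>R x (n - 1) - (1/12) *\<^sub>R x (n - 2)"
  by (simp add: am_mean_def am_coeff_def eval_nat_numeral)

lemma am_mean_4:
  "am_mean 4 x n = (3/8) *\<^sub>R x n + (19/24) *\<^sub>R x (n - 1) - (5/24) *\<^sub>R x (n - 2) + (1/24) *\<^sub>R x (n - 3)"
  by (simp add: am_mean_def am_coeff_def eval_nat_numeral)

text \<open>
  The trapezoidal part of the mean telescopes exactly. With \<open>w\<close> the second difference, the others
  telescope by \<open>inner d w = (\<parallel>d\<parallel>\<^sup>2 - \<parallel>d'\<parallel>\<^sup>2 + \<parallel>w\<parallel>\<^sup>2) / 2\<close> and
  \<open>inner d (w - w') = inner d w - inner d' w' - inner w w'\<close>, primes denoting the previous index.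
  The remaining products of second differences are what prevents unconditional stability.
\<close>

lemma am_energy_identity:
  fixes u :: "nat \<Rightarrow> 'a::real_inner"
  assumes "\<nu> \<in> {3, 4}" "n \<ge> 3"
  shows "inner (bdiff u n) (am_mean \<nu> u n) = am_energy \<nu> u n - am_energy \<nu> u (n - 1)
     - (norm (bdiff (bdiff u) n))\<^sup>2 / 24
     + am_kappa \<nu> * inner (bdiff (bdiff u) n) (bdiff (bdiff u) (n - 1))"
proof -
  obtain k where n: "n = Suc (Suc (Suc k))"
    using assms(2) by (auto simp: numeral_3_eq_3 Suc_le_eq dest!: less_imp_Suc_add)
  have s: "Suc (Suc (Suc k)) - 2 = Suc k" "Suc (Suc (Suc k)) - 3 = k" "Suc (Suc k) - 1 = Suc k"
    by auto
  show ?thesis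
    using assms(1) unfolding n
    apply (elim insertE emptyE; simp only: am_mean_3 am_mean_4 s am_energy_def bdiff_def am_kappa_def)
     apply (simp_all add: power2_norm_eq_inner inner_diff_left inner_diff_right inner_add_left
        inner_add_right inner_commute[of "u (Suc k)" "u k"]
        inner_commute[of "u (Suc (Suc k))" "u k"] inner_commute[of "u (Suc (Suc (Suc k)))" "u k"]
        inner_commute[of "u (Suc (Suc k))" "u (Suc k)"] inner_commute[of "u (Suc (Suc (Suc k)))" "u (Suc k)"]
        inner_commute[of "u (Suc (Suc (Suc k)))" "u (Suc (Suc k))"])
     apply (simp_all add: field_simps)
    done
qed

lemma norm_am_mean_le:
  assumes "\<nu> \<in> {3, 4}" "\<And>j. j < \<nu> \<Longrightarrow> norm (x (n - j)) \<le> B"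
  shows "norm (am_mean \<nu> x n) \<le> 2 * B"
proof -
  have B: "0 \<le> B"
    using order_trans[OF norm_ge_zero assms(2)[of 0]] assms(1) by auto
  have "norm (am_mean \<nu> x n) \<le> (\<Sum>j<\<nu>. \<bar>am_coeff \<nu> j\<bar> * norm (x (n - j)))"
    unfolding am_mean_def by (rule order_trans[OF norm_sum]) simp
  also have "\<dots> \<le> (\<Sum>j<\<nu>. \<bar>am_coeff \<nu> j\<bar> * B)"
    by (intro sum_mono mult_left_mono assms(2)) auto
  also have "\<dots> \<le> 2 * B"
    using assms(1) B by (auto simp: am_coeff_def eval_nat_numeral)
  finally show ?thesis .
qed

lemma norm_am_mean_le_sum:
  assumes "\<nu> \<in> {3, 4}"
  shows "norm (am_mean \<nu> x n) \<le> (\<Sum>j<\<nu>. norm (x (n - j)))"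
proof -
  have "norm (am_mean \<nu> x n) \<le> (\<Sum>j<\<nu>. \<bar>am_coeff \<nu> j\<bar> * norm (x (n - j)))"
    unfolding am_mean_def by (rule order_trans[OF norm_sum]) simp
  also have "\<dots> \<le> (\<Sum>j<\<nu>. 1 * norm (x (n - j)))"
    using assms by (intro sum_mono mult_right_mono) (auto simp: am_coeff_def eval_nat_numeral less_Suc_eq)
  finally show ?thesis by simp
qed

lemma young_quarter_left: "(a::real) * b \<le> a\<^sup>2 / 4 + b\<^sup>2"
  using zero_le_power2[of "a/2 - b"] by (simp add: power2_eq_square algebra_simps)

text \<open>
  The energy is not coercive in \<open>u n\<close> alone, but the defect at the previous index carries a factor
  that is small enough to be absorbed when the maximum over all indices is taken.
\<close>

lemma am_energy_lower:
  assumes "\<nu> \<in> {3, 4}"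
  shows "3/8 * (norm (u n))\<^sup>2 - (norm (u (n - 1)))\<^sup>2 / 8 - (norm (bdiff (bdiff u) n))\<^sup>2 \<le> am_energy \<nu> u n"
proof -
  have d: "(norm (bdiff u n))\<^sup>2 \<le> 2 * (norm (u n))\<^sup>2 + 2 * (norm (u (n - 1)))\<^sup>2"
    using zero_le_power2[of "norm (u n + u (n - 1))"] unfolding bdiff_def
    by (simp add: power2_norm_eq_inner inner_diff inner_add inner_commute algebra_simps)
  have "inner (bdiff u n) (bdiff (bdiff u) n) \<le> norm (bdiff u n) * norm (bdiff (bdiff u) n)"
    by (rule norm_cauchy_schwarz)
  also have "\<dots> \<le> (norm (bdiff u n))\<^sup>2 / 4 + (norm (bdiff (bdiff u) n))\<^sup>2"
    by (rule young_quarter_left)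
  finally have i: "inner (bdiff u n) (bdiff (bdiff u) n) \<le> (norm (bdiff u n))\<^sup>2 / 4 + (norm (bdiff (bdiff u) n))\<^sup>2" .
  show ?thesis
    using d i zero_le_power2[of "norm (bdiff u n)"] zero_le_power2[of "norm (u n)"] zero_le_power2[of "norm (u (n-1))"] zero_le_power2[of "norm (bdiff (bdiff u) n)"]
    unfolding am_energy_def am_kappa_def by (cases "\<nu> = 3"; simp; linarith)
qed

lemma am_energy_upper:
  assumes "\<nu> \<in> {3, 4}" "(norm (u n))\<^sup>2 \<le> B" "(norm (u (n - 1)))\<^sup>2 \<le> B" "(norm (u (n - 2)))\<^sup>2 \<le> B"
  shows "am_energy \<nu> u n \<le> 2 * B"
proof -
  define b where "b = sqrt B"
  have B: "B = b\<^sup>2" "0 \<le> b"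
    using order_trans[OF zero_le_power2 assms(2)] by (auto simp: b_def)
  have nb: "norm (u n) \<le> b" "norm (u (n - 1)) \<le> b" "norm (u (n - 2)) \<le> b"
    using assms(2-4) unfolding b_def by (auto intro: real_le_rsqrt)
  have d: "norm (bdiff u n) \<le> 2 * b" "norm (bdiff u (n - 1)) \<le> 2 * b"
    using norm_triangle_ineq4[of "u n" "u (n - 1)"] norm_triangle_ineq4[of "u (n - 1)" "u (n - 2)"] nb
    by (auto simp: bdiff_def numeral_2_eq_2)
  have w: "norm (bdiff (bdiff u) n) \<le> 4 * b"
    using norm_triangle_ineq4[of "bdiff u n" "bdiff u (n - 1)"] d by (simp add: bdiff_def[of "bdiff u"])
  have "\<bar>inner (bdiff u n) (bdiff (bdiff u) n)\<bar> \<le> norm (bdiff u n) * norm (bdiff (bdiff u) n)"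
    by (rule Cauchy_Schwarz_ineq2)
  also have "\<dots> \<le> (2 * b) * (4 * b)" by (intro mult_mono d w) (use B in auto)
  finally have i: "\<bar>inner (bdiff u n) (bdiff (bdiff u) n)\<bar> \<le> 8 * B" by (simp add: B power2_eq_square)
  show ?thesis
    using i assms(2) zero_le_power2[of "norm (bdiff u n)"] zero_le_power2[of b] B(1)
    unfolding am_energy_def am_kappa_def by (cases "\<nu> = 3"; simp; linarith)
qed

text \<open>
  For a single step the new value enters with the positive leading coefficient of the mean, so it
  is controlled by the preceding values at the cost of a large constant. This suffices for boundedly
  many steps only.
\<close>

lemma am_increment_lower:
  assumes "\<nu> \<in> {3, 4}" "\<And>j. 1 \<le> j \<Longrightarrow> j < \<nu> \<Longrightarrow> (norm (u (n - j)))\<^sup>2 \<le> B"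
  shows "(norm (u n))\<^sup>2 / 4 - 40 * B \<le> inner (bdiff u n) (am_mean \<nu> u n)"
proof -
  define b where "b = sqrt B"
  have "(norm (u (n - 1)))\<^sup>2 \<le> B" using assms by auto
  from order_trans[OF zero_le_power2 this] have B: "B = b\<^sup>2" "0 \<le> b"
    by (auto simp: b_def)
  have nb: "norm (u (n - j)) \<le> b" if "1 \<le> j" "j < \<nu>" for j
    using assms(2)[OF that] unfolding b_def by (auto intro: real_le_rsqrt)
  define y where "y = am_mean \<nu> u n - am_coeff \<nu> 0 *\<^sub>R u n"
  have "y = (\<Sum>j\<in>{1..<\<nu>}. am_coeff \<nu> j *\<^sub>R u (n - j))"
    using assms(1) by (auto simp: y_def am_mean_def sum.atLeast_Suc_lessThan lessThan_atLeast0)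
  then have "norm y \<le> (\<Sum>j\<in>{1..<\<nu>}. \<bar>am_coeff \<nu> j\<bar> * norm (u (n - j)))"
    using norm_sum[of "\<lambda>j. am_coeff \<nu> j *\<^sub>R u (n - j)" "{1..<\<nu>}"] by simp
  also have "\<dots> \<le> (\<Sum>j\<in>{1..<\<nu>}. 1 * b)"
    using assms(1) nb B(2)
    by (intro sum_mono mult_mono) (auto simp: am_coeff_def eval_nat_numeral less_Suc_eq)
  also have "\<dots> \<le> 3 * b" using assms(1) B(2) by auto
  finally have y: "norm y \<le> 3 * b" .
  have c: "3/8 \<le> am_coeff \<nu> 0" "am_coeff \<nu> 0 \<le> 1"
    using assms(1) by (auto simp: am_coeff_def)
  have eq: "inner (bdiff u n) (am_mean \<nu> u n) =
     am_coeff \<nu> 0 * (norm (u n))\<^sup>2 + inner (u n) y - am_coeff \<nu> 0 * inner (u (n - 1)) (u n) - inner (u (n - 1)) y"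
    by (simp add: y_def bdiff_def power2_norm_eq_inner inner_diff algebra_simps)
  define z where "z = norm (u n)"
  have 1: "\<bar>inner (u n) y\<bar> \<le> z * (3 * b)"
    by (rule order_trans[OF Cauchy_Schwarz_ineq2]) (auto simp: z_def intro!: mult_mono y)
  have b1: "norm (u (n - 1)) \<le> b" using nb assms(1) by auto
  have "\<bar>inner (u (n - 1)) (u n)\<bar> \<le> b * z"
    by (rule order_trans[OF Cauchy_Schwarz_ineq2]) (use b1 B(2) in \<open>auto simp: z_def intro!: mult_mono\<close>)
  then have 2: "am_coeff \<nu> 0 * \<bar>inner (u (n - 1)) (u n)\<bar> \<le> 1 * (b * z)"
    using c B(2) by (intro mult_mono) (auto simp: z_def)
  have 3: "\<bar>inner (u (n - 1)) y\<bar> \<le> b * (3 * b)"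
    by (rule order_trans[OF Cauchy_Schwarz_ineq2]) (use b1 y B(2) in \<open>auto intro!: mult_mono\<close>)
  have 4: "am_coeff \<nu> 0 * z\<^sup>2 \<ge> 3/8 * z\<^sup>2" using c by (intro mult_right_mono) auto
  have 5: "am_coeff \<nu> 0 * inner (u (n - 1)) (u n) \<le> b * z"
    using order_trans[OF mult_left_mono[OF abs_ge_self] 2] c by simp
  have "4 * (z * b) \<le> z\<^sup>2/8 + 32 * b\<^sup>2"
    using zero_le_power2[of "z - 16 * b"] by (simp add: power2_eq_square algebra_simps)
  then have "z\<^sup>2 / 4 - 40 * b\<^sup>2 \<le> 3/8 * z\<^sup>2 - 3 * (z * b) - b * z - 3 * b\<^sup>2"
    using mult.commute[of b z] zero_le_power2[of b] by linarith
  then show ?thesis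
    using eq 1 3 4 5 B(1) unfolding z_def by (simp add: power2_eq_square algebra_simps)
qed

section \<open>Energy estimate for the stabilized scheme in an inner product space\<close>

text \<open>
  Here \<open>v\<close> and \<open>g\<close> stand for the iterates and their images under the skew operator, which enters the
  scheme through linear combinations of these vectors.
\<close>

locale am_sequences =
  fixes \<nu> :: nat and \<tau> \<delta> :: real and v g :: "nat \<Rightarrow> 'a::real_inner"
  assumes nu: "\<nu> \<in> {3, 4}" and tau_pos: "\<tau> > 0" and delta_pos: "\<delta> > 0"
begin

abbreviation "p \<equiv> first_index \<nu>"

definition u :: "nat \<Rightarrow> 'a" where
  "u n = v n + \<delta> *\<^sub>R g n"

definition residual :: "nat \<Rightarrow> 'a" where
  "residual n = bdiff v n /\<^sub>R \<tau> + am_mean \<nu> g n"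

text \<open>
  This is \<open>P\<^sub>\<delta> V\<close>: as \<open>T\<^sub>\<delta>\<close> is linear and independent of time, it commutes with \<open>S\<^sub>\<delta>\<close> and the test
  function is \<open>S\<^sub>\<delta>\<close> applied to \<open>u = T\<^sub>\<delta> V\<close>.
\<close>

definition supg_test :: "nat \<Rightarrow> 'a" where
  "supg_test n = am_mean \<nu> u n + (\<delta> / \<tau>) *\<^sub>R bdiff u n"

definition init :: real where
  "init = (\<Sum>j<p. (norm (u j))\<^sup>2)"

definition dissipation :: "nat \<Rightarrow> real" where
  "dissipation m = \<tau> * \<delta> * (\<Sum>n=p..m. (norm (residual n))\<^sup>2)"

text \<open>
  The square of the norm against which the load is measured by duality. The additional \<open>0\<close> makes the
  maximum meaningful for \<open>m < p\<close>, where the energy reduces to the initial part.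
\<close>

definition energy :: "nat \<Rightarrow> real" where
  "energy m = init + Max (insert 0 ((\<lambda>n. (norm (u n))\<^sup>2) ` {p..m})) + dissipation m"

lemma p_eq: "2 \<le> p" "p \<le> 3" "\<nu> = Suc p"
  using nu by (auto simp: first_index_def)

lemma am_mean_u: "am_mean \<nu> u n = am_mean \<nu> v n + \<delta> *\<^sub>R am_mean \<nu> g n"
  by (simp add: am_mean_def u_def scaleR_sum_right sum.distrib scaleR_add_right mult.commute)

lemma bdiff_u: "bdiff u n = bdiff v n + \<delta> *\<^sub>R bdiff g n"
  by (simp add: bdiff_def u_def scaleR_diff_right)

lemma dissipation_nonneg: "0 \<le> dissipation m"
  using tau_pos delta_pos by (auto simp: dissipation_def intro!: mult_nonneg_nonneg sum_nonneg)

lemma dissipation_mono: "m \<le> k \<Longrightarrow> dissipation m \<le> dissipation k"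
  unfolding dissipation_def using tau_pos delta_pos by (intro mult_left_mono sum_mono2) auto

lemma init_nonneg: "0 \<le> init" by (simp add: init_def sum_nonneg)

lemma energy_mono: "m \<le> k \<Longrightarrow> energy m \<le> energy k"
  unfolding energy_def by (intro add_mono order_refl Max_mono dissipation_mono) auto

lemma norm_u_le_energy:
  assumes "j \<le> m"
  shows "(norm (u j))\<^sup>2 \<le> energy m"
proof (cases "j < p")
  case True
  then have "(norm (u j))\<^sup>2 \<le> (\<Sum>j<p. (norm (u j))\<^sup>2)"
    by (intro member_le_sum) auto
  moreover have "0 \<le> Max (insert 0 ((\<lambda>n. (norm (u n))\<^sup>2) ` {p..m}))" by simp
  ultimately show ?thesis unfolding energy_def init_def using dissipation_nonneg[of m] by linarith
next
  case False
  then have "(norm (u j))\<^sup>2 \<le> Max (insert 0 ((\<lambda>n. (norm (u n))\<^sup>2) ` {p..m}))"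
    using assms by (intro Max_ge) auto
  then show ?thesis unfolding energy_def using dissipation_nonneg[of m] init_nonneg by linarith
qed

lemma energy_nonneg: "0 \<le> energy m"
  using order_trans[OF zero_le_power2 norm_u_le_energy[of 0 m]] by simp

lemma energy_Suc_le:
  assumes "p \<le> n"
  shows "energy n \<le> energy (n - 1) + (norm (u n))\<^sup>2 + dissipation n"
proof -
  have "{p..n} = insert n {p..n - 1}" using assms p_eq(1) by auto
  then have "insert 0 ((\<lambda>n. (norm (u n))\<^sup>2) ` {p..n})
     = insert ((norm (u n))\<^sup>2) (insert 0 ((\<lambda>n. (norm (u n))\<^sup>2) ` {p..n - 1}))" by auto
  then have "Max (insert 0 ((\<lambda>n. (norm (u n))\<^sup>2) ` {p..n}))
     = max ((norm (u n))\<^sup>2) (Max (insert 0 ((\<lambda>n. (norm (u n))\<^sup>2) ` {p..n - 1})))"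
    by simp
  also have "\<dots> \<le> (norm (u n))\<^sup>2 + Max (insert 0 ((\<lambda>n. (norm (u n))\<^sup>2) ` {p..n - 1}))"
    by simp
  finally show ?thesis using dissipation_nonneg[of "n - 1"] unfolding energy_def by linarith
qed

lemma abs_increment_le:
  assumes "k \<le> n"
  shows "\<bar>inner (bdiff u k) (am_mean \<nu> u k)\<bar> \<le> 4 * energy n"
proof -
  have b: "norm (u j) \<le> sqrt (energy n)" if "j \<le> n" for j
    using norm_u_le_energy[OF that] by (rule real_le_rsqrt)
  have 1: "norm (bdiff u k) \<le> 2 * sqrt (energy n)"
    using norm_triangle_ineq4[of "u k" "u (k - 1)"] b[of k] b[of "k - 1"] assms unfolding bdiff_def by linarith
  have 2: "norm (am_mean \<nu> u k) \<le> 2 * sqrt (energy n)"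
    using assms by (intro norm_am_mean_le nu b) auto
  have "norm (bdiff u k) * norm (am_mean \<nu> u k) \<le> (2 * sqrt (energy n)) * (2 * sqrt (energy n))"
    using energy_nonneg[of n] by (intro mult_mono 1 2) auto
  also have "\<dots> = 4 * energy n" using energy_nonneg[of n] by simp
  finally show ?thesis using Cauchy_Schwarz_ineq2 order_trans by blast
qed

end

text \<open>
  The number \<open>\<theta>\<close> is a multiple of \<open>\<tau> / h\<close>. In this form the mesh size disappears: the inverse
  estimate by the residual and \<open>\<delta> \<lesssim> h\<close> become \<open>inverse_est\<close> and \<open>theta_le\<close>.
\<close>

locale am_supg_sequences = am_sequences +
  fixes N :: nat and C L D \<theta> :: real and r :: "nat \<Rightarrow> 'a"
  assumes params: "C \<ge> 0" "L \<ge> 0" "D \<ge> 0" "\<theta> \<ge> 0"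
    and skew: "\<And>i j. i \<le> N \<Longrightarrow> j \<le> N \<Longrightarrow> inner (g i) (v j) = - inner (v i) (g j)"
    and galerkin: "\<And>n j. n \<in> {p..N} \<Longrightarrow> j \<le> N \<Longrightarrow> inner (residual n) (u j) = inner (r n) (u j)"
    and inverse_est: "\<And>n. n \<in> {p..N} \<Longrightarrow> norm (bdiff g n) \<le> \<theta> * norm (residual n)"
    and tau_le: "\<tau> \<le> C * \<delta>"
    and theta_le: "\<delta> * \<theta> \<le> L * \<tau>"
    and dual: "\<And>m. m \<in> {p..N} \<Longrightarrow> \<tau> * (\<Sum>n=p..m. inner (r n) (supg_test n)) \<le> D * sqrt (energy m)"
begin

lemmas pos = tau_pos delta_pos params

lemma skew_mean:
  assumes "n \<le> N" "k \<le> N"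
  shows "inner (am_mean \<nu> g n) (v k) = - inner (am_mean \<nu> v n) (g k)"
  using assms by (simp add: am_mean_def inner_sum_left skew sum_negf)

lemma skew_mean_mean:
  assumes "n \<le> N"
  shows "inner (am_mean \<nu> g n) (am_mean \<nu> v n) = 0"
proof -
  have "inner (am_mean \<nu> g n) (am_mean \<nu> v n) = (\<Sum>j<\<nu>. am_coeff \<nu> j * inner (am_mean \<nu> g n) (v (n - j)))"
    by (simp add: am_mean_def[of _ v] inner_sum_right)
  also have "\<dots> = - (\<Sum>j<\<nu>. am_coeff \<nu> j * inner (am_mean \<nu> v n) (g (n - j)))"
    using assms by (simp add: skew_mean sum_negf)
  also have "\<dots> = - inner (am_mean \<nu> v n) (am_mean \<nu> g n)"
    by (simp add: am_mean_def[of _ g] inner_sum_right)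
  finally show ?thesis by (simp add: inner_commute)
qed

lemma norm_skew:
  assumes "inner a b = 0"
  shows "(norm (a + \<delta> *\<^sub>R b))\<^sup>2 = (norm a)\<^sup>2 + \<delta>\<^sup>2 * (norm b)\<^sup>2"
  unfolding power2_norm_eq_inner
  using assms by (simp add: inner_add inner_commute[of b a] power2_eq_square)

lemma galerkin_supg_test:
  assumes "n \<in> {p..N}"
  shows "inner (r n) (supg_test n) = inner (residual n) (supg_test n)"
proof -
  have "inner (r n) (u j) = inner (residual n) (u j)" if "j \<le> n" for j
    using galerkin[OF assms, of j] that assms by simp
  then show ?thesis
    by (simp add: supg_test_def am_mean_def bdiff_def inner_add_right inner_diff_right inner_sum_right)
qed

text \<open>
  Decompose \<open>supg_test n\<close> into \<open>\<delta>\<close> times the residual plus the means and differences of \<open>v\<close> and \<open>g\<close>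
  that are not part of it. By skewness a mean of \<open>g\<close> is orthogonal to the mean of \<open>v\<close>, a difference of
  \<open>v\<close> to that of \<open>g\<close>, and the cross terms between means and differences cancel in
  \<open>inner (bdiff u n) (am_mean \<nu> u n)\<close>.
\<close>

lemma energy_balance:
  assumes n: "n \<in> {p..N}"
  shows "\<tau> * inner (r n) (supg_test n) = \<tau> * \<delta> * (norm (residual n))\<^sup>2 + inner (bdiff u n) (am_mean \<nu> u n)"
proof -
  have nN: "n \<le> N" "n - 1 \<le> N" using n by auto
  define dv dg mv mg where "dv = bdiff v n" and "dg = bdiff g n" and "mv = am_mean \<nu> v n"
    and "mg = am_mean \<nu> g n"
  have h1: "inner mg mv = 0" using skew_mean_mean nN by (simp add: mg_def mv_def)
  have s0: "inner (v i) (g i) = 0" if "i \<le> N" for i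
    using skew[OF that that] by (simp add: inner_commute)
  have h2: "inner dv dg = 0"
    using s0[OF nN(1)] s0[OF nN(2)] skew[OF nN(1) nN(2)]
    by (simp add: dv_def dg_def bdiff_def inner_diff inner_commute)
  have h3: "inner mg dv = - inner mv dg"
    using nN by (simp add: mg_def mv_def dv_def dg_def bdiff_def inner_diff_right skew_mean)
  have "\<tau> * inner (dv /\<^sub>R \<tau> + mg) (mv + \<delta> *\<^sub>R mg + (\<delta> / \<tau>) *\<^sub>R (dv + \<delta> *\<^sub>R dg))
     = \<tau> * \<delta> * (norm (dv /\<^sub>R \<tau> + mg))\<^sup>2 + inner (dv + \<delta> *\<^sub>R dg) (mv + \<delta> *\<^sub>R mg)"
    unfolding power2_norm_eq_inner
    using pos(1) h1 h2 h3 inner_commute[of dv mg] inner_commute[of mv dg] inner_commute[of dg mg]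
    by (simp add: inner_add field_simps power2_eq_square)
  then show ?thesis
    unfolding galerkin_supg_test[OF n]
    by (simp add: residual_def supg_test_def am_mean_u bdiff_u dv_def dg_def mv_def mg_def)
qed

lemma summed_balance:
  assumes "m \<in> {p..N}"
  shows "dissipation m + (\<Sum>n=p..m. inner (bdiff u n) (am_mean \<nu> u n)) \<le> D * sqrt (energy m)"
proof -
  have "\<tau> * (\<Sum>n=p..m. inner (r n) (supg_test n)) =
      (\<Sum>n=p..m. \<tau> * \<delta> * (norm (residual n))\<^sup>2 + inner (bdiff u n) (am_mean \<nu> u n))"
    using assms by (auto simp: sum_distrib_left energy_balance intro!: sum.cong)
  also have "\<dots> = dissipation m + (\<Sum>n=p..m. inner (bdiff u n) (am_mean \<nu> u n))"
    by (simp add: sum.distrib dissipation_def sum_distrib_left)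
  finally show ?thesis using dual[OF assms] by simp
qed

lemma startup_step:
  assumes n: "n \<in> {p..N}" "n \<le> 6"
  shows "energy n \<le> 600 * (energy (n - 1) + D\<^sup>2)"
proof -
  define E where "E = energy (n - 1)"
  have E0: "0 \<le> E" by (simp add: E_def energy_nonneg)
  have n1: "1 \<le> n" using n p_eq by auto
  have incr: "(norm (u n))\<^sup>2 / 4 - 40 * E \<le> inner (bdiff u n) (am_mean \<nu> u n)"
  proof (rule am_increment_lower[OF nu])
    fix j assume "1 \<le> j" "j < \<nu>"
    then show "(norm (u (n - j)))\<^sup>2 \<le> E"
      unfolding E_def by (intro norm_u_le_energy) simp
  qed
  have ins: "{p..n} = insert n {p..n - 1}" using n1 n by auto
  have split: "(\<Sum>k=p..n. inner (bdiff u k) (am_mean \<nu> u k))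
     = inner (bdiff u n) (am_mean \<nu> u n) + (\<Sum>k=p..n - 1. inner (bdiff u k) (am_mean \<nu> u k))"
    unfolding ins by (subst sum.insert) (use n1 in auto)
  have "(\<Sum>k=p..n - 1. - (4 * E)) \<le> (\<Sum>k=p..n - 1. inner (bdiff u k) (am_mean \<nu> u k))"
  proof (rule sum_mono)
    fix k assume "k \<in> {p..n - 1}"
    then show "- (4 * E) \<le> inner (bdiff u k) (am_mean \<nu> u k)"
      using abs_increment_le[of k "n - 1"] unfolding E_def by auto
  qed
  \<comment> \<open>At most six earlier steps, as \<open>n \<le> 6\<close>; twice the first computed index is at most \<open>6\<close>.\<close>
  moreover have "real (Suc (n - 1) - p) * (4 * E) \<le> 6 * (4 * E)"
    using n E0 by (intro mult_right_mono) auto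
  ultimately have "- (24 * E) \<le> (\<Sum>k=p..n - 1. inner (bdiff u k) (am_mean \<nu> u k))"
    unfolding sum_constant card_atLeastAtMost by linarith
  with summed_balance[OF n(1)] incr
  have 1: "dissipation n + (norm (u n))\<^sup>2 / 4 \<le> D * sqrt (energy n) + 64 * E"
    unfolding split by linarith
  have "D * sqrt (energy n) \<le> 4 * D\<^sup>2 + energy n / 16"
    using zero_le_power2[of "2 * D - sqrt (energy n) / 4"] energy_nonneg[of n]
    by (simp add: power2_eq_square algebra_simps)
  moreover have "energy n \<le> E + (norm (u n))\<^sup>2 + dissipation n"
    unfolding E_def using n by (intro energy_Suc_le) simp
  ultimately have "3/4 * energy n \<le> 257 * E + 16 * D\<^sup>2"
    using 1 dissipation_nonneg[of n] by argo
  moreover have "0 \<le> D\<^sup>2" by simp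
  ultimately show ?thesis
    using E0 unfolding E_def[symmetric] distrib_left by linarith
qed

text \<open>
  Each of the first steps costs a fixed factor; before the first computed step the energy is the
  initial one.
\<close>

lemma startup:
  assumes "p \<le> Suc n" "n \<le> N" "n \<le> 6"
  shows "energy n \<le> 1200 ^ (Suc n - p) * (init + D\<^sup>2)"
  using assms
proof (induction n)
  case 0
  then show ?case using p_eq(1) by simp
next
  case (Suc n)
  show ?case
  proof (cases "p \<le> Suc n")
    case True
    define x where "x = (1200::real) ^ (Suc n - p)"
    have x: "1 \<le> x" "1200 ^ (Suc (Suc n) - p) = 1200 * x"
      using True by (auto simp: x_def Suc_diff_le)
    have IH: "energy n \<le> x * (init + D\<^sup>2)"
      using Suc True by (auto simp: x_def)
    have y: "init + D\<^sup>2 \<le> x * (init + D\<^sup>2)" "D\<^sup>2 \<le> init + D\<^sup>2"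
      using mult_right_mono[OF x(1), of "init + D\<^sup>2"] init_nonneg by auto
    have "energy (Suc n) \<le> 600 * (energy n + D\<^sup>2)"
      using startup_step[of "Suc n"] Suc.prems True by simp
    also have "\<dots> \<le> 1200 * (x * (init + D\<^sup>2))"
      using IH y by (simp add: algebra_simps)
    finally show ?thesis using x(2) by simp
  next
    case False
    then have "Suc (Suc n) = p" using Suc.prems by auto
    then show ?thesis by (auto simp: energy_def dissipation_def init_def)
  qed
qed

lemma young_quarter_right: "(a::real) * b \<le> a\<^sup>2 + b\<^sup>2 / 4"
  using zero_le_power2[of "a - b/2"] by (simp add: power2_eq_square algebra_simps)

text \<open>
  The differenced scheme gives \<open>wv = \<tau> dA - \<tau> dM\<close> for the second difference \<open>wv\<close> of \<open>v\<close>, where \<open>dA\<close>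
  and \<open>dM\<close> are the differences of the residuals and of the means of \<open>g\<close>. Estimating \<open>\<parallel>\<tau> dA\<parallel>\<^sup>2\<close>
  directly would give \<open>\<tau>\<^sup>2\<close> times squared residuals with a factor of order one, which is not small
  against the dissipation when \<open>\<tau>\<close> is comparable to \<open>\<delta>\<close>. Pairing with \<open>wv\<close> instead, the Galerkin
  equations trade \<open>dA\<close> for data, and every term left over carries a factor \<open>\<theta>\<close>.
\<close>

lemma second_difference_step:
  assumes n: "n \<in> {2 * p..N}" and th1: "\<theta> \<le> 1"
  defines "\<alpha> \<equiv> (\<Sum>j<\<nu>. norm (residual (n - j)))"
  shows "(norm (bdiff (bdiff u) n))\<^sup>2 \<le> 2 * \<tau>\<^sup>2 * (norm (r n) + norm (r (n - 1)))\<^sup>2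
           + 2 * (1 + C + L) * \<theta> * (\<tau> * \<delta>) * \<alpha>\<^sup>2"
proof -
  define wv wg wu where "wv = bdiff (bdiff v) n" and "wg = bdiff (bdiff g) n" and "wu = bdiff (bdiff u) n"
  define dA where "dA = residual n - residual (n - 1)"
  define dM where "dM = am_mean \<nu> (bdiff g) n"
  have idx: "n - j \<in> {p..N}" if "j < \<nu>" for j using that n p_eq by auto
  have jl: "0 < \<nu>" "1 < \<nu>" using nu by auto
  have n1: "n \<in> {p..N}" "n - 1 \<in> {p..N}" using idx[OF jl(1)] idx[OF jl(2)] by auto
  have wu: "wu = wv + \<delta> *\<^sub>R wg"
    by (simp add: wu_def wv_def wg_def bdiff_def u_def algebra_simps)
  have a0: "0 \<le> \<alpha>" by (simp add: \<alpha>_def sum_nonneg)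
  have "(\<Sum>j\<in>{0, 1}. norm (residual (n - j))) \<le> \<alpha>"
    unfolding \<alpha>_def using jl by (intro sum_mono2) auto
  then have a2: "norm (residual n) + norm (residual (n - 1)) \<le> \<alpha>" by simp
  have dA: "norm dA \<le> \<alpha>"
    using norm_triangle_ineq4[of "residual n" "residual (n - 1)"] a2 by (simp add: dA_def)
  have "norm wg \<le> norm (bdiff g n) + norm (bdiff g (n - 1))"
    unfolding wg_def by (subst bdiff_def) (rule norm_triangle_ineq4)
  also have "\<dots> \<le> \<theta> * norm (residual n) + \<theta> * norm (residual (n - 1))"
    by (intro add_mono inverse_est n1)
  also have "\<dots> \<le> \<theta> * \<alpha>"
    using mult_left_mono[OF a2 pos(6)] by (simp add: algebra_simps)
  finally have wg: "norm wg \<le> \<theta> * \<alpha>" .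
  have "norm dM \<le> (\<Sum>j<\<nu>. norm (bdiff g (n - j)))"
    unfolding dM_def by (rule norm_am_mean_le_sum[OF nu])
  also have "\<dots> \<le> (\<Sum>j<\<nu>. \<theta> * norm (residual (n - j)))"
    by (intro sum_mono inverse_est idx) auto
  finally have dM: "norm dM \<le> \<theta> * \<alpha>" by (simp add: \<alpha>_def sum_distrib_left)
  have "am_mean \<nu> g n - am_mean \<nu> g (n - 1) = dM"
    by (simp add: dM_def am_mean_def bdiff_def sum_subtractf scaleR_diff_right diff_commute)
  then have wv: "wv = \<tau> *\<^sub>R dA - \<tau> *\<^sub>R dM"
    using pos(1) unfolding wv_def dA_def residual_def
    by (auto simp: bdiff_def[of "bdiff v"] algebra_simps)
  have two: "n - 1 - 1 \<le> N" "n \<le> N" "n - 1 \<le> N" using n by auto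
  \<comment> \<open>Here the residuals are traded for data; it needs the full \<open>wu = T\<^sub>\<delta> wv\<close> as a test function.\<close>
  have gal: "inner dA wu = inner (r n - r (n - 1)) wu"
    unfolding dA_def wu_def bdiff_def
    using galerkin[OF n1(1)] galerkin[OF n1(2)] two
    by (simp add: inner_diff_left inner_diff_right)
  have s: "inner wv wg = 0"
  proof -
    have "inner (v i) (g i) = 0" if "i \<le> N" for i
      using skew[OF that that] by (simp add: inner_commute)
    then show ?thesis
      using two skew[OF two(2) two(3)] skew[OF two(2) two(1)] skew[OF two(3) two(1)]
      unfolding wv_def wg_def bdiff_def
      by (simp add: inner_diff inner_commute)
  qed
  define z where "z = norm wu"
  define \<rho> where "\<rho> = norm (r n) + norm (r (n - 1))"
  have z2: "z\<^sup>2 = (norm wv)\<^sup>2 + \<delta>\<^sup>2 * (norm wg)\<^sup>2"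
    unfolding z_def wu by (rule norm_skew[OF s])
  have "(norm wv)\<^sup>2 \<le> z\<^sup>2" using z2 by simp
  then have wvz: "norm wv \<le> z" by (rule power2_le_imp_le) (simp add: z_def)
  have "(norm wv)\<^sup>2 = \<tau> * inner dA wv - \<tau> * inner dM wv"
    by (subst (2 3) wv) (simp add: power2_norm_eq_inner wv inner_diff_left inner_diff_right algebra_simps inner_commute)
  also have "inner dA wv = inner (r n - r (n - 1)) wu - \<delta> * inner dA wg"
    using gal by (simp add: wu inner_add_right)
  finally have 1: "(norm wv)\<^sup>2 = \<tau> * inner (r n - r (n - 1)) wu - \<tau> * (\<delta> * inner dA wg) - \<tau> * inner dM wv"
    by (simp add: algebra_simps)
  have "inner (r n - r (n - 1)) wu \<le> norm (r n - r (n - 1)) * z"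
    unfolding z_def by (rule norm_cauchy_schwarz)
  also have "\<dots> \<le> \<rho> * z"
    unfolding \<rho>_def z_def by (intro mult_right_mono norm_triangle_ineq4) simp
  finally have 2: "\<tau> * inner (r n - r (n - 1)) wu \<le> \<tau> * (\<rho> * z)"
    using pos by (intro mult_left_mono) auto
  have "- inner dA wg \<le> norm dA * norm wg"
    using Cauchy_Schwarz_ineq2[of dA wg] by linarith
  also have "\<dots> \<le> \<alpha> * (\<theta> * \<alpha>)"
    by (intro mult_mono dA wg a0) simp
  finally have "\<tau> * (\<delta> * (- inner dA wg)) \<le> \<tau> * (\<delta> * (\<alpha> * (\<theta> * \<alpha>)))"
    using pos by (intro mult_left_mono) auto
  then have 3: "- (\<tau> * (\<delta> * inner dA wg)) \<le> \<theta> * (\<tau> * \<delta>) * \<alpha>\<^sup>2"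
    by (simp add: power2_eq_square algebra_simps)
  have "- inner dM wv \<le> norm dM * norm wv"
    using Cauchy_Schwarz_ineq2[of dM wv] by linarith
  also have "\<dots> \<le> (\<theta> * \<alpha>) * z"
    using a0 pos by (intro mult_mono dM wvz) auto
  finally have "\<tau> * (- inner dM wv) \<le> \<tau> * ((\<theta> * \<alpha>) * z)"
    using pos by (intro mult_left_mono) auto
  then have 4: "- (\<tau> * inner dM wv) \<le> (\<tau> * \<theta> * \<alpha>) * z" by (simp add: algebra_simps)
  have 5: "\<delta>\<^sup>2 * (norm wg)\<^sup>2 \<le> L * \<theta> * (\<tau> * \<delta>) * \<alpha>\<^sup>2"
  proof -
    have "\<delta>\<^sup>2 * (norm wg)\<^sup>2 \<le> \<delta>\<^sup>2 * (\<theta> * \<alpha>)\<^sup>2"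
      by (intro mult_left_mono power_mono wg) auto
    also have "\<dots> = (\<delta> * \<theta>) * (\<delta> * \<theta> * \<alpha>\<^sup>2)" by (simp add: power2_eq_square algebra_simps)
    also have "\<dots> \<le> (L * \<tau>) * (\<delta> * \<theta> * \<alpha>\<^sup>2)"
      using pos by (intro mult_right_mono theta_le) auto
    finally show ?thesis by (simp add: algebra_simps)
  qed
  have 6: "(\<tau> * \<theta> * \<alpha>)\<^sup>2 \<le> C * \<theta> * (\<tau> * \<delta>) * \<alpha>\<^sup>2"
  proof -
    have "(\<tau> * \<theta> * \<alpha>)\<^sup>2 = \<tau> * (\<theta> * (\<theta> * (\<tau> * \<alpha>\<^sup>2)))" by (simp add: power2_eq_square algebra_simps)
    also have "\<dots> \<le> (C * \<delta>) * (\<theta> * (1 * (\<tau> * \<alpha>\<^sup>2)))"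
      using pos th1 by (intro mult_mono tau_le) auto
    finally show ?thesis by (simp add: algebra_simps)
  qed
  have "z\<^sup>2 \<le> \<tau> * \<rho> * z + (\<tau> * \<theta> * \<alpha>) * z + (1 + L) * \<theta> * (\<tau> * \<delta>) * \<alpha>\<^sup>2"
    using z2 1 2 3 4 5 by (simp add: algebra_simps)
  moreover have "\<tau> * \<rho> * z \<le> (\<tau> * \<rho>)\<^sup>2 + z\<^sup>2 / 4" by (rule young_quarter_right)
  moreover have "(\<tau> * \<theta> * \<alpha>) * z \<le> (\<tau> * \<theta> * \<alpha>)\<^sup>2 + z\<^sup>2 / 4" by (rule young_quarter_right)
  ultimately have "z\<^sup>2 \<le> 2 * (\<tau> * \<rho>)\<^sup>2 + 2 * ((1 + C + L) * \<theta> * (\<tau> * \<delta>) * \<alpha>\<^sup>2)"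
    using 6 by (simp add: algebra_simps)
  then show ?thesis by (simp only: z_def wu_def \<rho>_def power_mult_distrib mult.assoc)
qed

lemma sum_shift_le:
  fixes f :: "nat \<Rightarrow> real"
  assumes "\<And>n. 0 \<le> f n" "j \<le> p"
  shows "(\<Sum>n=2*p..m. f (n - j)) \<le> (\<Sum>n=p..m. f n)"
proof -
  have inj: "inj_on (\<lambda>n. n - j) {2*p..m}"
    using assms(2) by (auto simp: inj_on_def)
  have "(\<Sum>n=2*p..m. f (n - j)) = sum f ((\<lambda>n. n - j) ` {2*p..m})"
    using sum.reindex[OF inj, of f] by simp
  also have "\<dots> \<le> (\<Sum>n=p..m. f n)"
    using assms by (intro sum_mono2) auto
  finally show ?thesis .
qed

lemma second_difference_sum:
  assumes m: "m \<le> N" and th1: "\<theta> \<le> 1"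
  shows "(\<Sum>n=2*p..m. (norm (bdiff (bdiff u) n))\<^sup>2) \<le> 8 * \<tau>\<^sup>2 * (\<Sum>n=p..m. (norm (r n))\<^sup>2)
           + 32 * (1 + C + L) * \<theta> * dissipation m"
proof -
  define K where "K = (1 + C + L) * \<theta> * (\<tau> * \<delta>)"
  have K0: "0 \<le> K" using pos by (simp add: K_def)
  define b where "b j = (\<Sum>n=2*p..m. (norm (residual (n - j)))\<^sup>2)" for j
  have bound: "(norm (bdiff (bdiff u) n))\<^sup>2 \<le> 4 * \<tau>\<^sup>2 * ((norm (r n))\<^sup>2 + (norm (r (n - 1)))\<^sup>2)
      + 8 * K * (\<Sum>j<\<nu>. (norm (residual (n - j)))\<^sup>2)" if n: "n \<in> {2*p..m}" for n
  proof -
    have 1: "(norm (r n) + norm (r (n - 1)))\<^sup>2 \<le> 2 * ((norm (r n))\<^sup>2 + (norm (r (n - 1)))\<^sup>2)"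
      using zero_le_power2[of "norm (r n) - norm (r (n - 1))"] by (simp add: power2_eq_square algebra_simps)
    have "(\<Sum>j<\<nu>. norm (residual (n - j)) * 1)\<^sup>2 \<le> (\<Sum>j<\<nu>. (norm (residual (n - j)))\<^sup>2) * (\<Sum>j<\<nu>. 1\<^sup>2)"
      by (rule Cauchy_Schwarz_ineq_sum)
    also have "\<dots> \<le> (\<Sum>j<\<nu>. (norm (residual (n - j)))\<^sup>2) * 4"
      using nu by (intro mult_left_mono sum_nonneg) auto
    finally have 2: "(\<Sum>j<\<nu>. norm (residual (n - j)))\<^sup>2 \<le> 4 * (\<Sum>j<\<nu>. (norm (residual (n - j)))\<^sup>2)" by simp
    have "(norm (bdiff (bdiff u) n))\<^sup>2 \<le> 2 * \<tau>\<^sup>2 * (norm (r n) + norm (r (n - 1)))\<^sup>2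
        + 2 * K * (\<Sum>j<\<nu>. norm (residual (n - j)))\<^sup>2"
      using second_difference_step[of n, OF _ th1] n m unfolding K_def by (simp add: algebra_simps)
    also have "\<dots> \<le> 2 * \<tau>\<^sup>2 * (2 * ((norm (r n))\<^sup>2 + (norm (r (n - 1)))\<^sup>2))
        + 2 * K * (4 * (\<Sum>j<\<nu>. (norm (residual (n - j)))\<^sup>2))"
      by (intro add_mono mult_left_mono 1 2) (use K0 in auto)
    finally show ?thesis by (simp add: mult.assoc algebra_simps)
  qed
  have "(\<Sum>n=2*p..m. (norm (bdiff (bdiff u) n))\<^sup>2) \<le>
     (\<Sum>n=2*p..m. 4 * \<tau>\<^sup>2 * ((norm (r n))\<^sup>2 + (norm (r (n - 1)))\<^sup>2)
      + 8 * K * (\<Sum>j<\<nu>. (norm (residual (n - j)))\<^sup>2))"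
    by (intro sum_mono bound)
  also have "\<dots> = 4 * \<tau>\<^sup>2 * ((\<Sum>n=2*p..m. (norm (r (n - 0)))\<^sup>2) + (\<Sum>n=2*p..m. (norm (r (n - 1)))\<^sup>2))
      + 8 * K * (\<Sum>j<\<nu>. \<Sum>n=2*p..m. (norm (residual (n - j)))\<^sup>2)"
    by (subst sum.swap) (simp add: sum.distrib sum_distrib_left distrib_left)
  also have "\<dots> \<le> 4 * \<tau>\<^sup>2 * ((\<Sum>n=p..m. (norm (r n))\<^sup>2) + (\<Sum>n=p..m. (norm (r n))\<^sup>2))
      + 8 * K * (\<Sum>j<\<nu>. \<Sum>n=p..m. (norm (residual n))\<^sup>2)"
    using p_eq K0 by (intro add_mono mult_left_mono sum_mono sum_shift_le) auto
  also have "\<dots> \<le> 8 * \<tau>\<^sup>2 * (\<Sum>n=p..m. (norm (r n))\<^sup>2) + 8 * K * (4 * (\<Sum>n=p..m. (norm (residual n))\<^sup>2))"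
    using p_eq K0 by (intro add_mono mult_left_mono) (auto intro!: mult_right_mono sum_nonneg)
  finally show ?thesis by (simp add: dissipation_def K_def algebra_simps)
qed

lemma telescope:
  fixes F :: "nat \<Rightarrow> real"
  assumes "a \<le> m"
  shows "(\<Sum>n=Suc a..m. F n - F (n - 1)) = F m - F a"
  using assms by (induction m) (auto simp: le_Suc_eq)

text \<open>
  Sum the balance from the first computed step. Up to index \<open>2 * p\<close> the increments are bounded by
  the energy there; after it the identity for the Adams--Moulton energy leaves second differences,
  which are those covered by \<open>second_difference_sum\<close>.
\<close>

lemma late_energy:
  assumes m: "m \<in> {Suc (2*p)..N}" and th1: "\<theta> \<le> 1"
  shows "3/8 * (norm (u m))\<^sup>2 + dissipation m \<le> (norm (u (m - 1)))\<^sup>2 / 8 + D * sqrt (energy m) + 30 * energy (2 * p)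
     + 3 * (\<Sum>n=2*p..m. (norm (bdiff (bdiff u) n))\<^sup>2)"
proof -
  define w where "w n = bdiff (bdiff u) n" for n
  define X where "X n = inner (bdiff u n) (am_mean \<nu> u n)" for n
  define W where "W = (\<Sum>n=2*p..m. (norm (w n))\<^sup>2)"
  have W0: "0 \<le> W" by (simp add: W_def sum_nonneg)
  have low: "am_energy \<nu> u n - am_energy \<nu> u (n - 1) - ((norm (w n))\<^sup>2 + (norm (w (n - 1)))\<^sup>2) \<le> X n"
    if "n \<in> {Suc (2*p)..m}" for n
  proof -
    have "X n = am_energy \<nu> u n - am_energy \<nu> u (n - 1) - (norm (w n))\<^sup>2 / 24
        + am_kappa \<nu> * inner (w n) (w (n - 1))"
      unfolding X_def w_def using that p_eq by (intro am_energy_identity nu) auto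
    moreover have "\<bar>inner (w n) (w (n - 1))\<bar> \<le> norm (w n) * norm (w (n - 1))"
      by (rule Cauchy_Schwarz_ineq2)
    moreover have "norm (w n) * norm (w (n - 1)) \<le> (norm (w n))\<^sup>2 / 4 + (norm (w (n - 1)))\<^sup>2"
      by (rule young_quarter_left)
    ultimately show ?thesis
      using zero_le_power2[of "norm (w n)"] zero_le_power2[of "norm (w (n - 1))"]
      unfolding am_kappa_def by (cases "\<nu> = 3"; simp; linarith)
  qed
  have s: "(\<Sum>n=Suc (2*p)..m. (norm (w (n - 1)))\<^sup>2) \<le> W" "(\<Sum>n=Suc (2*p)..m. (norm (w n))\<^sup>2) \<le> W"
  proof -
    have "(\<Sum>n=Suc (2*p)..m. (norm (w (n - 1)))\<^sup>2) = (\<Sum>n=2*p..m - 1. (norm (w n))\<^sup>2)"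
      using m by (intro sum.reindex_bij_witness[of _ Suc "\<lambda>n. n - 1"]) auto
    also have "\<dots> \<le> W" unfolding W_def by (intro sum_mono2) auto
    finally show "(\<Sum>n=Suc (2*p)..m. (norm (w (n - 1)))\<^sup>2) \<le> W" .
    show "(\<Sum>n=Suc (2*p)..m. (norm (w n))\<^sup>2) \<le> W" unfolding W_def by (intro sum_mono2) auto
  qed
  have "(\<Sum>n=Suc (2*p)..m. (am_energy \<nu> u n - am_energy \<nu> u (n - 1)) - ((norm (w n))\<^sup>2 + (norm (w (n - 1)))\<^sup>2))
      \<le> (\<Sum>n=Suc (2*p)..m. X n)"
    by (intro sum_mono low)
  then have late: "am_energy \<nu> u m - am_energy \<nu> u (2*p) - 2 * W \<le> (\<Sum>n=Suc (2*p)..m. X n)"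
    using s telescope[of "2*p" m "am_energy \<nu> u"] m
    by (simp add: sum_subtractf sum.distrib)
  have early: "- (16 * energy (2*p)) \<le> (\<Sum>n=p..2*p. X n)"
  proof -
    have "(\<Sum>n=p..2*p. - (4 * energy (2*p))) \<le> (\<Sum>n=p..2*p. X n)"
    proof (rule sum_mono)
      fix n assume "n \<in> {p..2*p}"
      then show "- (4 * energy (2*p)) \<le> X n"
        using abs_increment_le[of n "2*p"] unfolding X_def by auto
    qed
    moreover have "real (Suc (2*p) - p) * (4 * energy (2*p)) \<le> 4 * (4 * energy (2*p))"
      using energy_nonneg[of "2*p"] p_eq by (intro mult_right_mono) auto
    ultimately show ?thesis by simp
  qed
  have "{p..m} = {p..2*p} \<union> {Suc (2*p)..m}" "{p..2*p} \<inter> {Suc (2*p)..m} = {}"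
    using m by auto
  then have "(\<Sum>n=p..m. X n) = (\<Sum>n=p..2*p. X n) + (\<Sum>n=Suc (2*p)..m. X n)"
    by (simp add: sum.union_disjoint)
  with summed_balance[of m] m
  have bal: "dissipation m + (\<Sum>n=p..2*p. X n) + (\<Sum>n=Suc (2*p)..m. X n) \<le> D * sqrt (energy m)"
    unfolding X_def by auto
  have up: "am_energy \<nu> u (2*p) \<le> 2 * energy (2*p)"
    by (intro am_energy_upper nu norm_u_le_energy) auto
  have wm: "(norm (w m))\<^sup>2 \<le> W"
    unfolding W_def using m by (intro member_le_sum) auto
  have lo: "3/8 * (norm (u m))\<^sup>2 - (norm (u (m - 1)))\<^sup>2 / 8 - (norm (w m))\<^sup>2 \<le> am_energy \<nu> u m"
    unfolding w_def by (rule am_energy_lower[OF nu])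
  show ?thesis
    using bal early late up wm lo energy_nonneg[of "2*p"] unfolding W_def w_def by linarith
qed

text \<open>
  The smallness of \<open>\<theta>\<close> makes the second differences cost at most half of the dissipation. The
  rest is a bootstrap on the maximum of \<open>(norm (u n))\<^sup>2\<close>, where the load term is split so that only a
  small multiple of the final energy is left on the right-hand side.
\<close>

theorem stability:
  assumes small: "192 * (1 + C + L) * \<theta> \<le> 1" and N: "p \<le> N"
  shows "energy N \<le> 10000 * 1200 ^ 5 * (init + D\<^sup>2 + \<tau>\<^sup>2 * (\<Sum>n=p..N. (norm (r n))\<^sup>2))"
proof -
  define K :: real where "K = 1200 ^ 5"
  define RR where "RR = \<tau>\<^sup>2 * (\<Sum>n=p..N. (norm (r n))\<^sup>2)"
  have RR0: "0 \<le> RR" by (simp add: RR_def sum_nonneg)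
  have K1: "1 \<le> K" by (simp add: K_def)
  have start: "energy n \<le> K * (init + D\<^sup>2)" if "n \<le> 2 * p" "n \<le> N" "p \<le> n" for n
  proof -
    have "energy n \<le> 1200 ^ (Suc n - p) * (init + D\<^sup>2)"
      using that p_eq by (intro startup) auto
    also have "\<dots> \<le> K * (init + D\<^sup>2)"
      unfolding K_def using that p_eq init_nonneg
      by (intro mult_right_mono power_increasing) auto
    finally show ?thesis .
  qed
  have KI: "0 \<le> K * (init + D\<^sup>2)" using K1 init_nonneg by simp
  show ?thesis
  proof (cases "N \<le> 2 * p")
    case True
    have "energy N \<le> K * (init + D\<^sup>2)" using start True N by auto
    also have "\<dots> \<le> K * (init + D\<^sup>2 + RR)" using RR0 K1 by (intro mult_left_mono) auto
    also have "\<dots> \<le> 10000 * (K * (init + D\<^sup>2 + RR))"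
      using K1 RR0 init_nonneg by (auto intro!: mult_nonneg_nonneg)
    finally show ?thesis by (simp add: K_def RR_def)
  next
    case False
    \<comment> \<open>The number \<open>192\<close> makes \<open>3 * 32 * (1 + C + L) * \<theta>\<close> at most one half, which is what the absorption requires.\<close>
    have "\<theta> \<le> (1 + C + L) * \<theta>" using pos by (simp add: algebra_simps)
    then have th1: "\<theta> \<le> 1" using small pos(6) by linarith
    define Q where "Q = energy N"
    define Y where "Y = Max (insert 0 ((\<lambda>n. (norm (u n))\<^sup>2) ` {p..N}))"
    have Y: "(norm (u n))\<^sup>2 \<le> Y" if "n \<in> {p..N}" for n
      unfolding Y_def using that by (intro Max_ge) auto
    have Y0: "0 \<le> Y" by (simp add: Y_def)
    \<comment> \<open>The weights \<open>4\<close> and \<open>1/16\<close> split the load term; \<open>1/16\<close> lets the final energy be absorbed below.\<close>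
    define B where "B = 30 * (K * (init + D\<^sup>2)) + 24 * RR + 4 * D\<^sup>2"
    have B0: "0 \<le> B" using KI RR0 by (simp add: B_def)
    have bound: "3/8 * (norm (u m))\<^sup>2 + dissipation m / 2 \<le> Y / 8 + B + Q / 16" if m: "m \<in> {Suc (2*p)..N}" for m
    proof -
      have "D * sqrt (energy m) \<le> D * sqrt Q"
        unfolding Q_def using m pos by (intro mult_left_mono real_sqrt_le_mono energy_mono) auto
      also have "\<dots> \<le> 4 * D\<^sup>2 + Q / 16"
        using zero_le_power2[of "2 * D - sqrt Q / 4"] energy_nonneg[of N]
        by (simp add: Q_def power2_eq_square algebra_simps)
      finally have 1: "D * sqrt (energy m) \<le> 4 * D\<^sup>2 + Q / 16" .
      have 2: "energy (2*p) \<le> K * (init + D\<^sup>2)" using start[of "2*p"] False by auto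
      have "(\<Sum>n=2*p..m. (norm (bdiff (bdiff u) n))\<^sup>2) \<le> 8 * \<tau>\<^sup>2 * (\<Sum>n=p..m. (norm (r n))\<^sup>2)
           + 32 * (1 + C + L) * \<theta> * dissipation m"
        using m by (intro second_difference_sum th1) auto
      also have "\<dots> \<le> 8 * RR + dissipation m / 6"
      proof (rule add_mono)
        have "\<tau>\<^sup>2 * (\<Sum>n=p..m. (norm (r n))\<^sup>2) \<le> RR"
          unfolding RR_def using m by (intro mult_left_mono sum_mono2) auto
        then show "8 * \<tau>\<^sup>2 * (\<Sum>n=p..m. (norm (r n))\<^sup>2) \<le> 8 * RR" by simp
        have "32 * (1 + C + L) * \<theta> * dissipation m \<le> 1/6 * dissipation m"
          using small by (intro mult_right_mono dissipation_nonneg) (simp add: algebra_simps)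
        then show "32 * (1 + C + L) * \<theta> * dissipation m \<le> dissipation m / 6" by simp
      qed
      finally have 3: "(\<Sum>n=2*p..m. (norm (bdiff (bdiff u) n))\<^sup>2) \<le> 8 * RR + dissipation m / 6" .
      have 4: "(norm (u (m - 1)))\<^sup>2 \<le> Y" using m p_eq by (intro Y) auto
      show ?thesis
        using late_energy[OF m th1] 1 2 3 4 unfolding B_def by linarith
    qed
    have all: "3/8 * (norm (u m))\<^sup>2 \<le> Y / 8 + B + Q / 16" if m: "m \<in> {p..N}" for m
    proof (cases "m \<le> 2*p")
      case True
      have "(norm (u m))\<^sup>2 \<le> energy m" by (rule norm_u_le_energy) simp
      also have "\<dots> \<le> K * (init + D\<^sup>2)" using m True by (intro start) auto
      also have "\<dots> \<le> B" unfolding B_def using KI RR0 by simp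
      finally show ?thesis using Y0 energy_nonneg[of N] B0 unfolding Q_def by linarith
    next
      case False
      then have "m \<in> {Suc (2*p)..N}" using m by auto
      from bound[OF this] show ?thesis using dissipation_nonneg[of m] by linarith
    qed
    have "Y \<in> insert 0 ((\<lambda>n. (norm (u n))\<^sup>2) ` {p..N})" unfolding Y_def by (intro Max_in) auto
    then consider "Y = 0" | n where "n \<in> {p..N}" "Y = (norm (u n))\<^sup>2" by blast
    then have Yb: "3/8 * Y \<le> Y / 8 + B + Q / 16"
    proof cases
      case 1
      then show ?thesis using B0 energy_nonneg[of N] by (simp add: Q_def)
    next
      case 2
      then show ?thesis using all[of n] by simp
    qed
    have Db: "dissipation N / 2 \<le> Y / 8 + B + Q / 16"
      using order_trans[OF _ bound[of N], of "dissipation N / 2"] False by simp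
    have "Q = init + Y + dissipation N" by (simp add: Q_def energy_def init_def Y_def)
    then have "Q \<le> 16 * init + 200 * B" using Yb Db init_nonneg B0 by linarith
    also have "\<dots> \<le> 10000 * (K * (init + D\<^sup>2 + RR))"
    proof -
      have "init \<le> K * init" "D\<^sup>2 \<le> K * D\<^sup>2" "RR \<le> K * RR"
        using mult_right_mono[OF K1, of init] mult_right_mono[OF K1, of "D\<^sup>2"]
          mult_right_mono[OF K1, of RR] RR0 init_nonneg by simp_all
      then show ?thesis unfolding B_def distrib_left using init_nonneg RR0 zero_le_power2[of D]
        by linarith
    qed
    finally show ?thesis by (simp add: Q_def K_def RR_def)
  qed
qed
end

section \<open>Square integrable functions modulo null sets\<close>

definition square_integrable :: "(real^'d \<Rightarrow> real^'s) \<Rightarrow> bool" where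
  "square_integrable f \<longleftrightarrow> f \<in> borel_measurable lebesgue \<and> integrable lebesgue (\<lambda>x. (norm (f x))\<^sup>2)"

lemma square_integrable_inner:
  assumes "square_integrable f" "square_integrable g"
  shows "integrable lebesgue (\<lambda>x. inner (f x) (g x))"
proof (rule Bochner_Integration.integrable_bound)
  show "integrable lebesgue (\<lambda>x. (norm (f x))\<^sup>2 + (norm (g x))\<^sup>2)"
    using assms by (simp add: square_integrable_def)
  show "(\<lambda>x. inner (f x) (g x)) \<in> borel_measurable lebesgue"
    using assms by (auto simp: square_integrable_def)
  have "\<bar>inner a b\<bar> \<le> (norm a)\<^sup>2 + (norm b)\<^sup>2" for a b :: "real^'b"
  proof -
    have "\<bar>inner a b\<bar> \<le> norm a * norm b" by (rule Cauchy_Schwarz_ineq2)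
    also have "2 * (norm a * norm b) \<le> (norm a)\<^sup>2 + (norm b)\<^sup>2"
      using zero_le_power2[of "norm a - norm b"] by (simp add: power2_eq_square algebra_simps)
    then have "norm a * norm b \<le> (norm a)\<^sup>2 + (norm b)\<^sup>2"
      using mult_nonneg_nonneg[OF norm_ge_zero norm_ge_zero, of a b] by linarith
    finally show ?thesis .
  qed
  then show "AE x in lebesgue. norm (inner (f x) (g x)) \<le> norm ((norm (f x))\<^sup>2 + (norm (g x))\<^sup>2)"
    by simp
qed

lemma square_integrable_zero: "square_integrable (\<lambda>_. 0)"
  by (simp add: square_integrable_def)

lemma square_integrable_scaleR:
  assumes "square_integrable f"
  shows "square_integrable (\<lambda>x. c *\<^sub>R f x)"
  using assms by (auto simp: square_integrable_def power_mult_distrib)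

lemma square_integrable_add:
  assumes "square_integrable f" "square_integrable g"
  shows "square_integrable (\<lambda>x. f x + g x)"
proof -
  have "(\<lambda>x. (norm (f x + g x))\<^sup>2) = (\<lambda>x. (norm (f x))\<^sup>2 + 2 * inner (f x) (g x) + (norm (g x))\<^sup>2)"
    by (auto simp: power2_norm_eq_inner inner_add inner_commute)
  then show ?thesis
    using assms square_integrable_inner[OF assms] by (auto simp: square_integrable_def)
qed

lemma square_integrable_uminus: "square_integrable f \<Longrightarrow> square_integrable (\<lambda>x. - f x)"
  using square_integrable_scaleR[of f "-1"] by simp

lemma square_integrable_diff:
  assumes "square_integrable f" "square_integrable g"
  shows "square_integrable (\<lambda>x. f x - g x)"
  using square_integrable_add[OF assms(1) square_integrable_uminus[OF assms(2)]] by simp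

definition L2_rel :: "(real^'d \<Rightarrow> real^'s) \<Rightarrow> (real^'d \<Rightarrow> real^'s) \<Rightarrow> bool" where
  "L2_rel f g \<longleftrightarrow> square_integrable f \<and> square_integrable g \<and> (AE x in lebesgue. f x = g x)"

lemma L2_rel_trans:
  assumes "L2_rel f g" "L2_rel g h"
  shows "L2_rel f h"
proof -
  have "AE x in lebesgue. f x = g x" "AE x in lebesgue. g x = h x"
    using assms by (auto simp: L2_rel_def)
  then have "AE x in lebesgue. f x = h x" by eventually_elim simp
  with assms show ?thesis by (simp add: L2_rel_def)
qed

text \<open>
  The inner product theorem above needs a type with a definite inner product; passing to classes
  modulo null sets provides it. Functions on a domain enter through their extension by zero.
\<close>

quotient_type ('d, 's) L2 = "real^('d::finite) \<Rightarrow> real^('s::finite)" / partial: L2_rel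
proof (rule part_equivpI)
  show "\<exists>f. L2_rel f f"
    by (rule exI[of _ "\<lambda>_. 0"]) (simp add: L2_rel_def square_integrable_zero)
  show "symp L2_rel"
    by (auto simp: symp_def L2_rel_def eq_commute)
  show "transp L2_rel"
    using L2_rel_trans by (blast intro: transpI)
qed

lemma AE_eq_cong2:
  assumes "AE x in M. f x = f' x" "AE x in M. g x = g' x"
  shows "AE x in M. h (f x) (g x) = h (f' x) (g' x)"
  using assms by eventually_elim simp

instantiation L2 :: (finite, finite) real_vector
begin

lift_definition zero_L2 :: "('a, 'b) L2" is "\<lambda>_. 0"
  by (simp add: L2_rel_def square_integrable_zero)

lift_definition plus_L2 :: "('a, 'b) L2 \<Rightarrow> ('a, 'b) L2 \<Rightarrow> ('a, 'b) L2" is "\<lambda>f g x. f x + g x"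
  unfolding L2_rel_def by (auto intro: square_integrable_add AE_eq_cong2[where h="(+)"])

lift_definition minus_L2 :: "('a, 'b) L2 \<Rightarrow> ('a, 'b) L2 \<Rightarrow> ('a, 'b) L2" is "\<lambda>f g x. f x - g x"
  unfolding L2_rel_def by (auto intro: square_integrable_diff AE_eq_cong2[where h="(-)"])

lift_definition uminus_L2 :: "('a, 'b) L2 \<Rightarrow> ('a, 'b) L2" is "\<lambda>f x. - f x"
  by (auto simp: L2_rel_def square_integrable_uminus)

lift_definition scaleR_L2 :: "real \<Rightarrow> ('a, 'b) L2 \<Rightarrow> ('a, 'b) L2" is "\<lambda>c f x. c *\<^sub>R f x"
  unfolding L2_rel_def by (auto intro: square_integrable_scaleR AE_eq_cong2[where h="\<lambda>y _. c *\<^sub>R y" for c])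

instance
proof
  fix x y z :: "('a, 'b) L2" and a b :: real
  show "x + y + z = x + (y + z)"
    by transfer (auto simp: L2_rel_def add.assoc intro!: square_integrable_add)
  show "x + y = y + x"
    by transfer (auto simp: L2_rel_def add.commute intro!: square_integrable_add)
  show "0 + x = x"
    by transfer (auto simp: L2_rel_def)
  show "- x + x = 0"
    by transfer (auto simp: L2_rel_def square_integrable_zero)
  show "x - y = x + - y"
    by transfer (auto simp: L2_rel_def intro!: square_integrable_add square_integrable_diff square_integrable_uminus)
  show "a *\<^sub>R (x + y) = a *\<^sub>R x + a *\<^sub>R y"
    by transfer (auto simp: L2_rel_def scaleR_add_right intro!: square_integrable_add square_integrable_scaleR)
  show "(a + b) *\<^sub>R x = a *\<^sub>R x + b *\<^sub>R x"
    by transfer (auto simp: L2_rel_def scaleR_add_left intro!: square_integrable_add square_integrable_scaleR)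
  show "a *\<^sub>R b *\<^sub>R x = (a * b) *\<^sub>R x"
    by transfer (auto simp: L2_rel_def intro!: square_integrable_scaleR)
  show "1 *\<^sub>R x = x"
    by transfer (auto simp: L2_rel_def)
qed

end

instantiation L2 :: (finite, finite) real_inner
begin

lift_definition inner_L2 :: "('a, 'b) L2 \<Rightarrow> ('a, 'b) L2 \<Rightarrow> real" is
  "\<lambda>f g. LINT x | lebesgue. inner (f x) (g x)"
proof -
  fix f1 f2 g1 g2 :: "real^'a \<Rightarrow> real^'b"
  assume "L2_rel f1 f2" "L2_rel g1 g2"
  then show "(LINT x | lebesgue. inner (f1 x) (g1 x)) = (LINT x | lebesgue. inner (f2 x) (g2 x))"
    unfolding L2_rel_def square_integrable_def
    by (intro integral_cong_AE AE_eq_cong2[where h=inner]) auto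
qed

definition norm_L2 :: "('a, 'b) L2 \<Rightarrow> real" where "norm_L2 x = sqrt (inner x x)"
definition sgn_L2 :: "('a, 'b) L2 \<Rightarrow> ('a, 'b) L2" where "sgn_L2 x = x /\<^sub>R norm x"
definition dist_L2 :: "('a, 'b) L2 \<Rightarrow> ('a, 'b) L2 \<Rightarrow> real" where "dist_L2 x y = norm (x - y)"
definition uniformity_L2 :: "(('a, 'b) L2 \<times> ('a, 'b) L2) filter" where
  "uniformity_L2 = (INF e\<in>{0 <..}. principal {(x, y). dist x y < e})"
definition open_L2 :: "('a, 'b) L2 set \<Rightarrow> bool" where
  "open_L2 U \<longleftrightarrow> (\<forall>x\<in>U. \<forall>\<^sub>F (x', y) in uniformity. x' = x \<longrightarrow> y \<in> U)"

instance
proof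
  fix x y z :: "('a, 'b) L2" and a b :: real
  show "inner x y = inner y x"
    by transfer (auto simp: inner_commute)
  show "inner (x + y) z = inner x z + inner y z"
    by transfer (auto simp: L2_rel_def inner_add_left square_integrable_inner)
  show "inner (a *\<^sub>R x) y = a * inner x y"
    by transfer (auto simp: L2_rel_def)
  show "0 \<le> inner x x"
    by transfer (auto intro: integral_nonneg)
  show "inner x x = 0 \<longleftrightarrow> x = 0"
  proof (transfer, goal_cases)
    case (1 f)
    then show ?case
      by (subst integral_nonneg_eq_0_iff_AE)
        (auto simp: L2_rel_def square_integrable_inner square_integrable_zero)
  qed
  show "norm x = sqrt (inner x x)" by (rule norm_L2_def)
  show "sgn x = x /\<^sub>R norm x" by (rule sgn_L2_def)
  show "dist x y = norm (x - y)" by (rule dist_L2_def)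
  show "(uniformity :: (('a, 'b) L2 \<times> ('a, 'b) L2) filter) = (INF e\<in>{0 <..}. principal {(x, y). dist x y < e})"
    by (rule uniformity_L2_def)
  show "open U \<longleftrightarrow> (\<forall>x\<in>U. \<forall>\<^sub>F (x', y) in uniformity. x' = x \<longrightarrow> y \<in> U)" for U :: "('a, 'b) L2 set"
    by (rule open_L2_def)
qed

end

definition to_L2 :: "(real^'d) set \<Rightarrow> (real^'d \<Rightarrow> real^'s) \<Rightarrow> ('d::finite, 's::finite) L2" where
  "to_L2 \<Omega> U = abs_L2 (\<lambda>x. indicat_real \<Omega> x *\<^sub>R U x)"

lemma square_integrable_indicator:
  assumes \<Omega>: "\<Omega> \<in> sets lebesgue" and U: "U \<in> L2_space \<Omega>"
  shows "square_integrable (\<lambda>x. indicat_real \<Omega> x *\<^sub>R U x)"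
proof -
  have "(\<lambda>x. (norm (indicat_real \<Omega> x *\<^sub>R U x))\<^sup>2) = (\<lambda>x. indicat_real \<Omega> x *\<^sub>R (norm (U x))\<^sup>2)"
    by (auto simp: indicator_def)
  then show ?thesis
    using U \<Omega> unfolding L2_space_def square_integrable_def
    by (auto simp: borel_measurable_restrict_space_iff integrable_restrict_space)
qed

lemma L2_rel_indicator:
  assumes "\<Omega> \<in> sets lebesgue" "U \<in> L2_space \<Omega>"
  shows "L2_rel (\<lambda>x. indicat_real \<Omega> x *\<^sub>R U x) (\<lambda>x. indicat_real \<Omega> x *\<^sub>R U x)"
  using square_integrable_indicator[OF assms] by (simp add: L2_rel_def)

context
  fixes \<Omega> :: "(real^'d) set"
  assumes \<Omega>: "\<Omega> \<in> sets lebesgue"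
begin

lemma inner_to_L2:
  assumes "U \<in> L2_space \<Omega>" "W \<in> L2_space \<Omega>"
  shows "inner (to_L2 \<Omega> U) (to_L2 \<Omega> W) = L2_inner \<Omega> U W"
proof -
  have "inner (to_L2 \<Omega> U) (to_L2 \<Omega> W) =
     (LINT x | lebesgue. inner (indicat_real \<Omega> x *\<^sub>R U x) (indicat_real \<Omega> x *\<^sub>R W x))"
    unfolding to_L2_def by (rule inner_L2.abs_eq[OF L2_rel_indicator[OF \<Omega> assms(1)] L2_rel_indicator[OF \<Omega> assms(2)]])
  also have "\<dots> = (LINT x | lebesgue. indicat_real \<Omega> x *\<^sub>R (inner (U x) (W x)))"
    by (intro Bochner_Integration.integral_cong) (auto simp: indicator_def)
  finally show ?thesis
    using \<Omega> by (simp add: L2_inner_def integral_restrict_space)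
qed

lemma norm_to_L2:
  assumes "U \<in> L2_space \<Omega>"
  shows "norm (to_L2 \<Omega> U) = L2_norm \<Omega> U"
  unfolding norm_L2_def L2_norm_def by (simp add: inner_to_L2 assms)

lemma L2_space_add:
  assumes "U \<in> L2_space \<Omega>" "W \<in> L2_space \<Omega>"
  shows "(\<lambda>x. U x + W x) \<in> L2_space \<Omega>"
proof -
  have "square_integrable (\<lambda>x. indicat_real \<Omega> x *\<^sub>R U x + indicat_real \<Omega> x *\<^sub>R W x)"
    by (intro square_integrable_add square_integrable_indicator \<Omega> assms)
  then have s: "square_integrable (\<lambda>x. indicat_real \<Omega> x *\<^sub>R (U x + W x))"
    by (simp add: scaleR_add_right)
  have "(\<lambda>x. (norm (indicat_real \<Omega> x *\<^sub>R (U x + W x)))\<^sup>2) = (\<lambda>x. indicat_real \<Omega> x *\<^sub>R (norm (U x + W x))\<^sup>2)"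
    by (auto simp: indicator_def)
  with s \<Omega> show ?thesis unfolding L2_space_def square_integrable_def
    by (auto simp: borel_measurable_restrict_space_iff integrable_restrict_space)
qed

lemma L2_space_scaleR:
  assumes "U \<in> L2_space \<Omega>"
  shows "(\<lambda>x. c *\<^sub>R U x) \<in> L2_space \<Omega>"
  using assms unfolding L2_space_def by (auto simp: power_mult_distrib)

lemma to_L2_add:
  assumes "U \<in> L2_space \<Omega>" "W \<in> L2_space \<Omega>"
  shows "to_L2 \<Omega> (\<lambda>x. U x + W x) = to_L2 \<Omega> U + to_L2 \<Omega> W"
  unfolding to_L2_def
  by (subst plus_L2.abs_eq[OF L2_rel_indicator[OF \<Omega> assms(1)] L2_rel_indicator[OF \<Omega> assms(2)]])
    (simp add: scaleR_add_right)

lemma to_L2_scaleR: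
  assumes "U \<in> L2_space \<Omega>"
  shows "to_L2 \<Omega> (\<lambda>x. c *\<^sub>R U x) = c *\<^sub>R to_L2 \<Omega> U"
  unfolding to_L2_def
  by (subst scaleR_L2.abs_eq[OF L2_rel_indicator[OF \<Omega> assms]]) (simp add: mult.commute)

lemma L2_space_diff:
  assumes "U \<in> L2_space \<Omega>" "W \<in> L2_space \<Omega>"
  shows "(\<lambda>x. U x - W x) \<in> L2_space \<Omega>"
  using L2_space_add[OF assms(1) L2_space_scaleR[OF assms(2), of "-1"]] by simp

lemma to_L2_diff:
  assumes "U \<in> L2_space \<Omega>" "W \<in> L2_space \<Omega>"
  shows "to_L2 \<Omega> (\<lambda>x. U x - W x) = to_L2 \<Omega> U - to_L2 \<Omega> W"
  using to_L2_add[OF assms(1) L2_space_scaleR[OF assms(2), of "-1"]] to_L2_scaleR[OF assms(2), of "-1"]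
  by simp

lemma L2_space_zero: "(\<lambda>_. 0) \<in> L2_space \<Omega>"
  by (simp add: L2_space_def)

lemma L2_space_sum:
  assumes "\<And>i. i \<in> I \<Longrightarrow> U i \<in> L2_space \<Omega>"
  shows "(\<lambda>x. \<Sum>i\<in>I. U i x) \<in> L2_space \<Omega>"
  using assms by (induction I rule: infinite_finite_induct) (auto simp: L2_space_zero L2_space_add)

lemma to_L2_zero: "to_L2 \<Omega> (\<lambda>_. 0) = 0"
  using to_L2_scaleR[OF L2_space_zero, of 0] by simp

lemma to_L2_sum:
  assumes "\<And>i. i \<in> I \<Longrightarrow> U i \<in> L2_space \<Omega>"
  shows "to_L2 \<Omega> (\<lambda>x. \<Sum>i\<in>I. U i x) = (\<Sum>i\<in>I. to_L2 \<Omega> (U i))"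
  using assms
  by (induction I rule: infinite_finite_induct) (auto simp: to_L2_zero to_L2_add L2_space_sum)

lemma L2_space_matrix:
  fixes A :: "real^'s^'s"
  assumes "U \<in> L2_space \<Omega>"
  shows "(\<lambda>x. A *v U x) \<in> L2_space \<Omega>"
proof -
  obtain K where K: "\<And>x. norm (A *v x) \<le> norm x * K"
    using bounded_linear.bounded[OF matrix_vector_mul_bounded_linear[of A]] by blast
  have m: "(\<lambda>x. A *v U x) \<in> borel_measurable (lebesgue_on \<Omega>)"
  proof (rule measurable_compose[where f = U and g = "(*v) A" and N = borel])
    show "U \<in> borel_measurable (lebesgue_on \<Omega>)" using assms by (simp add: L2_space_def)
    show "(*v) A \<in> borel_measurable borel"
      by (intro borel_measurable_continuous_onI linear_continuous_on matrix_vector_mul_bounded_linear)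
  qed
  have "integrable (lebesgue_on \<Omega>) (\<lambda>x. (norm (A *v U x))\<^sup>2)"
  proof (rule Bochner_Integration.integrable_bound)
    show "integrable (lebesgue_on \<Omega>) (\<lambda>x. (norm (U x))\<^sup>2 * K\<^sup>2)"
      using assms by (simp add: L2_space_def)
    show "(\<lambda>x. (norm (A *v U x))\<^sup>2) \<in> borel_measurable (lebesgue_on \<Omega>)"
      using m by simp
    show "AE x in lebesgue_on \<Omega>. norm ((norm (A *v U x))\<^sup>2) \<le> norm ((norm (U x))\<^sup>2 * K\<^sup>2)"
    proof (rule AE_I2)
      fix x
      have "(norm (A *v U x))\<^sup>2 \<le> (norm (U x) * K)\<^sup>2" by (intro power_mono K) simp
      then show "norm ((norm (A *v U x))\<^sup>2) \<le> norm ((norm (U x))\<^sup>2 * K\<^sup>2)"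
        by (simp add: power_mult_distrib)
    qed
  qed
  with m show ?thesis by (simp add: L2_space_def)
qed

end

section \<open>Smooth bumps supported in boxes\<close>

lemma partial_deriv_eqI: "(f has_derivative f') (at x) \<Longrightarrow> partial_deriv i f x = f' (axis i 1)"
  unfolding partial_deriv_def by (simp add: frechet_derivative_at[symmetric])

lemma partial_deriv_const: "partial_deriv i (\<lambda>_. c) = (\<lambda>_. 0)"
  by (rule ext) (simp add: partial_deriv_eqI[OF has_derivative_const])

lemma C_k_const: "C_k k (\<lambda>_. c)"
  by (induction k arbitrary: c) (auto simp: partial_deriv_const)

lemma C_k_Suc_imp: "C_k (Suc k) f \<Longrightarrow> C_k k f"
proof (induction k arbitrary: f)
  case 0
  then show ?case
    by (auto intro!: continuous_at_imp_continuous_on differentiable_imp_continuous_within)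
next
  case (Suc k)
  then show ?case by (metis C_k.simps(2))
qed

lemma partial_deriv_add:
  assumes "f differentiable (at x)" "g differentiable (at x)"
  shows "partial_deriv i (\<lambda>x. f x + g x) x = partial_deriv i f x + partial_deriv i g x"
  using assms unfolding frechet_derivative_works
  by (subst partial_deriv_eqI[OF has_derivative_add]) (auto simp: partial_deriv_def)

lemma partial_deriv_mult:
  assumes "f differentiable (at x)" "g differentiable (at x)"
  shows "partial_deriv i (\<lambda>x. f x * g x) x = f x * partial_deriv i g x + partial_deriv i f x * g x"
  using assms unfolding frechet_derivative_works
  by (subst partial_deriv_eqI[OF has_derivative_mult]) (auto simp: partial_deriv_def)

lemma C_k_add: "C_k k f \<Longrightarrow> C_k k g \<Longrightarrow> C_k k (\<lambda>x. f x + g x)"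
proof (induction k arbitrary: f g)
  case 0
  then show ?case by (auto intro: continuous_on_add)
next
  case (Suc k)
  have "partial_deriv i (\<lambda>x. f x + g x) = (\<lambda>x. partial_deriv i f x + partial_deriv i g x)" for i
    using Suc.prems by (auto simp: partial_deriv_add)
  with Suc show ?case by auto
qed

lemma C_k_mult: "C_k k f \<Longrightarrow> C_k k g \<Longrightarrow> C_k k (\<lambda>x. f x * g x)"
proof (induction k arbitrary: f g)
  case 0
  then show ?case by (auto intro: continuous_on_mult)
next
  case (Suc k)
  have "partial_deriv i (\<lambda>x. f x * g x) = (\<lambda>x. f x * partial_deriv i g x + partial_deriv i f x * g x)" for i
    using Suc.prems by (auto simp: partial_deriv_mult)
  moreover have "C_k k f" "C_k k g" using Suc.prems by (auto intro: C_k_Suc_imp simp del: C_k.simps)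
  ultimately show ?case using Suc.prems by (auto intro!: C_k_add Suc.IH)
qed

lemma C_k_diff: "C_k k f \<Longrightarrow> C_k k g \<Longrightarrow> C_k k (\<lambda>x. f x - g x)"
  using C_k_add[of k f "\<lambda>x. - 1 * g x"] C_k_mult[OF C_k_const, of k g "-1"] by simp

lemma C_k_prod: "(\<And>i. i \<in> I \<Longrightarrow> C_k k (f i)) \<Longrightarrow> C_k k (\<lambda>x. \<Prod>i\<in>I. f i x)"
  by (induction I rule: infinite_finite_induct) (auto simp: C_k_const C_k_mult)

lemma C_k_coordinate: "C_k k (\<lambda>x. x $ j)"
proof (cases k)
  case (Suc l)
  have d: "((\<lambda>x :: real^'a. x $ j) has_derivative (\<lambda>x. x $ j)) (at x)" for x
    by (rule bounded_linear_imp_has_derivative[OF bounded_linear_vec_nth])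
  have "partial_deriv i (\<lambda>x :: real^'a. x $ j) = (\<lambda>_. axis i 1 $ j)" for i
    using partial_deriv_eqI[OF d] by auto
  with d show ?thesis unfolding Suc by (auto simp: C_k_const differentiable_def)
qed (auto intro: continuous_intros)

text \<open>
  The functions \<open>exp (- 1 / s) / s ^ n\<close>, extended by zero. The derivative of each is a linear
  combination of two others, so the family is closed under differentiation and smoothness of
  compositions follows by one induction over all \<open>n\<close>.
\<close>

definition flat :: "nat \<Rightarrow> real \<Rightarrow> real" where
  "flat n s = (if s > 0 then exp (- inverse s) * inverse s ^ n else 0)"

lemma flat_tendsto_0: "(flat n \<longlongrightarrow> 0) (at 0)"
proof (rule filterlim_split_at)
  have "eventually (\<lambda>s. flat n s = 0) (at_left 0)"
    by (auto simp: flat_def eventually_at_filter)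
  then show "(flat n \<longlongrightarrow> 0) (at_left 0)" by (rule tendsto_eventually)
  have "((\<lambda>s. inverse s ^ n / exp (inverse s)) \<longlongrightarrow> 0) (at_right (0::real))"
    by (rule filterlim_compose[OF tendsto_power_div_exp_0 filterlim_inverse_at_top_right])
  moreover have "eventually (\<lambda>s. inverse s ^ n / exp (inverse s) = flat n s) (at_right 0)"
    by (auto simp: flat_def eventually_at_filter exp_minus field_simps)
  ultimately show "(flat n \<longlongrightarrow> 0) (at_right 0)" by (rule Lim_transform_eventually)
qed

lemma flat_deriv: "(flat n has_real_derivative (flat (n + 2) s - real n * flat (n + 1) s)) (at s)"
proof -
  consider "s > 0" | "s < 0" | "s = 0" by linarith
  then show ?thesis
  proof cases
    case 1
    have "((\<lambda>s. exp (- inverse s) * inverse s ^ n) has_real_derivative (flat (n + 2) s - real n * flat (n + 1) s)) (at s)"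
      using 1 by (cases n) (auto intro!: derivative_eq_intros simp: flat_def field_simps power2_eq_square,
        metis One_nat_def power_eq_if)
    then show ?thesis
      by (rule has_field_derivative_transform_within_open[where S = "{0<..}"])
        (use 1 in \<open>auto simp: flat_def\<close>)
  next
    case 2
    have "((\<lambda>_. 0) has_real_derivative 0) (at s)" by simp
    then have "(flat n has_real_derivative 0) (at s)"
      by (rule has_field_derivative_transform_within_open[where S = "{..<0}"])
        (use 2 in \<open>auto simp: flat_def\<close>)
    with 2 show ?thesis by (simp add: flat_def)
  next
    case 3
    have "eventually (\<lambda>h. flat (n + 1) h = (flat n (0 + h) - flat n 0) / h) (at 0)"
      by (auto simp: flat_def eventually_at_filter field_simps)
    with flat_tendsto_0[of "n + 1"] have "(flat n has_real_derivative 0) (at 0)"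
      unfolding DERIV_def by (rule Lim_transform_eventually)
    with 3 show ?thesis by (simp add: flat_def)
  qed
qed

lemma C_k_flat: "C_k k q \<Longrightarrow> C_k k (\<lambda>x. flat n (q x))"
proof (induction k arbitrary: n)
  case 0
  have "continuous_on UNIV (flat n)"
    by (intro continuous_at_imp_continuous_on ballI DERIV_isCont[OF flat_deriv])
  with 0 show ?case by (auto intro: continuous_on_compose2)
next
  case (Suc k)
  have d: "((\<lambda>x. flat n (q x)) has_derivative
     (\<lambda>h. (flat (n + 2) (q x) - real n * flat (n + 1) (q x)) * frechet_derivative q (at x) h)) (at x)" for x
  proof -
    have "(flat n has_derivative (*) (flat (n + 2) (q x) - real n * flat (n + 1) (q x))) (at (q x))"
      using flat_deriv[of n "q x"] by (simp add: has_field_derivative_def)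
    moreover have "(q has_derivative frechet_derivative q (at x)) (at x)"
      using Suc.prems by (auto simp: frechet_derivative_works)
    ultimately show ?thesis by (rule has_derivative_compose[rotated])
  qed
  have "partial_deriv i (\<lambda>x. flat n (q x)) =
     (\<lambda>x. (flat (n + 2) (q x) - real n * flat (n + 1) (q x)) * partial_deriv i q x)" for i
    using partial_deriv_eqI[OF d] by (auto simp: partial_deriv_def)
  moreover have "C_k k q" using Suc.prems by (rule C_k_Suc_imp)
  ultimately show ?case
    using d Suc.prems by (auto simp: differentiable_def intro!: C_k_mult C_k_diff C_k_const Suc.IH)
qed

text \<open>
  Smooth functions that are positive exactly on the box with corners \<open>a\<close> and \<open>b\<close> and increase to its indicator
  function as \<open>m\<close> grows. Boxes rather than balls are used because they are stable under
  intersection.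
\<close>

definition box_bump :: "real^'d \<Rightarrow> real^'d \<Rightarrow> nat \<Rightarrow> real^'d \<Rightarrow> real" where
  "box_bump a b m x = (\<Prod>i\<in>UNIV. flat 0 (real (Suc m) * ((x $ i - a $ i) * (b $ i - x $ i))))"

lemma C_k_box_bump: "C_k k (box_bump a b m)"
proof -
  have "C_k k (\<lambda>x. \<Prod>i\<in>UNIV. flat 0 (real (Suc m) * ((x $ i - a $ i) * (b $ i - x $ i))))"
    by (intro C_k_prod C_k_flat C_k_mult C_k_const C_k_diff C_k_coordinate)
  then show ?thesis unfolding box_bump_def[abs_def] .
qed

lemma box_bump_nonzero_iff:
  assumes "box a b \<noteq> {}"
  shows "box_bump a b m x \<noteq> 0 \<longleftrightarrow> x \<in> box a b"
proof -
  have ab: "a $ i < b $ i" for i using assms by (simp add: interval_ne_empty_cart)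
  have "0 < real (Suc m) * ((x $ i - a $ i) * (b $ i - x $ i)) \<longleftrightarrow> a $ i < x $ i \<and> x $ i < b $ i" for i
    using ab[of i] by (auto simp: zero_less_mult_iff)
  then show ?thesis
    unfolding box_bump_def by (auto simp: flat_def mem_box_cart)
qed

lemma box_bump_range: "0 \<le> box_bump a b m x" "box_bump a b m x \<le> 1"
proof -
  have "0 \<le> flat 0 s" "flat 0 s \<le> 1" for s by (auto simp: flat_def)
  then show "0 \<le> box_bump a b m x" "box_bump a b m x \<le> 1"
    unfolding box_bump_def by (auto intro!: prod_nonneg prod_le_1)
qed

lemma box_bump_tendsto:
  assumes "box a b \<noteq> {}"
  shows "(\<lambda>m. box_bump a b m x) \<longlonglongrightarrow> indicator (box a b) x"
proof (cases "x \<in> box a b")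
  case True
  then have q: "0 < (x $ i - a $ i) * (b $ i - x $ i)" for i by (simp add: mem_box_cart)
  have "(\<lambda>m. flat 0 (real (Suc m) * ((x $ i - a $ i) * (b $ i - x $ i)))) \<longlonglongrightarrow> 1" for i
  proof -
    have "(\<lambda>m. exp (- (inverse (real (Suc m)) * inverse ((x $ i - a $ i) * (b $ i - x $ i))))) \<longlonglongrightarrow>
       exp (- (0 * inverse ((x $ i - a $ i) * (b $ i - x $ i))))"
      by (intro tendsto_intros LIMSEQ_inverse_real_of_nat)
    then show ?thesis using q[of i] by (simp add: flat_def inverse_mult_distrib)
  qed
  then have "(\<lambda>m. \<Prod>i\<in>UNIV. flat 0 (real (Suc m) * ((x $ i - a $ i) * (b $ i - x $ i)))) \<longlonglongrightarrow> (\<Prod>i\<in>(UNIV :: 'a set). 1)"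
    by (intro tendsto_prod)
  with True show ?thesis by (simp add: box_bump_def)
next
  case False
  then have "box_bump a b m x = 0" for m using box_bump_nonzero_iff[OF assms] by blast
  with False show ?thesis by simp
qed

lemma test_function_box_bump:
  assumes "box a b \<noteq> {}" "cbox a b \<subseteq> \<Omega>"
  shows "test_function \<Omega> (box_bump a b m)"
proof -
  have "{x. box_bump a b m x \<noteq> 0} = box a b" using box_bump_nonzero_iff[OF assms(1)] by auto
  then show ?thesis
    using assms by (auto simp: test_function_def C_k_box_bump)
qed

section \<open>Weak derivatives of locally affine functions\<close>

lemma lborel_integral_translate:
  fixes f :: "'a::euclidean_space \<Rightarrow> 'b::{banach, second_countable_topology}"
  assumes "f \<in> borel_measurable borel"
  shows "(LINT x | lborel. f (t + x)) = (LINT x | lborel. f x)"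
proof -
  have "distr lborel borel (\<lambda>x. t + x) = lborel"
    using lborel_affine[of 1 t] by (simp add: density_1)
  then have "(LINT x | lborel. f x) = (LINT x | distr lborel borel (\<lambda>x. t + x). f x)" by simp
  also have "\<dots> = (LINT x | lborel. f (t + x))"
    using assms by (intro integral_distr) auto
  finally show ?thesis by simp
qed

lemma continuous_compact_support_integrable:
  fixes f :: "'a::euclidean_space \<Rightarrow> 'b::{banach, second_countable_topology}"
  assumes "continuous_on UNIV f" "compact S" "\<And>x. x \<notin> S \<Longrightarrow> f x = 0"
  shows "integrable lborel f"
proof -
  have "integrable lborel (\<lambda>x. indicator S x *\<^sub>R f x)"
    by (intro borel_integrable_compact assms continuous_on_subset[OF assms(1)]) simp
  also have "(\<lambda>x. indicator S x *\<^sub>R f x) = f"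
    using assms(3) by (auto simp: indicator_def)
  finally show ?thesis .
qed

text \<open>
  Near a point outside the closed support the function vanishes identically.
\<close>

lemma partial_deriv_outside_support:
  assumes "x \<notin> closure {x. g x \<noteq> 0}"
  shows "partial_deriv i g x = 0"
proof -
  have "((\<lambda>_. 0) has_derivative (\<lambda>_. 0)) (at x)" by simp
  then have "(g has_derivative (\<lambda>_. 0)) (at x)"
    by (rule has_derivative_transform_within_open[where s = "- closure {x. g x \<noteq> 0}"])
      (use assms closure_subset[of "{x. g x \<noteq> 0}"] in auto)
  then show ?thesis by (simp add: partial_deriv_eqI)
qed

text \<open>
  The integral of a difference quotient vanishes by translation invariance, and difference
  quotients converge boundedly to the derivative.
\<close>

lemma integral_partial_deriv_eq_0:
  fixes g :: "real^'d \<Rightarrow> real"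
  assumes C1: "C_k 1 g" and supp: "compact (closure {x. g x \<noteq> 0})"
  shows "(LINT x | lborel. partial_deriv i g x) = 0"
proof -
  let ?S = "closure {x. g x \<noteq> 0}"
  let ?D = "partial_deriv i g"
  have cD: "continuous_on UNIV ?D" and diff: "\<And>x. g differentiable (at x)"
    using C1 by auto
  have cg: "continuous_on UNIV g" using C_k_Suc_imp[of 0 g] C1 by simp
  have g0: "g x = 0" if "x \<notin> ?S" for x using that closure_subset[of "{x. g x \<noteq> 0}"] by auto
  have ig: "integrable lborel g"
    by (rule continuous_compact_support_integrable[OF cg supp g0])
  obtain r where r: "?S \<subseteq> cball 0 r"
    using compact_imp_bounded[OF supp] unfolding bounded_iff by (auto simp: subset_iff)
  have out: "y \<notin> ?S" if "r < norm y" for y using r that by (meson leD mem_cball_0 subsetD)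
  define B where "B = cball (0 :: real^'d) (r + 1)"
  have "compact (?D ` B)"
    unfolding B_def by (intro compact_continuous_image continuous_on_subset[OF cD]) auto
  then have "bounded (?D ` B)" by (rule compact_imp_bounded)
  then obtain M where M: "\<And>x. x \<in> B \<Longrightarrow> \<bar>?D x\<bar> \<le> M"
    unfolding bounded_iff by auto
  define e :: "real^'d" where "e = axis i 1"
  define t where "t n = inverse (real (Suc n))" for n
  have t: "0 < t n" "t n \<le> 1" for n by (auto simp: t_def field_simps)
  define h where "h n x = (g (t n *\<^sub>R e + x) - g x) / t n" for n x
  have line: "((\<lambda>s. g (s *\<^sub>R e + x)) has_real_derivative ?D (s *\<^sub>R e + x)) (at s)" for s x
  proof -
    have l: "((\<lambda>s. s *\<^sub>R e + x) has_derivative (\<lambda>s. s *\<^sub>R e)) (at s)"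
      by (auto intro!: derivative_eq_intros)
    have f: "(g has_derivative frechet_derivative g (at (s *\<^sub>R e + x))) (at (s *\<^sub>R e + x))"
      using diff frechet_derivative_works by blast
    have sc: "frechet_derivative g (at (s *\<^sub>R e + x)) (c *\<^sub>R e) = ?D (s *\<^sub>R e + x) * c" for c
      unfolding linear_scale[OF has_derivative_linear[OF f], of c e]
      unfolding real_scaleR_def partial_deriv_def e_def by (rule mult.commute)
    from has_derivative_compose[OF l f] show ?thesis
      unfolding sc has_field_derivative_def .
  qed
  have lim: "(\<lambda>n. h n x) \<longlonglongrightarrow> ?D x" for x
  proof -
    have "((\<lambda>s. (g ((0 + s) *\<^sub>R e + x) - g (0 *\<^sub>R e + x)) / s) \<longlongrightarrow> ?D (0 *\<^sub>R e + x)) (at 0)"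
      using line[of x 0] by (simp only: DERIV_def)
    moreover have "filterlim t (at 0) sequentially"
    proof (rule filterlim_atI)
      show "t \<longlonglongrightarrow> 0" unfolding t_def[abs_def] by (rule LIMSEQ_inverse_real_of_nat)
      show "\<forall>\<^sub>F n in sequentially. t n \<noteq> 0" by (intro always_eventually allI) (metis t(1) less_irrefl)
    qed
    ultimately show ?thesis
      using filterlim_compose[of "\<lambda>s. (g (s *\<^sub>R e + x) - g x) / s" "nhds (?D x)" "at 0" t sequentially]
      by (simp add: h_def)
  qed
  have bound: "\<bar>h n x\<bar> \<le> indicator B x * M" for n x
  proof (cases "x \<in> B")
    case False
    have "norm (t n *\<^sub>R e) \<le> 1" using t[of n] by (simp add: e_def)
    moreover have "norm x \<le> norm (t n *\<^sub>R e + x) + norm (t n *\<^sub>R e)"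
      using norm_triangle_ineq4[of "t n *\<^sub>R e + x" "t n *\<^sub>R e"] by (simp only: add_diff_cancel_left')
    moreover have "r + 1 < norm x" using False by (simp add: B_def)
    ultimately have "r < norm (t n *\<^sub>R e + x)" "r < norm x" by linarith+
    from this[THEN out, THEN g0] show ?thesis using False by (simp add: h_def)
  next
    case True
    have "\<exists>s>0. s < t n \<and> g (t n *\<^sub>R e + x) - g (0 *\<^sub>R e + x) = (t n - 0) * ?D (s *\<^sub>R e + x)"
      by (rule MVT2[OF t(1)[of n], of "\<lambda>s. g (s *\<^sub>R e + x)" "\<lambda>s. ?D (s *\<^sub>R e + x)"]) (rule line)
    then obtain s where s: "g (t n *\<^sub>R e + x) - g (0 *\<^sub>R e + x) = (t n - 0) * ?D (s *\<^sub>R e + x)"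
      by blast
    then have hs: "h n x = ?D (s *\<^sub>R e + x)" using t[of n] by (simp add: h_def)
    have "0 \<le> M" using M[OF True] by linarith
    show ?thesis
    proof (cases "s *\<^sub>R e + x \<in> B")
      case True
      from M[OF this] hs \<open>x \<in> B\<close> show ?thesis by simp
    next
      case False
      then have "s *\<^sub>R e + x \<notin> ?S" by (intro out) (simp add: B_def)
      then show ?thesis
        using hs \<open>0 \<le> M\<close> partial_deriv_outside_support[of "s *\<^sub>R e + x" g i] by simp
    qed
  qed
  have mg: "g \<in> borel_measurable borel" using cg by (rule borel_measurable_continuous_onI)
  have ish: "integrable lborel (\<lambda>x. g (t n *\<^sub>R e + x))" for n
  proof (rule continuous_compact_support_integrable)
    show "continuous_on UNIV (\<lambda>x. g (t n *\<^sub>R e + x))"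
      by (rule continuous_on_compose2[OF cg]) (auto intro: continuous_intros)
    show "compact ((\<lambda>x. - (t n *\<^sub>R e) + x) ` ?S)" by (rule compact_translation[OF supp])
    show "g (t n *\<^sub>R e + x) = 0" if "x \<notin> (\<lambda>x. - (t n *\<^sub>R e) + x) ` ?S" for x
    proof (rule g0)
      show "t n *\<^sub>R e + x \<notin> ?S"
      proof
        assume "t n *\<^sub>R e + x \<in> ?S"
        then have "- (t n *\<^sub>R e) + (t n *\<^sub>R e + x) \<in> (\<lambda>x. - (t n *\<^sub>R e) + x) ` ?S" by (rule imageI)
        with that show False by simp
      qed
    qed
  qed
  have int0: "(LINT x | lborel. h n x) = 0" for n
  proof -
    have "(LINT x | lborel. h n x) = ((LINT x | lborel. g (t n *\<^sub>R e + x)) - (LINT x | lborel. g x)) / t n"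
      unfolding h_def using ig ish by simp
    then show ?thesis by (simp add: lborel_integral_translate[OF mg])
  qed
  have "(\<lambda>n. LINT x | lborel. h n x) \<longlonglongrightarrow> (LINT x | lborel. ?D x)"
  proof (rule integral_dominated_convergence)
    show "?D \<in> borel_measurable lborel" using borel_measurable_continuous_onI[OF cD] by simp
    show "h n \<in> borel_measurable lborel" for n
      using ig ish unfolding h_def by (auto intro!: borel_measurable_integrable)
    have "integrable lborel (\<lambda>x. indicator B x *\<^sub>R M)"
      by (rule borel_integrable_compact) (auto simp: B_def)
    then show "integrable lborel (\<lambda>x. indicator B x * M)" by simp
    show "AE x in lborel. (\<lambda>n. h n x) \<longlonglongrightarrow> ?D x" using lim by simp
    show "AE x in lborel. norm (h n x) \<le> indicator B x * M" for n using bound by simp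
  qed
  then show ?thesis by (simp add: int0 LIMSEQ_const_iff)
qed

text \<open>
  The sets over which the integral vanishes form a Dynkin system containing the boxes, hence all
  Borel sets; Lebesgue sets differ from Borel sets by null sets.
\<close>

lemma AE_eq_0_if_box_integrals_eq_0:
  fixes f :: "'a::euclidean_space \<Rightarrow> 'b::{banach, second_countable_topology}"
  assumes f: "integrable lebesgue f" and box0: "\<And>a b. (LINT x : box a b | lebesgue. f x) = 0"
    and UNIV0: "(LINT x | lebesgue. f x) = 0"
  shows "AE x in lebesgue. f x = 0"
proof -
  have si: "set_integrable lebesgue A f" if "A \<in> sets lebesgue" for A
    using integrable_mult_indicator[OF that f] by (simp add: set_integrable_def)
  have sb: "sigma_sets UNIV (range (\<lambda>(a, b). box a b :: 'a set)) = sets borel"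
    by (subst borel_eq_box) simp
  have leb: "A \<in> sets lebesgue" if "A \<in> sigma_sets UNIV (range (\<lambda>(a, b). box a b :: 'a set))" for A
    using that unfolding sb by simp
  have stable: "Int_stable (range (\<lambda>(a, b). box a b :: 'a set))"
    by (auto simp: Int_stable_def box_Int_box)
  have cl: "range (\<lambda>(a, b). box a b :: 'a set) \<subseteq> Pow UNIV" by simp
  have borel: "(LINT x : A | lebesgue. f x) = 0" if "A \<in> sigma_sets UNIV (range (\<lambda>(a, b). box a b :: 'a set))" for A
    using stable cl that
  proof (induction rule: sigma_sets_induct_disjoint)
    case (basic A)
    then show ?case using box0 by auto
  next
    case empty
    then show ?case by (simp add: set_lebesgue_integral_def)
  next
    case (compl A)
    then have A: "A \<in> sets lebesgue" by (intro leb)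
    have "(LINT x : A \<union> (UNIV - A) | lebesgue. f x) = (LINT x : A | lebesgue. f x) + (LINT x : UNIV - A | lebesgue. f x)"
      using A by (intro set_integral_Un si) auto
    moreover have "A \<union> (UNIV - A) = UNIV" by auto
    ultimately show ?case using compl UNIV0 by (simp add: set_lebesgue_integral_def)
  next
    case (union A)
    then have A: "A i \<in> sets lebesgue" for i by (intro leb) auto
    have "(LINT x : (\<Union>i. A i) | lebesgue. f x) = (\<Sum>i. (LINT x : A i | lebesgue. f x))"
      using A union(1)
      by (intro lebesgue_integral_countable_add si) (auto simp: disjoint_family_on_def)
    then show ?case using union by simp
  qed
  interpret sigma_finite_measure "lebesgue :: 'a measure"
  proof
    show "\<exists>A. countable A \<and> A \<subseteq> sets (lebesgue :: 'a measure) \<and> \<Union>A = space lebesgue \<and> (\<forall>a\<in>A. emeasure lebesgue a \<noteq> \<infinity>)"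
      by (rule exI[of _ "range (\<lambda>n. cball 0 (real n))"])
        (auto simp: emeasure_cball real_arch_simple)
  qed
  show ?thesis
  proof (rule density_zero[OF f])
    fix A :: "'a set" assume "A \<in> sets lebesgue"
    then obtain S N N' where A: "A = S \<union> N" "N \<subseteq> N'" "N' \<in> null_sets lborel" "S \<in> sets lborel"
      by (rule sets_completionE)
    have "AE x in lebesgue. x \<notin> N'"
      using A(3) by (intro AE_not_in null_sets_completionI)
    then have "AE x in lebesgue. indicator A x *\<^sub>R f x = indicator S x *\<^sub>R f x"
      by eventually_elim (use A(1,2) in \<open>auto simp: indicator_def\<close>)
    moreover have "S \<in> sets lebesgue" using A(4) by simp
    ultimately have "(LINT x : A | lebesgue. f x) = (LINT x : S | lebesgue. f x)"
      using si[OF \<open>A \<in> sets lebesgue\<close>] si[of S] unfolding set_lebesgue_integral_def set_integrable_def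
      by (intro integral_cong_AE borel_measurable_integrable) auto
    also have "\<dots> = 0" using A(4) by (intro borel) (simp add: sb)
    finally show "(LINT x : A | lebesgue. f x) = 0" .
  qed
qed

lemma affine_has_derivative:
  fixes B :: "real^'d^'s"
  shows "((\<lambda>x. (B *v x + b) $ j) has_derivative (\<lambda>h. (B *v h) $ j)) (at x)"
proof -
  have "((\<lambda>x. B *v x) has_derivative (\<lambda>h. B *v h)) (at x)"
    by (rule bounded_linear_imp_has_derivative[OF matrix_vector_mul_bounded_linear])
  then have "((\<lambda>x. B *v x + b) has_derivative (\<lambda>h. B *v h)) (at x)"
    by (rule has_derivative_add_const)
  then show ?thesis
    by (rule bounded_linear.has_derivative[OF bounded_linear_vec_nth])
qed

lemma partial_deriv_affine:
  fixes B :: "real^'d^'s"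
  shows "partial_deriv i (\<lambda>x. (B *v x + b) $ j) = (\<lambda>_. column i B $ j)"
  using partial_deriv_eqI[OF affine_has_derivative, of i B b j] by (auto simp only: matrix_vector_mult_basis)

lemma C_k_affine:
  fixes B :: "real^'d^'s"
  shows "C_k k (\<lambda>x. (B *v x + b) $ j)"
proof (cases k)
  case 0
  have "continuous_on UNIV (\<lambda>x. (B *v x + b) $ j)"
    by (intro continuous_at_imp_continuous_on ballI has_derivative_continuous[OF affine_has_derivative])
  with 0 show ?thesis by simp
next
  case (Suc l)
  have "(\<lambda>x. (B *v x + b) $ j) differentiable (at x)" for x
    using affine_has_derivative unfolding differentiable_def by blast
  then show ?thesis unfolding Suc C_k.simps partial_deriv_affine by (simp add: C_k_const)
qed

text \<open>
  Componentwise, the product of the test function with an affine function is again smooth with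
  compact support, so the integral of its derivative vanishes.
\<close>

lemma integral_by_parts_affine:
  fixes B :: "real^'d^'s"
  assumes \<phi>: "test_function \<Omega> \<phi>"
  shows "(LINT x | lborel. partial_deriv i \<phi> x *\<^sub>R (B *v x + b)) = - (LINT x | lborel. \<phi> x *\<^sub>R column i B)"
    and "integrable lborel (\<lambda>x. \<phi> x *\<^sub>R column i B)"
proof -
  let ?S = "closure {x. \<phi> x \<noteq> 0}"
  have C: "C_k k \<phi>" for k using \<phi> by (auto simp: test_function_def)
  have S: "compact ?S" using \<phi> by (auto simp: test_function_def)
  have c\<phi>: "continuous_on UNIV \<phi>" using C[of 0] by simp
  have cD: "continuous_on UNIV (partial_deriv i \<phi>)" using C[of 1] by simp
  have \<phi>0: "\<phi> x = 0" if "x \<notin> ?S" for x using that closure_subset[of "{x. \<phi> x \<noteq> 0}"] by auto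
  have cB: "continuous_on UNIV (\<lambda>x. B *v x + b)"
    by (intro continuous_intros linear_continuous_on matrix_vector_mul_bounded_linear)
  have int1: "integrable lborel (\<lambda>x. partial_deriv i \<phi> x *\<^sub>R (B *v x + b))"
  proof (rule continuous_compact_support_integrable[OF continuous_on_scaleR[OF cD cB] S])
    show "partial_deriv i \<phi> x *\<^sub>R (B *v x + b) = 0" if "x \<notin> ?S" for x
      using partial_deriv_outside_support[OF that, of i] by simp
  qed
  show int2: "integrable lborel (\<lambda>x. \<phi> x *\<^sub>R column i B)"
  proof (rule continuous_compact_support_integrable[OF continuous_on_scaleR[OF c\<phi> continuous_on_const] S])
    show "\<phi> x *\<^sub>R column i B = 0" if "x \<notin> ?S" for x
      using \<phi>0[OF that] by simp
  qed
  show "(LINT x | lborel. partial_deriv i \<phi> x *\<^sub>R (B *v x + b)) = - (LINT x | lborel. \<phi> x *\<^sub>R column i B)"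
  proof (rule vec_eq_iff[THEN iffD2], rule allI)
    fix j
    define l where "l x = (B *v x + b) $ j" for x
    have "{x. \<phi> x * l x \<noteq> 0} \<subseteq> {x. \<phi> x \<noteq> 0}" by auto
    then have "closure {x. \<phi> x * l x \<noteq> 0} \<subseteq> ?S" by (rule closure_mono)
    then have supp: "compact (closure {x. \<phi> x * l x \<noteq> 0})"
      using compact_Int_closed[OF S closed_closure, of "{x. \<phi> x * l x \<noteq> 0}"] by (simp add: inf.absorb2)
    have Cl: "C_k 1 l" unfolding l_def[abs_def] by (rule C_k_affine)
    have "(LINT x | lborel. partial_deriv i (\<lambda>x. \<phi> x * l x) x) = 0"
      by (rule integral_partial_deriv_eq_0[OF C_k_mult[OF C[of 1] Cl] supp])
    moreover have "partial_deriv i (\<lambda>x. \<phi> x * l x) x =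
       (\<phi> x *\<^sub>R column i B) $ j + (partial_deriv i \<phi> x *\<^sub>R (B *v x + b)) $ j" for x
    proof -
      have "partial_deriv i (\<lambda>x. \<phi> x * l x) x = \<phi> x * partial_deriv i l x + partial_deriv i \<phi> x * l x"
        using C[of 1] Cl by (intro partial_deriv_mult) auto
      also have "partial_deriv i l x = column i B $ j"
        unfolding l_def[abs_def] partial_deriv_affine ..
      finally show ?thesis by (simp add: l_def)
    qed
    moreover have "(LINT x | lborel. (\<phi> x *\<^sub>R column i B) $ j + (partial_deriv i \<phi> x *\<^sub>R (B *v x + b)) $ j)
       = (LINT x | lborel. (\<phi> x *\<^sub>R column i B) $ j) + (LINT x | lborel. (partial_deriv i \<phi> x *\<^sub>R (B *v x + b)) $ j)"
      using int1 int2
      by (intro Bochner_Integration.integral_add integrable_bounded_linear[OF bounded_linear_vec_nth])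
    ultimately have "(LINT x | lborel. partial_deriv i \<phi> x *\<^sub>R (B *v x + b)) $ j = - (LINT x | lborel. \<phi> x *\<^sub>R column i B) $ j"
      unfolding integral_bounded_linear[OF bounded_linear_vec_nth int1]
        integral_bounded_linear[OF bounded_linear_vec_nth int2] by simp
    then show "(LINT x | lborel. partial_deriv i \<phi> x *\<^sub>R (B *v x + b)) $ j = (- (LINT x | lborel. \<phi> x *\<^sub>R column i B)) $ j"
      by simp
  qed
qed

lemma L2_space_integrable:
  assumes "bounded \<Omega>" "\<Omega> \<in> sets lebesgue" "U \<in> L2_space \<Omega>"
  shows "integrable lebesgue (\<lambda>x. indicat_real \<Omega> x *\<^sub>R U x)"
proof -
  have fin: "finite_measure (lebesgue_on \<Omega>)"
    by (intro finite_measure_lebesgue_on bounded_set_imp_lmeasurable assms)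
  have "integrable (lebesgue_on \<Omega>) U"
  proof (rule Bochner_Integration.integrable_bound)
    show "integrable (lebesgue_on \<Omega>) (\<lambda>x. 1 + (norm (U x))\<^sup>2)"
      using assms(3) finite_measure.integrable_const[OF fin, of "1::real"] by (auto simp: L2_space_def)
    show "U \<in> borel_measurable (lebesgue_on \<Omega>)" using assms(3) by (simp add: L2_space_def)
    have "t \<le> 1 + t\<^sup>2" for t :: real
      using zero_le_power2[of "t - 1/2"] by (simp add: power2_eq_square algebra_simps)
    then show "AE x in lebesgue_on \<Omega>. norm (U x) \<le> norm (1 + (norm (U x))\<^sup>2)"
      by (auto intro!: AE_I2 order_trans[OF _ abs_ge_self])
  qed
  then show ?thesis using assms(2) by (simp add: integrable_restrict_space)
qed

lemma weak_partial_works: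
  assumes "U \<in> H1_space \<Omega>"
  shows "weak_partial \<Omega> i U \<in> L2_space \<Omega>" "has_weak_partial \<Omega> i U (weak_partial \<Omega> i U)"
proof -
  have "\<exists>W. W \<in> L2_space \<Omega> \<and> has_weak_partial \<Omega> i U W"
    using assms unfolding H1_space_def by blast
  from someI_ex[OF this]
  show "weak_partial \<Omega> i U \<in> L2_space \<Omega>" "has_weak_partial \<Omega> i U (weak_partial \<Omega> i U)"
    unfolding weak_partial_def by auto
qed

text \<open>
  Outside the open set where \<open>U\<close> is affine the test function and its derivative vanish, so in the
  defining identity of the weak derivative \<open>U\<close> may be replaced by the affine function on the whole
  space, where classical integration by parts applies.
\<close>

lemma weak_partial_tested_affine:
  fixes B :: "real^'d^'s"
  assumes \<Omega>: "open \<Omega>" "bounded \<Omega>" and U: "U \<in> H1_space \<Omega>" and O: "O' \<subseteq> \<Omega>" 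
    and aff: "\<And>x. x \<in> O' \<Longrightarrow> U x = B *v x + b" and \<phi>: "test_function O' \<phi>"
  shows "(LINT x | lebesgue. \<phi> x *\<^sub>R (indicat_real \<Omega> x *\<^sub>R (weak_partial \<Omega> i U x - column i B))) = 0"
proof -
  let ?W = "weak_partial \<Omega> i U"
  have \<Omega>l: "\<Omega> \<in> sets lebesgue" using \<Omega>(1) by simp
  have \<phi>\<Omega>: "test_function \<Omega> \<phi>" using \<phi> O by (auto simp: test_function_def)
  have cl: "closure {x. \<phi> x \<noteq> 0} \<subseteq> O'" using \<phi> by (simp add: test_function_def)
  have \<phi>0: "\<phi> x = 0" if "x \<notin> O'" for x using that cl closure_subset[of "{x. \<phi> x \<noteq> 0}"] by auto
  have d0: "partial_deriv i \<phi> x = 0" if "x \<notin> O'" for x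
    using that cl by (intro partial_deriv_outside_support) auto
  have C: "continuous_on UNIV (partial_deriv i \<phi>)" "continuous_on UNIV \<phi>"
    using \<phi> C_k.simps by (auto simp: test_function_def dest: spec[of _ 0] spec[of _ "Suc 0"])
  have cB: "continuous_on UNIV (\<lambda>x. B *v x + b)"
    by (intro continuous_intros linear_continuous_on matrix_vector_mul_bounded_linear)
  have "(LINT x | lebesgue. indicat_real \<Omega> x *\<^sub>R (partial_deriv i \<phi> x *\<^sub>R U x)) =
     - (LINT x | lebesgue. indicat_real \<Omega> x *\<^sub>R (\<phi> x *\<^sub>R ?W x))"
    using weak_partial_works(2)[OF U, of i] \<phi>\<Omega> \<Omega>l
    unfolding has_weak_partial_def by (simp add: integral_restrict_space)
  also have "(\<lambda>x. indicat_real \<Omega> x *\<^sub>R (partial_deriv i \<phi> x *\<^sub>R U x)) = (\<lambda>x. partial_deriv i \<phi> x *\<^sub>R (B *v x + b))"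
  proof
    fix x show "indicat_real \<Omega> x *\<^sub>R (partial_deriv i \<phi> x *\<^sub>R U x) = partial_deriv i \<phi> x *\<^sub>R (B *v x + b)"
      using O aff[of x] d0[of x] by (cases "x \<in> O'") (auto simp: indicator_def)
  qed
  also have "(LINT x | lebesgue. partial_deriv i \<phi> x *\<^sub>R (B *v x + b)) = (LINT x | lborel. partial_deriv i \<phi> x *\<^sub>R (B *v x + b))"
  proof (rule integral_completion)
    show "(\<lambda>x. partial_deriv i \<phi> x *\<^sub>R (B *v x + b)) \<in> borel_measurable lborel"
      using borel_measurable_continuous_onI[OF continuous_on_scaleR[OF C(1) cB]] by simp
  qed
  also have "\<dots> = - (LINT x | lborel. \<phi> x *\<^sub>R column i B)"
    by (rule integral_by_parts_affine[OF \<phi>])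
  also have "(LINT x | lborel. \<phi> x *\<^sub>R column i B) = (LINT x | lebesgue. \<phi> x *\<^sub>R column i B)"
    by (rule integral_completion[symmetric])
      (use borel_measurable_continuous_onI[OF continuous_on_scaleR[OF C(2) continuous_on_const]] in simp)
  finally have eq: "(LINT x | lebesgue. \<phi> x *\<^sub>R column i B) = (LINT x | lebesgue. indicat_real \<Omega> x *\<^sub>R (\<phi> x *\<^sub>R ?W x))"
    by simp
  have i1: "integrable lebesgue (\<lambda>x. \<phi> x *\<^sub>R column i B)"
    using integral_by_parts_affine(2)[OF \<phi>]
    by (subst integrable_completion) auto
  obtain M where M: "\<And>x. \<bar>\<phi> x\<bar> \<le> M"
  proof -
    have "compact (\<phi> ` closure {x. \<phi> x \<noteq> 0})"
      using \<phi> by (intro compact_continuous_image continuous_on_subset[OF C(2)]) (auto simp: test_function_def)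
    then have "bounded (\<phi> ` closure {x. \<phi> x \<noteq> 0})" by (rule compact_imp_bounded)
    then obtain M where M: "\<And>x. x \<in> closure {x. \<phi> x \<noteq> 0} \<Longrightarrow> \<bar>\<phi> x\<bar> \<le> M"
      unfolding bounded_iff by auto
    have "\<bar>\<phi> x\<bar> \<le> max M 0" for x
    proof (cases "\<phi> x = 0")
      case False
      then have "x \<in> closure {x. \<phi> x \<noteq> 0}" using closure_subset by fastforce
      from M[OF this] show ?thesis by simp
    qed simp
    then show ?thesis by (rule that)
  qed
  have i2: "integrable lebesgue (\<lambda>x. \<phi> x *\<^sub>R (indicat_real \<Omega> x *\<^sub>R ?W x))"
  proof (rule Bochner_Integration.integrable_bound)
    have iW: "integrable lebesgue (\<lambda>x. indicat_real \<Omega> x *\<^sub>R ?W x)"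
      by (rule L2_space_integrable[OF \<Omega>(2) \<Omega>l weak_partial_works(1)[OF U]])
    then show "integrable lebesgue (\<lambda>x. M *\<^sub>R (indicat_real \<Omega> x *\<^sub>R ?W x))" by (rule integrable_scaleR_right)
    have "\<phi> \<in> borel_measurable lebesgue"
      using borel_measurable_continuous_onI[OF C(2)] by (simp add: measurable_completion)
    with iW show "(\<lambda>x. \<phi> x *\<^sub>R (indicat_real \<Omega> x *\<^sub>R ?W x)) \<in> borel_measurable lebesgue"
      by (intro borel_measurable_scaleR borel_measurable_integrable[OF iW])
    show "AE x in lebesgue. norm (\<phi> x *\<^sub>R (indicat_real \<Omega> x *\<^sub>R ?W x)) \<le> norm (M *\<^sub>R (indicat_real \<Omega> x *\<^sub>R ?W x))"
    proof (rule AE_I2)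
      fix x
      have "\<bar>\<phi> x\<bar> \<le> \<bar>M\<bar>" using M[of x] by simp
      then show "norm (\<phi> x *\<^sub>R (indicat_real \<Omega> x *\<^sub>R ?W x)) \<le> norm (M *\<^sub>R (indicat_real \<Omega> x *\<^sub>R ?W x))"
        unfolding norm_scaleR by (rule mult_right_mono) simp
    qed
  qed
  have "(\<lambda>x. \<phi> x *\<^sub>R (indicat_real \<Omega> x *\<^sub>R (?W x - column i B))) =
     (\<lambda>x. \<phi> x *\<^sub>R (indicat_real \<Omega> x *\<^sub>R ?W x) - \<phi> x *\<^sub>R column i B)"
  proof
    fix x show "\<phi> x *\<^sub>R (indicat_real \<Omega> x *\<^sub>R (?W x - column i B)) =
       \<phi> x *\<^sub>R (indicat_real \<Omega> x *\<^sub>R ?W x) - \<phi> x *\<^sub>R column i B"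
      using O \<phi>0[of x] by (cases "x \<in> O'") (auto simp: indicator_def scaleR_diff_right)
  qed
  then show ?thesis
    using i1 i2 eq by (simp add: mult.commute)
qed

text \<open>
  The difference between the weak derivative and the column is annihilated by all bumps in the
  open set. In the limit its integrals over boxes vanish, so it vanishes almost everywhere on every
  closed box in the set, and countably many of these cover it.
\<close>

lemma weak_partial_affine:
  fixes B :: "real^'d^'s"
  assumes \<Omega>: "open \<Omega>" "bounded \<Omega>" and U: "U \<in> H1_space \<Omega>" and O: "open O'" "O' \<subseteq> \<Omega>" 
    and aff: "\<And>x. x \<in> O' \<Longrightarrow> U x = B *v x + b"
  shows "AE x in lebesgue. x \<in> O' \<longrightarrow> weak_partial \<Omega> i U x = column i B"
proof -
  define F where "F x = indicat_real \<Omega> x *\<^sub>R (weak_partial \<Omega> i U x - column i B)" for x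
  have \<Omega>l: "\<Omega> \<in> sets lebesgue" using \<Omega>(1) by simp
  have iF: "integrable lebesgue F"
  proof -
    have "(\<lambda>_. column i B) \<in> L2_space \<Omega>"
      using finite_measure_lebesgue_on[OF bounded_set_imp_lmeasurable[OF \<Omega>(2) \<Omega>l]]
        finite_measure.integrable_const[where a = "(norm (column i B))\<^sup>2"]
      by (simp add: L2_space_def)
    from Bochner_Integration.integrable_diff[OF L2_space_integrable[OF \<Omega>(2) \<Omega>l weak_partial_works(1)[OF U]] L2_space_integrable[OF \<Omega>(2) \<Omega>l this]]
    show ?thesis unfolding F_def by (simp add: scaleR_diff_right)
  qed
  have box0: "(LINT x : box a b | lebesgue. F x) = 0" if "cbox a b \<subseteq> O'" for a b
  proof (cases "box a b = {}")
    case True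
    then show ?thesis by (simp add: set_lebesgue_integral_def)
  next
    case False
    have "(\<lambda>m. LINT x | lebesgue. box_bump a b m x *\<^sub>R F x) \<longlonglongrightarrow> (LINT x | lebesgue. indicat_real (box a b) x *\<^sub>R F x)"
    proof (rule integral_dominated_convergence)
      show "(\<lambda>x. indicat_real (box a b) x *\<^sub>R F x) \<in> borel_measurable lebesgue"
        by (intro borel_measurable_scaleR borel_measurable_integrable[OF iF] borel_measurable_indicator) auto
      show "(\<lambda>x. box_bump a b m x *\<^sub>R F x) \<in> borel_measurable lebesgue" for m
      proof -
        have "continuous_on UNIV (box_bump a b m)" using C_k_box_bump[of 0 a b m] by simp
        from borel_measurable_continuous_onI[OF this] have "box_bump a b m \<in> borel_measurable lebesgue"
          by (simp add: measurable_completion)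
        then show ?thesis by (intro borel_measurable_scaleR borel_measurable_integrable[OF iF])
      qed
      show "integrable lebesgue (\<lambda>x. norm (F x))" using iF by simp
      show "AE x in lebesgue. (\<lambda>m. box_bump a b m x *\<^sub>R F x) \<longlonglongrightarrow> indicat_real (box a b) x *\<^sub>R F x"
        by (intro AE_I2 tendsto_scaleR box_bump_tendsto[OF False] tendsto_const)
      show "AE x in lebesgue. norm (box_bump a b m x *\<^sub>R F x) \<le> norm (F x)" for m
        using box_bump_range[of a b m] by (auto intro!: AE_I2 mult_left_le_one_le)
    qed
    moreover have "(LINT x | lebesgue. box_bump a b m x *\<^sub>R F x) = 0" for m
      unfolding F_def using False that
      by (intro weak_partial_tested_affine[OF \<Omega> U O(2) aff] test_function_box_bump)
    ultimately show ?thesis by (simp add: set_lebesgue_integral_def LIMSEQ_const_iff)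
  qed
  have AEbox: "AE x in lebesgue. x \<in> box c d \<longrightarrow> F x = 0" if cd: "cbox c d \<subseteq> O'" for c d
  proof -
    let ?f = "\<lambda>x. indicat_real (box c d) x *\<^sub>R F x"
    have "AE x in lebesgue. ?f x = 0"
    proof (rule AE_eq_0_if_box_integrals_eq_0)
      show "integrable lebesgue ?f" using iF by (intro integrable_mult_indicator) auto
      show "(LINT x | lebesgue. ?f x) = 0"
        using box0[OF cd] by (simp add: set_lebesgue_integral_def)
      fix a b :: "real^'d"
      obtain a' b' where ab: "box a b \<inter> box c d = box a' b'" using box_Int_box by blast
      have "(LINT x : box a b | lebesgue. ?f x) = (LINT x : box a' b' | lebesgue. F x)"
        unfolding set_lebesgue_integral_def ab[symmetric]
        by (intro Bochner_Integration.integral_cong) (auto simp: indicator_def)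
      also have "\<dots> = 0"
      proof (cases "box a' b' = {}")
        case True
        then show ?thesis by (simp add: set_lebesgue_integral_def)
      next
        case False
        then have "box c d \<noteq> {}" "box a' b' \<subseteq> box c d" using ab by auto
        from closure_mono[OF this(2)] this(1) False cd show ?thesis
          by (intro box0) auto
      qed
      finally show "(LINT x : box a b | lebesgue. ?f x) = 0" .
    qed
    then show ?thesis by eventually_elim (auto simp: indicator_def)
  qed
  have AEcbox: "AE x in lebesgue. x \<in> cbox c d \<longrightarrow> F x = 0" if cd: "cbox c d \<subseteq> O'" for c d
  proof -
    have "AE x in lebesgue. x \<notin> cbox c d - box c d"
      by (intro AE_not_in) (use negligible_frontier_interval in \<open>simp add: negligible_iff_null_sets\<close>)
    with AEbox[OF cd] show ?thesis by eventually_elim auto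
  qed
  obtain D where D: "countable D" "D \<subseteq> Pow O'" "\<And>X. X \<in> D \<Longrightarrow> \<exists>a b. X = cbox a b" "\<Union>D = O'"
    by (rule open_countable_Union_open_cbox[OF O(1)]) iprover
  have "AE x in lebesgue. \<forall>X\<in>D. x \<in> X \<longrightarrow> F x = 0"
    unfolding AE_ball_countable[OF D(1)]
  proof
    fix X assume X: "X \<in> D"
    then obtain a b where "X = cbox a b" using D(3) by blast
    with AEcbox[of a b] X D(2) show "AE x in lebesgue. x \<in> X \<longrightarrow> F x = 0" by auto
  qed
  then show ?thesis
  proof eventually_elim
    case (elim x)
    show ?case
    proof
      assume x: "x \<in> O'"
      then have "F x = 0" using elim D(4) by auto
      then show "weak_partial \<Omega> i U x = column i B" using x O(2) by (auto simp: F_def indicator_def)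
    qed
  qed
qed

section \<open>Inverse estimate by the residual on affine elements\<close>

text \<open>
  A boundary point of a Lipschitz domain has exterior points arbitrarily close to it, namely those
  below the graph. So it is not interior to the closure. This is what places the interiors of mesh
  elements, which are only known to lie in the closure, inside the domain.
\<close>

lemma lipschitz_domain_interior_closure:
  assumes "lipschitz_domain \<Omega>"
  shows "interior (closure \<Omega>) \<subseteq> \<Omega>"
proof
  fix z assume z: "z \<in> interior (closure \<Omega>)"
  have op: "open \<Omega>" using assms by (simp add: lipschitz_domain_def)
  show "z \<in> \<Omega>"
  proof (rule ccontr)
    assume nz: "z \<notin> \<Omega>"
    have "z \<in> frontier \<Omega>"
      using z nz op interior_subset by (auto simp: frontier_def interior_open)
    then obtain r e \<gamma> L where r: "r > 0" and e: "norm e = 1" and lip: "lipschitz_on L {y. y \<bullet> e = 0} \<gamma>"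
      and graph: "\<And>x. x \<in> ball z r \<Longrightarrow> x \<in> \<Omega> \<longleftrightarrow> \<gamma> (x - (x \<bullet> e) *\<^sub>R e) < x \<bullet> e"
      using assms unfolding lipschitz_domain_def by blast
    have ee: "e \<bullet> e = 1" using e by (simp add: dot_square_norm)
    have cP: "continuous_on UNIV (\<lambda>x. \<gamma> (x - (x \<bullet> e) *\<^sub>R e))"
      by (rule continuous_on_compose2[OF lipschitz_on_continuous_on[OF lip]])
        (auto intro!: continuous_intros simp: inner_diff_left ee)
    obtain s where s: "s > 0" "ball z s \<subseteq> closure \<Omega>"
      using z by (auto simp: mem_interior)
    \<comment> \<open>Step below the graph without leaving the neighbourhood contained in the closure.\<close>
  define t where "t = min r s / 2"
    have t: "0 < t" "t < r" "t < s" using r s by (auto simp: t_def)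
    define p where "p = z - t *\<^sub>R e"
    have pe: "p \<bullet> e = z \<bullet> e - t" by (simp add: p_def inner_diff_left ee)
    have Pp: "p - (p \<bullet> e) *\<^sub>R e = z - (z \<bullet> e) *\<^sub>R e"
      unfolding pe by (simp add: p_def algebra_simps)
    have dp: "dist z p = t" using t(1) e by (simp add: p_def dist_norm)
    define B where "B = ball z r \<inter> {x. x \<bullet> e < \<gamma> (x - (x \<bullet> e) *\<^sub>R e)}"
    have "open B"
      unfolding B_def by (intro open_Int open_ball open_Collect_less cP) (auto intro: continuous_intros)
    moreover have "p \<in> B"
      using graph[of z] nz r t dp pe Pp by (auto simp: B_def)
    moreover have "B \<inter> \<Omega> = {}" using graph by (force simp: B_def)
    ultimately have "p \<notin> closure \<Omega>" using open_Int_closure_eq_empty by blast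
    moreover have "p \<in> closure \<Omega>" using s(2) dp t by auto
    ultimately show False by blast
  qed
qed

lemma integrable_on_ball:
  fixes f :: "'a::euclidean_space \<Rightarrow> real"
  assumes "continuous_on UNIV f"
  shows "integrable lborel (\<lambda>x. indicat_real (ball c r) x * f x)"
proof -
  have "integrable lborel (\<lambda>x. indicat_real (cball c r) x *\<^sub>R f x)"
    by (intro borel_integrable_compact continuous_on_subset[OF assms]) auto
  from integrable_mult_indicator[OF _ this, of "ball c r"]
  have "integrable lborel (\<lambda>x. indicat_real (ball c r) x *\<^sub>R (indicat_real (cball c r) x *\<^sub>R f x))"
    by (simp only: sets_lborel borel_open open_ball)
  moreover have "indicat_real (ball c r) x *\<^sub>R (indicat_real (cball c r) x *\<^sub>R f x) = indicat_real (ball c r) x * f x" for x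
    by (auto simp: indicator_def)
  ultimately show ?thesis by (simp only:)
qed

lemma norm_diff_square_le:
  fixes a b :: "'a::real_inner"
  shows "(norm (a - b))\<^sup>2 \<le> 2 * ((norm a)\<^sup>2 + (norm b)\<^sup>2)"
  using zero_le_power2[of "norm (a + b)"] unfolding power2_norm_eq_inner
  by (simp add: inner_add inner_diff inner_commute)

text \<open>
  Comparing the values at points that differ by \<open>q\<close>, half a radius along the \<open>i\<close>-th axis, eliminates
  the constant part: the sum of the two squared values is at least half the square of
  \<open>B *v q\<close>, whatever \<open>b\<close> is. Averaging over the half ball and its translate, both inside the ball,
  gives the bound.
\<close>

lemma affine_ball_lower_bound:
  fixes B :: "real^'d^'s"
  assumes r: "r > 0"
  shows "r\<^sup>2 / 16 * (norm (column i B))\<^sup>2 * measure lborel (ball x0 (r / 2))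
     \<le> (LINT x | lborel. indicat_real (ball x0 r) x * (norm (B *v x + b))\<^sup>2)"
proof -
  define f where "f x = (norm (B *v x + b))\<^sup>2" for x
  define q where "q = (r / 2) *\<^sub>R (axis i 1 :: real^'d)"
  have nq: "norm q = r / 2" using r by (simp add: q_def)
  have cf: "continuous_on UNIV f"
    unfolding f_def by (intro continuous_intros linear_continuous_on matrix_vector_mul_bounded_linear)
  have cf': "continuous_on UNIV (\<lambda>x. f (q + x))"
    by (rule continuous_on_compose2[OF cf]) (auto intro: continuous_intros)
  have f0: "0 \<le> f x" for x by (simp add: f_def)
  let ?H = "ball x0 (r / 2)"
  have pw: "r\<^sup>2 / 8 * (norm (column i B))\<^sup>2 \<le> f (q + x) + f x" for x
  proof -
    have "(B *v (q + x) + b) - (B *v x + b) = (r / 2) *\<^sub>R column i B"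
      by (simp add: q_def matrix_vector_right_distrib matrix_vector_mult_scaleR matrix_vector_mult_basis)
    then have "(r / 2)\<^sup>2 * (norm (column i B))\<^sup>2 = (norm ((B *v (q + x) + b) - (B *v x + b)))\<^sup>2"
      by (simp add: power_mult_distrib power_divide)
    also have "\<dots> \<le> 2 * (f (q + x) + f x)"
      unfolding f_def by (rule norm_diff_square_le)
    finally show ?thesis by (simp add: power2_eq_square)
  qed
  have i1: "integrable lborel (\<lambda>x. indicat_real ?H x * f (q + x))" by (rule integrable_on_ball[OF cf'])
  have i2: "integrable lborel (\<lambda>x. indicat_real ?H x * f x)" by (rule integrable_on_ball[OF cf])
  have i3: "integrable lborel (\<lambda>x. indicat_real (ball x0 r) x * f x)" by (rule integrable_on_ball[OF cf])
  have i4: "integrable lborel (\<lambda>x. indicat_real (ball (x0 + q) (r / 2)) x * f x)" by (rule integrable_on_ball[OF cf])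
  have "(LINT x | lborel. indicat_real ?H x * (r\<^sup>2 / 8 * (norm (column i B))\<^sup>2))
      \<le> (LINT x | lborel. indicat_real ?H x * f (q + x) + indicat_real ?H x * f x)"
  proof (rule integral_mono)
    show "integrable lborel (\<lambda>x. indicat_real ?H x * (r\<^sup>2 / 8 * (norm (column i B))\<^sup>2))"
      by (rule integrable_on_ball) (rule continuous_on_const)
    show "integrable lborel (\<lambda>x. indicat_real ?H x * f (q + x) + indicat_real ?H x * f x)"
      using i1 i2 by simp
    show "indicat_real ?H x * (r\<^sup>2 / 8 * (norm (column i B))\<^sup>2) \<le> indicat_real ?H x * f (q + x) + indicat_real ?H x * f x" for x
      using mult_left_mono[OF pw[of x], of "indicat_real ?H x"] by (simp add: distrib_left)
  qed
  also have "\<dots> = (LINT x | lborel. indicat_real ?H x * f (q + x)) + (LINT x | lborel. indicat_real ?H x * f x)"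
    by (rule Bochner_Integration.integral_add[OF i1 i2])
  also have "(LINT x | lborel. indicat_real ?H x * f (q + x)) = (LINT x | lborel. indicat_real (ball (x0 + q) (r / 2)) (q + x) * f (q + x))"
    by (intro Bochner_Integration.integral_cong) (auto simp: indicator_def dist_norm algebra_simps)
  also have "\<dots> = (LINT x | lborel. indicat_real (ball (x0 + q) (r / 2)) x * f x)"
    using lborel_integral_translate[of "\<lambda>x. indicat_real (ball (x0 + q) (r / 2)) x * f x" q] i4
    by (auto dest: borel_measurable_integrable)
  also have "\<dots> \<le> (LINT x | lborel. indicat_real (ball x0 r) x * f x)"
  proof (rule integral_mono[OF i4 i3])
    fix x
    have "x \<in> ball x0 r" if "x \<in> ball (x0 + q) (r / 2)"
    proof -
      have "dist x0 x \<le> dist x0 (x0 + q) + dist (x0 + q) x" by (rule dist_triangle)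
      then show ?thesis using that nq by (simp add: dist_norm)
    qed
    then show "indicat_real (ball (x0 + q) (r / 2)) x * f x \<le> indicat_real (ball x0 r) x * f x"
      using f0[of x] by (auto simp: indicator_def)
  qed
  also have "(LINT x | lborel. indicat_real ?H x * f x) \<le> (LINT x | lborel. indicat_real (ball x0 r) x * f x)"
    by (rule integral_mono[OF i2 i3]) (use f0 r in \<open>auto simp: indicator_def\<close>)
  finally have "(LINT x | lborel. indicat_real ?H x * (r\<^sup>2 / 8 * (norm (column i B))\<^sup>2))
     \<le> 2 * (LINT x | lborel. indicat_real (ball x0 r) x * f x)" by simp
  then show ?thesis by (simp add: f_def mult.commute mult.left_commute)
qed

text \<open>
  Shape regularity makes the volume of the element comparable to that of an inner ball, so the
  previous bound turns into one for the constant gradient over the whole element.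
\<close>

lemma affine_gradient_element_bound:
  fixes B :: "real^'d^'s" and K :: "(real^'d) set"
  assumes K: "K \<in> sets lebesgue" "bounded K" "diameter K \<le> h" and r: "r > 0" "ball x0 r \<subseteq> K" "h \<le> \<kappa> * r" "0 < h"
  shows "(norm (column i B))\<^sup>2 * measure lebesgue K
     \<le> 16 * \<kappa>\<^sup>2 * (2 * \<kappa>) ^ CARD('d) / h\<^sup>2 * (LINT x | lborel. indicat_real (ball x0 r) x * (norm (B *v x + b))\<^sup>2)"
proof -
  define J where "J = (LINT x | lborel. indicat_real (ball x0 r) x * (norm (B *v x + b))\<^sup>2)"
  define \<beta> where "\<beta> = (norm (column i B))\<^sup>2"
  define \<omega> where "\<omega> = unit_ball_vol (real CARD('d))"
  have b0: "0 \<le> \<beta>" by (simp add: \<beta>_def)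
  have w0: "0 \<le> \<omega>" by (simp add: \<omega>_def)
  have k0: "0 < \<kappa>" using r by (meson less_le_trans zero_less_mult_pos2)
  have "x0 \<in> K" using r by auto
  then have "K \<subseteq> cball x0 h"
    using diameter_bounded_bound[OF K(2)] K(3) by (fastforce simp: subset_iff)
  then have "measure lebesgue K \<le> measure lebesgue (cball x0 h)"
    using K(1) by (intro measure_mono_fmeasurable) (auto)
  also have "\<dots> = \<omega> * h ^ CARD('d)"
    using r(4) by (simp add: content_cball \<omega>_def measure_completion)
  finally have mK: "measure lebesgue K \<le> \<omega> * h ^ CARD('d)" .
  have mb: "measure lborel (ball x0 (r / 2)) = \<omega> * (r / 2) ^ CARD('d)"
    using r(1) by (simp add: content_ball \<omega>_def)
  have low: "r\<^sup>2 / 16 * \<beta> * (\<omega> * (r / 2) ^ CARD('d)) \<le> J"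
    using affine_ball_lower_bound[OF r(1), of i B x0 b] unfolding J_def \<beta>_def mb .
  have "\<beta> * measure lebesgue K \<le> \<beta> * (\<omega> * h ^ CARD('d))" by (intro mult_left_mono mK b0)
  also have "\<dots> = \<beta> * \<omega> * h ^ CARD('d) * (h\<^sup>2 / h\<^sup>2)" using r(4) by simp
  also have "\<dots> \<le> \<beta> * \<omega> * (\<kappa> * r) ^ CARD('d) * ((\<kappa> * r)\<^sup>2 / h\<^sup>2)"
    using r b0 w0 by (intro mult_mono power_mono divide_right_mono mult_nonneg_nonneg) auto
  also have "\<dots> = 16 * \<kappa>\<^sup>2 * (2 * \<kappa>) ^ CARD('d) / h\<^sup>2 * (r\<^sup>2 / 16 * \<beta> * (\<omega> * (r / 2) ^ CARD('d)))"
    by (simp add: power_mult_distrib power_divide)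
  also have "\<dots> \<le> 16 * \<kappa>\<^sup>2 * (2 * \<kappa>) ^ CARD('d) / h\<^sup>2 * J"
    using k0 by (intro mult_left_mono low) auto
  finally show ?thesis unfolding \<beta>_def J_def .
qed

lemma simplicial_meshD:
  assumes "simplicial_mesh \<Omega> \<T>" "K \<in> \<T>"
  shows "finite \<T>" "convex K" "compact K" "K \<subseteq> closure \<Omega>"
  using assms unfolding simplicial_mesh_def triangulation_def
  by (auto intro: convex_simplex compact_simplex)

lemma simplicial_mesh_disjoint_interiors:
  assumes "simplicial_mesh \<Omega> \<T>" "K \<in> \<T>" "K' \<in> \<T>" "x \<in> interior K" "x \<in> interior K'"
  shows "K = K'"
proof -
  have sub: "K \<subseteq> K'" if K: "K \<in> \<T>" "K' \<in> \<T>" and x: "x \<in> interior K" "x \<in> interior K'" for K K'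
  proof -
    have "(K \<inter> K') face_of K"
      using assms(1) K unfolding simplicial_mesh_def triangulation_def by blast
    moreover have "x \<in> K \<inter> K'" using x interior_subset by auto
    moreover have "interior K = rel_interior K" using x(1) by (intro rel_interior_nonempty_interior[symmetric]) auto
    ultimately have "K \<inter> K' = K"
      using x(1) face_of_disjoint_rel_interior[of "K \<inter> K'" K] by blast
    then show ?thesis by auto
  qed
  show ?thesis using sub[OF assms(2,3,4,5)] sub[OF assms(3,2,5,4)] by auto
qed

text \<open>
  Quasi-uniformity bounds every diameter from below by the mesh size, and shape regularity turns
  this into an inner ball of comparable radius. The factor \<open>4\<close> is twofold: radius against diameter, and
  a loss of one half because the inscribed diameter is a supremum.
\<close>

lemma mesh_element_inner_ball:
  fixes \<T> :: "(real^'d) set set"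
  assumes "simplicial_mesh \<Omega> \<T>" "shape_regular \<sigma> \<T>" "quasi_uniform \<rho> \<T>" "K \<in> \<T>"
    and pos: "\<sigma> > 0" "\<rho> > 0" "mesh_size \<T> > 0"
  shows "diameter K \<le> mesh_size \<T>"
    and "\<exists>x r. r > 0 \<and> ball x r \<subseteq> interior K \<and> mesh_size \<T> \<le> 4 * \<sigma> * \<rho> * r"
proof -
  let ?h = "mesh_size \<T>"
  note K = simplicial_meshD[OF assms(1,4)]
  show "diameter K \<le> ?h"
    unfolding mesh_size_def using K(1) assms(4) by (intro Max_ge) auto
  have d: "?h \<le> \<rho> * diameter K" using assms(3,4) by (simp add: quasi_uniform_def)
  then have dpos: "0 < diameter K" using pos by (smt (verit) mult_nonneg_nonpos)
  then have "K \<noteq> {}" by auto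
  then obtain y where y: "y \<in> K" by blast
  let ?R = "{2 * r | r. 0 \<le> r \<and> (\<exists>x. cball x r \<subseteq> K)}"
  have "?R \<noteq> {}" using y by (auto intro!: exI[of _ "0::real"] exI[of _ y])
  moreover have "diameter K / (2 * \<sigma>) < Sup ?R"
  proof -
    have "diameter K \<le> \<sigma> * Sup ?R"
      using assms(2,4) by (simp add: shape_regular_def inscribed_diameter_def)
    moreover have "diameter K / (2 * \<sigma>) * \<sigma> < diameter K" using pos dpos by simp
    ultimately have "diameter K / (2 * \<sigma>) * \<sigma> < Sup ?R * \<sigma>" by (simp add: mult.commute)
    then show ?thesis using pos by (simp only: mult_less_cancel_right_pos)
  qed
  ultimately obtain s where "s \<in> ?R" "diameter K / (2 * \<sigma>) < s" using less_cSupE by blast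
  then obtain r x where r: "cball x r \<subseteq> K" "diameter K / (2 * \<sigma>) < 2 * r" by auto
  have r0: "0 < r" using r(2) dpos pos by (smt (verit) divide_pos_pos)
  have "diameter K \<le> 4 * \<sigma> * r" using r(2) pos by (simp add: field_simps)
  then have "?h \<le> \<rho> * (4 * \<sigma> * r)" using d pos by (meson mult_left_mono order_trans less_imp_le)
  moreover have "ball x r \<subseteq> interior K"
    using r(1) by (intro interior_maximal) (auto intro: subset_trans[OF ball_subset_cball])
  ultimately show "\<exists>x r. r > 0 \<and> ball x r \<subseteq> interior K \<and> ?h \<le> 4 * \<sigma> * \<rho> * r"
    using r0 by (intro exI[of _ x] exI[of _ r]) (simp add: mult_ac)
qed

lemma H1_imp_L2: "U \<in> H1_space \<Omega> \<Longrightarrow> U \<in> L2_space \<Omega>"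
  by (simp add: H1_space_def)

lemma const_coeff_op_L2:
  fixes A :: "'d::finite \<Rightarrow> real^'s^'s"
  assumes "open \<Omega>" "U \<in> H1_space \<Omega>"
  shows "const_coeff_op \<Omega> A U \<in> L2_space \<Omega>"
  unfolding const_coeff_op_def using assms
  by (intro L2_space_sum L2_space_matrix weak_partial_works) auto

lemma const_coeff_op_affine:
  fixes A :: "'d::finite \<Rightarrow> real^'s^'s" and B :: "real^'d^'s"
  assumes "open \<Omega>" "bounded \<Omega>" "U \<in> H1_space \<Omega>" "open O'" "O' \<subseteq> \<Omega>"
    and "\<And>x. x \<in> O' \<Longrightarrow> U x = B *v x + b"
  shows "AE x in lebesgue. x \<in> O' \<longrightarrow> const_coeff_op \<Omega> A U x = (\<Sum>i\<in>UNIV. A i *v column i B)"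
proof -
  have "AE x in lebesgue. \<forall>i\<in>UNIV. x \<in> O' \<longrightarrow> weak_partial \<Omega> i U x = column i B"
    using weak_partial_affine[OF assms] by (subst AE_ball_countable) auto
  then show ?thesis by eventually_elim (simp add: const_coeff_op_def)
qed

lemma norm_sum_matrix_square_le:
  fixes A :: "'d::finite \<Rightarrow> real^'s^'s"
  shows "(norm (\<Sum>i\<in>UNIV. A i *v c i))\<^sup>2 \<le> (\<Sum>i\<in>UNIV. (onorm ((*v) (A i)))\<^sup>2) * (\<Sum>i\<in>UNIV. (norm (c i))\<^sup>2)"
proof -
  have "norm (\<Sum>i\<in>UNIV. A i *v c i) \<le> (\<Sum>i\<in>UNIV. onorm ((*v) (A i)) * norm (c i))"
    by (rule order_trans[OF norm_sum]) (intro sum_mono onorm matrix_vector_mul_bounded_linear)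
  then have "(norm (\<Sum>i\<in>UNIV. A i *v c i))\<^sup>2 \<le> (\<Sum>i\<in>UNIV. onorm ((*v) (A i)) * norm (c i))\<^sup>2"
    by (intro power_mono) auto
  also have "\<dots> \<le> (\<Sum>i\<in>UNIV. (onorm ((*v) (A i)))\<^sup>2) * (\<Sum>i\<in>UNIV. (norm (c i))\<^sup>2)"
    by (rule Cauchy_Schwarz_ineq_sum)
  finally show ?thesis .
qed

lemma L2_norm_square:
  assumes "\<Omega> \<in> sets lebesgue"
  shows "(L2_norm \<Omega> U)\<^sup>2 = (LINT x | lebesgue. indicat_real \<Omega> x * (norm (U x))\<^sup>2)"
proof -
  have "L2_inner \<Omega> U U = (LINT x | lebesgue. indicat_real \<Omega> x * (norm (U x))\<^sup>2)"
    using assms by (simp add: L2_inner_def integral_restrict_space power2_norm_eq_inner)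
  moreover have "0 \<le> (LINT x | lebesgue. indicat_real \<Omega> x * (norm (U x))\<^sup>2)"
    by (intro Bochner_Integration.integral_nonneg) auto
  ultimately show ?thesis by (simp add: L2_norm_def)
qed

lemma integrable_norm_square_on:
  assumes "\<Omega> \<in> sets lebesgue" "U \<in> L2_space \<Omega>" "S \<in> sets lebesgue" "S \<subseteq> \<Omega>"
  shows "integrable lebesgue (\<lambda>x. indicat_real S x * (norm (U x))\<^sup>2)"
proof -
  have "integrable lebesgue (\<lambda>x. indicat_real \<Omega> x *\<^sub>R (norm (U x))\<^sup>2)"
    using assms by (simp add: L2_space_def integrable_restrict_space)
  from integrable_mult_indicator[OF assms(3) this]
  have "integrable lebesgue (\<lambda>x. indicat_real S x *\<^sub>R (indicat_real \<Omega> x *\<^sub>R (norm (U x))\<^sup>2))" .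
  moreover have "indicat_real S x *\<^sub>R (indicat_real \<Omega> x *\<^sub>R (norm (U x))\<^sup>2) = indicat_real S x * (norm (U x))\<^sup>2" for x
    using assms(4) by (auto simp: indicator_def)
  ultimately show ?thesis by (simp only:)
qed

text \<open>
  The square of the constant in the inverse estimate, up to the factor \<open>1 / h\<^sup>2\<close>; \<open>\<kappa>\<close> bounds the ratio of
  mesh size and inner radius of the elements.
\<close>

definition inverse_const :: "('d::finite \<Rightarrow> real^'s^'s) \<Rightarrow> real \<Rightarrow> real" where
  "inverse_const A \<kappa> = (\<Sum>i\<in>UNIV. (onorm ((*v) (A i)))\<^sup>2) * (real CARD('d) * (16 * \<kappa>\<^sup>2 * (2 * \<kappa>) ^ CARD('d)))"

lemma inverse_const_nonneg: "0 \<le> \<kappa> \<Longrightarrow> 0 \<le> inverse_const A \<kappa>"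
  by (auto simp: inverse_const_def intro!: mult_nonneg_nonneg sum_nonneg)

text \<open>
  On the element the operator applied to \<open>Z\<close> is almost everywhere a constant vector, which just changes the
  constant part of the affine function \<open>V\<close>; the lower bound on the inner ball is insensitive to it.
\<close>

lemma element_residual_bound:
  fixes A :: "'d::finite \<Rightarrow> real^'s^'s" and V Z :: "real^'d \<Rightarrow> real^'s"
  assumes \<Omega>: "open \<Omega>" "bounded \<Omega>" and VZ: "V \<in> H1_space \<Omega>" "Z \<in> H1_space \<Omega>"
    and K: "bounded K" "interior K \<subseteq> \<Omega>" "diameter K \<le> h" "0 < h"
    and r: "0 < r" "ball x0 r \<subseteq> interior K" "h \<le> \<kappa> * r"
    and affV: "\<And>x. x \<in> K \<Longrightarrow> V x = B *v x + b" and affZ: "\<And>x. x \<in> K \<Longrightarrow> Z x = B' *v x + b'"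
  shows "(LINT x | lebesgue. indicat_real (interior K) x * (norm (const_coeff_op \<Omega> A V x))\<^sup>2)
    \<le> inverse_const A \<kappa> / h\<^sup>2 *
       (LINT x | lebesgue. indicat_real (interior K) x * (norm (V x + const_coeff_op \<Omega> A Z x))\<^sup>2)"
proof -
  let ?G = "const_coeff_op \<Omega> A" and ?I = "interior K"
  let ?R = "\<lambda>x. V x + ?G Z x"
  define \<gamma> where "\<gamma> = (\<Sum>i\<in>UNIV. A i *v column i B)"
  define \<gamma>' where "\<gamma>' = (\<Sum>i\<in>UNIV. A i *v column i B')"
  define c where "c = 16 * \<kappa>\<^sup>2 * (2 * \<kappa>) ^ CARD('d) / h\<^sup>2"
  define J where "J = (LINT x | lborel. indicat_real (ball x0 r) x * (norm (B *v x + (b + \<gamma>')))\<^sup>2)"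
  have k0: "0 < \<kappa>" using r K(4) by (meson less_le_trans zero_less_mult_pos2)
  have \<Omega>l: "\<Omega> \<in> sets lebesgue" using \<Omega>(1) by simp
  have I: "?I \<in> sets lebesgue" "open ?I" by simp_all
  have inK: "x \<in> K" if "x \<in> ?I" for x using that interior_subset by blast
  have GV: "AE x in lebesgue. x \<in> ?I \<longrightarrow> ?G V x = \<gamma>"
    unfolding \<gamma>_def by (rule const_coeff_op_affine[OF \<Omega> VZ(1) I(2) K(2)]) (simp add: affV inK)
  have GZ: "AE x in lebesgue. x \<in> ?I \<longrightarrow> ?G Z x = \<gamma>'"
    unfolding \<gamma>'_def by (rule const_coeff_op_affine[OF \<Omega> VZ(2) I(2) K(2)]) (simp add: affZ inK)
  have L: "?G V \<in> L2_space \<Omega>" "?R \<in> L2_space \<Omega>"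
    by (rule const_coeff_op_L2[OF \<Omega>(1) VZ(1)],
        rule L2_space_add[OF \<Omega>l H1_imp_L2[OF VZ(1)] const_coeff_op_L2[OF \<Omega>(1) VZ(2)]])
  have fin: "?I \<in> lmeasurable"
    using I(1) bounded_subset[OF K(1) interior_subset] by (intro bounded_set_imp_lmeasurable)
  have "(LINT x | lebesgue. indicat_real ?I x * (norm (?G V x))\<^sup>2) = (LINT x | lebesgue. indicat_real ?I x * (norm \<gamma>)\<^sup>2)"
  proof (rule integral_cong_AE)
    show "(\<lambda>x. indicat_real ?I x * (norm (?G V x))\<^sup>2) \<in> borel_measurable lebesgue"
      by (rule borel_measurable_integrable[OF integrable_norm_square_on[OF \<Omega>l L(1) I(1) K(2)]])
    show "(\<lambda>x. indicat_real ?I x * (norm \<gamma>)\<^sup>2) \<in> borel_measurable lebesgue"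
      by (intro borel_measurable_times borel_measurable_indicator borel_measurable_const I(1))
    show "AE x in lebesgue. indicat_real ?I x * (norm (?G V x))\<^sup>2 = indicat_real ?I x * (norm \<gamma>)\<^sup>2"
      using GV by eventually_elim (auto simp: indicator_def)
  qed
  also have "\<dots> = (norm \<gamma>)\<^sup>2 * measure lebesgue ?I"
    using fin by (simp add: mult.commute)
  also have "\<dots> \<le> ((\<Sum>i\<in>UNIV. (onorm ((*v) (A i)))\<^sup>2) * (\<Sum>i\<in>UNIV. (norm (column i B))\<^sup>2)) * measure lebesgue ?I"
    unfolding \<gamma>_def by (intro mult_right_mono norm_sum_matrix_square_le) simp
  also have "\<dots> = (\<Sum>i\<in>UNIV. (onorm ((*v) (A i)))\<^sup>2) * (\<Sum>i\<in>UNIV. (norm (column i B))\<^sup>2 * measure lebesgue ?I)"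
    by (simp add: sum_distrib_right mult.assoc)
  also have "\<dots> \<le> (\<Sum>i\<in>UNIV. (onorm ((*v) (A i)))\<^sup>2) * (\<Sum>i\<in>(UNIV :: 'd set). c * J)"
  proof (intro mult_left_mono sum_mono sum_nonneg zero_le_power2)
    fix i
    have "diameter ?I \<le> h"
      using diameter_subset[OF interior_subset K(1)] K(3) by linarith
    then show "(norm (column i B))\<^sup>2 * measure lebesgue ?I \<le> c * J"
      unfolding c_def J_def
      by (intro affine_gradient_element_bound I bounded_subset[OF K(1) interior_subset] r K)
  qed
  also have "\<dots> = inverse_const A \<kappa> / h\<^sup>2 * J"
    by (simp add: inverse_const_def c_def)
  also have "\<dots> \<le> inverse_const A \<kappa> / h\<^sup>2 * (LINT x | lebesgue. indicat_real ?I x * (norm (?R x))\<^sup>2)"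
  proof (rule mult_left_mono)
    have cont: "continuous_on UNIV (\<lambda>x. (norm (B *v x + (b + \<gamma>')))\<^sup>2)"
      by (intro continuous_intros linear_continuous_on matrix_vector_mul_bounded_linear)
    have iball: "integrable lborel (\<lambda>x. indicat_real (ball x0 r) x * (norm (B *v x + (b + \<gamma>')))\<^sup>2)"
      by (rule integrable_on_ball[OF cont])
    have "J = (LINT x | lebesgue. indicat_real (ball x0 r) x * (norm (B *v x + (b + \<gamma>')))\<^sup>2)"
      unfolding J_def using borel_measurable_integrable[OF iball] by (intro integral_completion[symmetric])
    also have "\<dots> \<le> (LINT x | lebesgue. indicat_real ?I x * (norm (?R x))\<^sup>2)"
    proof (rule integral_mono_AE)
      show "integrable lebesgue (\<lambda>x. indicat_real (ball x0 r) x * (norm (B *v x + (b + \<gamma>')))\<^sup>2)"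
        using iball borel_measurable_integrable[OF iball] by (subst integrable_completion)
      show "integrable lebesgue (\<lambda>x. indicat_real ?I x * (norm (?R x))\<^sup>2)"
        by (rule integrable_norm_square_on[OF \<Omega>l L(2) I(1) K(2)])
      show "AE x in lebesgue. indicat_real (ball x0 r) x * (norm (B *v x + (b + \<gamma>')))\<^sup>2 \<le> indicat_real ?I x * (norm (?R x))\<^sup>2"
        using GZ
      proof eventually_elim
        case (elim x)
        show ?case
        proof (cases "x \<in> ball x0 r")
          case True
          then have "x \<in> ?I" using r(2) by blast
          with True show ?thesis using elim affV[OF inK] by (simp add: add.assoc)
        qed (simp add: indicator_def)
      qed
    qed
    finally show "J \<le> (LINT x | lebesgue. indicat_real ?I x * (norm (?R x))\<^sup>2)" .
    show "0 \<le> inverse_const A \<kappa> / h\<^sup>2" using k0 by (simp add: inverse_const_nonneg)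
  qed
  finally show ?thesis .
qed

text \<open>
  The usual inverse estimate has \<open>V\<close> alone on the right. That an arbitrary \<open>G Z\<close> may be added is
  special to piecewise affine functions and constant coefficients: sum the element bounds, using that
  the interiors of the elements are disjoint and cover the domain up to a null set.
\<close>

lemma inverse_estimate_by_residual:
  fixes A :: "'d::finite \<Rightarrow> real^'s^'s" and V Z :: "real^'d \<Rightarrow> real^'s"
  assumes \<Omega>: "lipschitz_domain \<Omega>" and mesh: "simplicial_mesh \<Omega> \<T>" "shape_regular \<sigma> \<T>" "quasi_uniform \<rho> \<T>"
    and pos: "\<sigma> > 0" "\<rho> > 0" "mesh_size \<T> > 0"
    and V: "V \<in> H1_space \<Omega>" "V \<in> continuous_piecewise_affine \<Omega> \<T>"
    and Z: "Z \<in> H1_space \<Omega>" "Z \<in> continuous_piecewise_affine \<Omega> \<T>"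
  shows "L2_norm \<Omega> (const_coeff_op \<Omega> A V) \<le> sqrt (inverse_const A (4 * \<sigma> * \<rho>)) / mesh_size \<T>
     * L2_norm \<Omega> (\<lambda>x. V x + const_coeff_op \<Omega> A Z x)"
proof -
  let ?G = "const_coeff_op \<Omega> A" and ?h = "mesh_size \<T>"
  let ?R = "\<lambda>x. V x + ?G Z x"
  let ?C = "inverse_const A (4 * \<sigma> * \<rho>)"
  have op: "open \<Omega>" "bounded \<Omega>" using \<Omega> by (auto simp: lipschitz_domain_def)
  have \<Omega>l: "\<Omega> \<in> sets lebesgue" using op(1) by simp
  have C0: "0 \<le> ?C" using pos by (intro inverse_const_nonneg) auto
  have fin: "finite \<T>" using mesh(1) by (simp add: simplicial_mesh_def triangulation_def)
  have sub: "interior K \<subseteq> \<Omega>" if "K \<in> \<T>" for K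
    using interior_mono[OF simplicial_meshD(4)[OF mesh(1) that]] lipschitz_domain_interior_closure[OF \<Omega>] by blast
  have L: "?G V \<in> L2_space \<Omega>" "?R \<in> L2_space \<Omega>"
    by (rule const_coeff_op_L2[OF op(1) V(1)],
        rule L2_space_add[OF \<Omega>l H1_imp_L2[OF V(1)] const_coeff_op_L2[OF op(1) Z(1)]])
  have iV: "integrable lebesgue (\<lambda>x. indicat_real S x * (norm (?G V x))\<^sup>2)"
    and iR: "integrable lebesgue (\<lambda>x. indicat_real S x * (norm (?R x))\<^sup>2)"
    if "S \<in> sets lebesgue" "S \<subseteq> \<Omega>" for S
    by (rule integrable_norm_square_on[OF \<Omega>l L(1) that], rule integrable_norm_square_on[OF \<Omega>l L(2) that])
  have elem: "(LINT x | lebesgue. indicat_real (interior K) x * (norm (?G V x))\<^sup>2)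
      \<le> ?C / ?h\<^sup>2 * (LINT x | lebesgue. indicat_real (interior K) x * (norm (?R x))\<^sup>2)" if K: "K \<in> \<T>" for K
  proof -
    obtain B b where B: "\<And>x. x \<in> K \<Longrightarrow> V x = B *v x + b"
      using V(2) K unfolding continuous_piecewise_affine_def by blast
    obtain B' b' where B': "\<And>x. x \<in> K \<Longrightarrow> Z x = B' *v x + b'"
      using Z(2) K unfolding continuous_piecewise_affine_def by blast
    obtain x0 r where r: "r > 0" "ball x0 r \<subseteq> interior K" "?h \<le> 4 * \<sigma> * \<rho> * r"
      using mesh_element_inner_ball(2)[OF mesh K pos] by blast
    show ?thesis
      by (rule element_residual_bound[OF op V(1) Z(1) compact_imp_bounded[OF simplicial_meshD(3)[OF mesh(1) K]]
            sub[OF K] mesh_element_inner_ball(1)[OF mesh K pos] pos(3) r B B'])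
  qed
  have cover: "AE x in lebesgue. x \<in> \<Omega> \<longrightarrow> (\<exists>K\<in>\<T>. x \<in> interior K)"
  proof -
    have "AE x in lebesgue. x \<notin> frontier K" if K: "K \<in> \<T>" for K
    proof (rule AE_not_in)
      show "frontier K \<in> null_sets lebesgue"
        using negligible_convex_frontier[OF simplicial_meshD(2)[OF mesh(1) K]] by (simp add: negligible_iff_null_sets)
    qed
    then have "AE x in lebesgue. \<forall>K\<in>\<T>. x \<notin> frontier K"
      using countable_finite[OF fin] by (subst AE_ball_countable) auto
    then show ?thesis
    proof eventually_elim
      case (elim x)
      show ?case
      proof
        assume "x \<in> \<Omega>"
        moreover have "\<Union>\<T> = closure \<Omega>" using mesh(1) by (simp add: simplicial_mesh_def)
        ultimately have "x \<in> \<Union>\<T>" using closure_subset by blast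
        then obtain K where K: "K \<in> \<T>" "x \<in> K" by blast
        then have "x \<in> interior K" using elim closure_subset unfolding frontier_def by blast
        with K show "\<exists>K\<in>\<T>. x \<in> interior K" by blast
      qed
    qed
  qed
  have "(L2_norm \<Omega> (?G V))\<^sup>2 = (LINT x | lebesgue. indicat_real \<Omega> x * (norm (?G V x))\<^sup>2)"
    by (rule L2_norm_square[OF \<Omega>l])
  also have "\<dots> \<le> (LINT x | lebesgue. (\<Sum>K\<in>\<T>. indicat_real (interior K) x * (norm (?G V x))\<^sup>2))"
  proof (rule integral_mono_AE)
    show "integrable lebesgue (\<lambda>x. indicat_real \<Omega> x * (norm (?G V x))\<^sup>2)" using \<Omega>l by (intro iV) auto
    show "integrable lebesgue (\<lambda>x. \<Sum>K\<in>\<T>. indicat_real (interior K) x * (norm (?G V x))\<^sup>2)"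
      by (intro Bochner_Integration.integrable_sum iV sub) auto
    show "AE x in lebesgue. indicat_real \<Omega> x * (norm (?G V x))\<^sup>2 \<le> (\<Sum>K\<in>\<T>. indicat_real (interior K) x * (norm (?G V x))\<^sup>2)"
      using cover
    proof eventually_elim
      case (elim x)
      show ?case
      proof (cases "x \<in> \<Omega>")
        case True
        then obtain K where K: "K \<in> \<T>" "x \<in> interior K" using elim by blast
        have "indicat_real (interior K) x * (norm (?G V x))\<^sup>2 \<le> (\<Sum>K\<in>\<T>. indicat_real (interior K) x * (norm (?G V x))\<^sup>2)"
          using K(1) fin by (intro member_le_sum) auto
        with True K show ?thesis by simp
      qed (simp add: sum_nonneg)
    qed
  qed
  also have "\<dots> = (\<Sum>K\<in>\<T>. LINT x | lebesgue. indicat_real (interior K) x * (norm (?G V x))\<^sup>2)"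
    by (intro Bochner_Integration.integral_sum iV sub) auto
  also have "\<dots> \<le> (\<Sum>K\<in>\<T>. ?C / ?h\<^sup>2 * (LINT x | lebesgue. indicat_real (interior K) x * (norm (?R x))\<^sup>2))"
    by (intro sum_mono elem)
  also have "\<dots> = ?C / ?h\<^sup>2 * (LINT x | lebesgue. (\<Sum>K\<in>\<T>. indicat_real (interior K) x * (norm (?R x))\<^sup>2))"
    unfolding sum_distrib_left[symmetric]
    by (subst Bochner_Integration.integral_sum) (auto intro!: iR sub)
  also have "\<dots> \<le> ?C / ?h\<^sup>2 * (LINT x | lebesgue. indicat_real \<Omega> x * (norm (?R x))\<^sup>2)"
  proof (intro mult_left_mono integral_mono)
    show "integrable lebesgue (\<lambda>x. \<Sum>K\<in>\<T>. indicat_real (interior K) x * (norm (?R x))\<^sup>2)"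
      by (intro Bochner_Integration.integrable_sum iR sub) auto
    show "integrable lebesgue (\<lambda>x. indicat_real \<Omega> x * (norm (?R x))\<^sup>2)" using \<Omega>l by (intro iR) auto
    show "0 \<le> ?C / ?h\<^sup>2" using C0 by simp
    fix x
    show "(\<Sum>K\<in>\<T>. indicat_real (interior K) x * (norm (?R x))\<^sup>2) \<le> indicat_real \<Omega> x * (norm (?R x))\<^sup>2"
    proof (cases "\<exists>K\<in>\<T>. x \<in> interior K")
      case True
      then obtain K where K: "K \<in> \<T>" "x \<in> interior K" by blast
      have "indicat_real (interior K') x = 0" if "K' \<in> \<T> - {K}" for K'
        using simplicial_mesh_disjoint_interiors[OF mesh(1) K(1) _ K(2), of K'] that by (auto simp: indicator_def)
      then have "(\<Sum>K'\<in>\<T>. indicat_real (interior K') x * (norm (?R x))\<^sup>2) = indicat_real (interior K) x * (norm (?R x))\<^sup>2"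
        using fin K(1) by (subst sum.remove[of _ K]) auto
      then show ?thesis using K sub by (auto simp: indicator_def)
    next
      case False
      then have "(\<Sum>K\<in>\<T>. indicat_real (interior K) x * (norm (?R x))\<^sup>2) = 0"
        by (intro sum.neutral) (auto simp: indicator_def)
      then show ?thesis by simp
    qed
  qed
  also have "\<dots> = ?C / ?h\<^sup>2 * (L2_norm \<Omega> ?R)\<^sup>2" by (simp only: L2_norm_square[OF \<Omega>l])
  also have "\<dots> = (sqrt ?C / ?h * L2_norm \<Omega> ?R)\<^sup>2"
    using C0 by (simp add: power_mult_distrib power_divide)
  finally have sq: "(L2_norm \<Omega> (?G V))\<^sup>2 \<le> (sqrt ?C / ?h * L2_norm \<Omega> ?R)\<^sup>2" .
  have "0 \<le> L2_inner \<Omega> ?R ?R" unfolding L2_inner_def by (intro Bochner_Integration.integral_nonneg) simp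
  then have "0 \<le> sqrt ?C / ?h * L2_norm \<Omega> ?R"
    using C0 pos(3) unfolding L2_norm_def by (intro mult_nonneg_nonneg divide_nonneg_pos) auto
  with sq show ?thesis by (rule power2_le_imp_le)
qed

section \<open>Skew operators on the space of classes\<close>

locale skew_L2_operator =
  fixes \<Omega> :: "(real^'d) set" and X :: "(real^'d \<Rightarrow> real^'s) set"
    and G :: "(real^'d \<Rightarrow> real^'s) \<Rightarrow> real^'d \<Rightarrow> real^'s"
  assumes measurable: "\<Omega> \<in> sets lebesgue"
    and subspace: "fun_subspace X" and X_L2: "X \<subseteq> L2_space \<Omega>" and dense: "dense_in_L2 \<Omega> X"
    and G_L2: "\<And>U. U \<in> X \<Longrightarrow> G U \<in> L2_space \<Omega>" and skew: "skew_on \<Omega> X G"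
begin

abbreviation cls :: "(real^'d \<Rightarrow> real^'s) \<Rightarrow> ('d, 's) L2" where
  "cls U \<equiv> to_L2 \<Omega> U"

lemma in_L2: "U \<in> X \<Longrightarrow> U \<in> L2_space \<Omega>"
  using X_L2 by blast

lemma X_add: "U \<in> X \<Longrightarrow> W \<in> X \<Longrightarrow> (\<lambda>x. U x + W x) \<in> X"
  and X_scaleR: "U \<in> X \<Longrightarrow> (\<lambda>x. c *\<^sub>R U x) \<in> X"
  and X_zero: "(\<lambda>_. 0) \<in> X"
  using subspace unfolding fun_subspace_def by auto

text \<open>
  Approximating \<open>Y\<close> from the dense space to an accuracy better than its norm contradicts orthogonality.
\<close>

lemma eq_if_inner_X_eq:
  assumes "Y \<in> L2_space \<Omega>" "\<And>W. W \<in> X \<Longrightarrow> inner (cls Y) (cls W) = 0"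
  shows "cls Y = 0"
proof (rule ccontr)
  assume "cls Y \<noteq> 0"
  then obtain W where W: "W \<in> X" "L2_norm \<Omega> (\<lambda>x. Y x - W x) < norm (cls Y)"
    using dense assms(1) unfolding dense_in_L2_def by (meson zero_less_norm_iff)
  have "norm (cls Y - cls W) < norm (cls Y)"
    using W assms(1) by (simp add: norm_to_L2[symmetric] to_L2_diff measurable L2_space_diff in_L2)
  moreover have "(norm (cls Y))\<^sup>2 = inner (cls Y) (cls Y - cls W)"
    using assms(2)[OF W(1)] by (simp add: power2_norm_eq_inner inner_diff_right)
  moreover have "inner (cls Y) (cls Y - cls W) \<le> norm (cls Y) * norm (cls Y - cls W)"
    by (rule norm_cauchy_schwarz)
  moreover have "0 < norm (cls Y)" using \<open>cls Y \<noteq> 0\<close> by simp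
  ultimately show False
    using mult_strict_left_mono[of "norm (cls Y - cls W)" "norm (cls Y)" "norm (cls Y)"]
    by (simp add: power2_eq_square)
qed

lemma skew_cls: "U \<in> X \<Longrightarrow> W \<in> X \<Longrightarrow> inner (cls (G U)) (cls W) = - inner (cls U) (cls (G W))"
  using skew by (simp add: skew_on_def inner_to_L2 measurable in_L2 G_L2)

lemma cls_lincomb:
  assumes "U \<in> X" "W \<in> X"
  shows "cls (\<lambda>x. a *\<^sub>R U x + b *\<^sub>R W x) = a *\<^sub>R cls U + b *\<^sub>R cls W"
  by (simp add: to_L2_add to_L2_scaleR measurable L2_space_scaleR in_L2 assms)

text \<open>
  Both sides have the same inner products with the dense space \<open>X\<close>, since skewness moves the
  operator to the other factor, where linearity is that of the inner product.
\<close>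

lemma cls_G_lincomb:
  assumes "U \<in> X" "W \<in> X"
  shows "cls (G (\<lambda>x. a *\<^sub>R U x + b *\<^sub>R W x)) = a *\<^sub>R cls (G U) + b *\<^sub>R cls (G W)"
proof -
  let ?S = "\<lambda>x. a *\<^sub>R U x + b *\<^sub>R W x"
  have S: "?S \<in> X" by (intro X_add X_scaleR assms)
  have cS: "cls ?S = a *\<^sub>R cls U + b *\<^sub>R cls W"
    by (rule cls_lincomb[OF assms])
  define Y where "Y x = G ?S x - (a *\<^sub>R G U x + b *\<^sub>R G W x)" for x
  have r: "(\<lambda>x. a *\<^sub>R G U x + b *\<^sub>R G W x) \<in> L2_space \<Omega>"
    by (intro L2_space_add L2_space_scaleR G_L2 assms measurable)
  have Y: "Y \<in> L2_space \<Omega>"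
    unfolding Y_def by (intro L2_space_diff r G_L2 S measurable)
  have cY: "cls Y = cls (G ?S) - (a *\<^sub>R cls (G U) + b *\<^sub>R cls (G W))"
    unfolding Y_def
    by (subst to_L2_diff[OF measurable G_L2[OF S] r])
      (simp add: to_L2_add to_L2_scaleR measurable L2_space_scaleR G_L2 assms)
  have "cls Y = 0"
  proof (rule eq_if_inner_X_eq[OF Y])
    fix Z assume Z: "Z \<in> X"
    show "inner (cls Y) (cls Z) = 0"
      unfolding cY by (simp add: inner_diff_left inner_add_left skew_cls[OF S Z] cS skew_cls assms Z)
  qed
  with cY show ?thesis by simp
qed

lemma cls_G_add: "U \<in> X \<Longrightarrow> W \<in> X \<Longrightarrow> cls (G (\<lambda>x. U x + W x)) = cls (G U) + cls (G W)"
  using cls_G_lincomb[of U W 1 1] by simp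

lemma cls_G_scaleR: "U \<in> X \<Longrightarrow> cls (G (\<lambda>x. a *\<^sub>R U x)) = a *\<^sub>R cls (G U)"
  using cls_G_lincomb[of U U a 0] by simp

lemma X_sum: "(\<And>j. j \<in> J \<Longrightarrow> U j \<in> X) \<Longrightarrow> (\<lambda>x. \<Sum>j\<in>J. U j x) \<in> X"
  by (induction J rule: infinite_finite_induct) (auto simp: X_zero X_add)

lemma cls_G_sum:
  "(\<And>j. j \<in> J \<Longrightarrow> U j \<in> X) \<Longrightarrow> cls (G (\<lambda>x. \<Sum>j\<in>J. U j x)) = (\<Sum>j\<in>J. cls (G (U j)))"
proof (induction J rule: infinite_finite_induct)
  case (insert j J)
  then show ?case by (simp add: cls_G_add X_sum)
qed (use cls_G_scaleR[OF X_zero, of 0] in simp_all)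

lemma T_op_L2: "U \<in> X \<Longrightarrow> T_op G \<delta> U \<in> L2_space \<Omega>"
  unfolding T_op_def by (intro L2_space_add L2_space_scaleR in_L2 G_L2 measurable)

lemma cls_T_op: "U \<in> X \<Longrightarrow> cls (T_op G \<delta> U) = cls U + \<delta> *\<^sub>R cls (G U)"
  unfolding T_op_def by (simp add: to_L2_add to_L2_scaleR measurable L2_space_scaleR in_L2 G_L2)

context
  fixes V :: "nat \<Rightarrow> real^'d \<Rightarrow> real^'s" and \<nu> :: nat and \<tau> \<delta> :: real
  assumes V: "\<And>n. V n \<in> X"
begin

abbreviation "cv n \<equiv> cls (V n)"
abbreviation "cg n \<equiv> cls (G (V n))"

lemma D_op_eq: "D_op \<tau> V n = (\<lambda>x. inverse \<tau> *\<^sub>R V n x + (- inverse \<tau>) *\<^sub>R V (n - 1) x)"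
  by (auto simp: D_op_def scaleR_diff_right)

lemma D_op_X: "D_op \<tau> V n \<in> X"
  unfolding D_op_eq by (intro X_add X_scaleR V)

lemma M_op_X: "M_op \<nu> V n \<in> X"
  unfolding M_op_def by (intro X_sum X_scaleR V)

lemma cls_D_op: "cls (D_op \<tau> V n) = bdiff cv n /\<^sub>R \<tau>"
  unfolding D_op_eq cls_lincomb[OF V V] by (simp add: bdiff_def scaleR_diff_right)

lemma cls_G_D_op: "cls (G (D_op \<tau> V n)) = bdiff cg n /\<^sub>R \<tau>"
  unfolding D_op_eq cls_G_lincomb[OF V V] by (simp add: bdiff_def scaleR_diff_right)

lemma cls_M_op: "cls (M_op \<nu> V n) = am_mean \<nu> cv n"
  unfolding M_op_def am_mean_def
  by (simp add: to_L2_sum to_L2_scaleR measurable L2_space_scaleR in_L2 V)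

lemma cls_G_M_op: "cls (G (M_op \<nu> V n)) = am_mean \<nu> cg n"
  unfolding M_op_def am_mean_def by (simp add: cls_G_sum cls_G_scaleR X_scaleR V)

lemma A_op_L2: "A_op G \<nu> \<tau> V n \<in> L2_space \<Omega>"
  unfolding A_op_def by (intro L2_space_add in_L2 G_L2 D_op_X M_op_X measurable)

lemma cls_A_op: "cls (A_op G \<nu> \<tau> V n) = bdiff cv n /\<^sub>R \<tau> + am_mean \<nu> cg n"
  unfolding A_op_def cls_D_op[symmetric] cls_G_M_op[symmetric]
  by (intro to_L2_add in_L2 G_L2 D_op_X M_op_X measurable)

lemma S_op_X: "S_op \<nu> \<tau> \<delta> V n \<in> X"
  unfolding S_op_def by (intro X_add X_scaleR M_op_X D_op_X)

lemma P_op_L2: "P_op G \<nu> \<tau> \<delta> V n \<in> L2_space \<Omega>"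
  unfolding P_op_def by (intro T_op_L2 S_op_X)

lemma cls_P_op:
  "cls (P_op G \<nu> \<tau> \<delta> V n) = am_mean \<nu> (\<lambda>n. cv n + \<delta> *\<^sub>R cg n) n + (\<delta> / \<tau>) *\<^sub>R bdiff (\<lambda>n. cv n + \<delta> *\<^sub>R cg n) n"
proof -
  have 1: "cls (S_op \<nu> \<tau> \<delta> V n) = am_mean \<nu> cv n + \<delta> *\<^sub>R (bdiff cv n /\<^sub>R \<tau>)"
    unfolding S_op_def
    by (simp add: to_L2_add to_L2_scaleR measurable L2_space_scaleR in_L2 M_op_X D_op_X cls_M_op cls_D_op)
  have 2: "cls (G (S_op \<nu> \<tau> \<delta> V n)) = am_mean \<nu> cg n + \<delta> *\<^sub>R (bdiff cg n /\<^sub>R \<tau>)"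
    unfolding S_op_def by (simp add: cls_G_add cls_G_scaleR X_scaleR M_op_X D_op_X cls_G_M_op cls_G_D_op)
  have 3: "am_mean \<nu> (\<lambda>n. cv n + \<delta> *\<^sub>R cg n) n = am_mean \<nu> cv n + \<delta> *\<^sub>R am_mean \<nu> cg n"
    by (simp add: am_mean_def scaleR_sum_right sum.distrib scaleR_add_right mult.commute)
  show ?thesis
    unfolding P_op_def cls_T_op[OF S_op_X] 1 2 3
    by (simp add: bdiff_def algebra_simps divide_inverse)
qed

end

end

section \<open>Stability of the fully discrete scheme\<close>

lemma Max_insert_0:
  fixes f :: "nat \<Rightarrow> real"
  assumes "a \<le> m" "\<And>n. 0 \<le> f n"
  shows "Max (insert 0 (f ` {a..m})) = Max (f ` {a..m})"
proof -
  have "f a \<le> Max (f ` {a..m})" using assms(1) by (intro Max_ge) auto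
  then show ?thesis
    using assms order_trans[OF assms(2)[of a]] by (subst Max_insert) auto
qed

lemma scheme_op_cong:
  assumes "\<And>k. k \<le> n \<Longrightarrow> V k = V' k"
  shows "D_op \<tau> V n = D_op \<tau> V' n" "M_op \<nu> V n = M_op \<nu> V' n" "A_op G \<nu> \<tau> V n = A_op G \<nu> \<tau> V' n"
    "P_op G \<nu> \<tau> \<delta> V n = P_op G \<nu> \<tau> \<delta> V' n"
proof -
  have V: "V (n - j) = V' (n - j)" for j using assms by simp
  show D: "D_op \<tau> V n = D_op \<tau> V' n" using assms V[of 1] by (simp add: D_op_def)
  show M: "M_op \<nu> V n = M_op \<nu> V' n" using V by (simp add: M_op_def)
  show "A_op G \<nu> \<tau> V n = A_op G \<nu> \<tau> V' n" unfolding A_op_def D M ..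
  show "P_op G \<nu> \<tau> \<delta> V n = P_op G \<nu> \<tau> \<delta> V' n" unfolding P_op_def S_op_def D M ..
qed

lemma scheme_norm_cong:
  assumes "\<And>k. k \<le> m \<Longrightarrow> V k = V' k" "first_index \<nu> \<le> m"
  shows "init_energy \<Omega> G \<nu> \<delta> V = init_energy \<Omega> G \<nu> \<delta> V'"
    "E_norm \<Omega> G \<nu> \<tau> \<delta> m V = E_norm \<Omega> G \<nu> \<tau> \<delta> m V'"
    "test_energy \<Omega> G \<nu> \<tau> \<delta> m V = test_energy \<Omega> G \<nu> \<tau> \<delta> m V'"
proof -
  show I: "init_energy \<Omega> G \<nu> \<delta> V = init_energy \<Omega> G \<nu> \<delta> V'"
    unfolding init_energy_def using assms by (intro sum.cong) auto
  have "A_op G \<nu> \<tau> V n = A_op G \<nu> \<tau> V' n" if "n \<le> m" for n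
    using assms(1) that by (intro scheme_op_cong) auto
  then have "(\<Sum>n=first_index \<nu>..m. (L2_norm \<Omega> (A_op G \<nu> \<tau> V n))\<^sup>2) = (\<Sum>n=first_index \<nu>..m. (L2_norm \<Omega> (A_op G \<nu> \<tau> V' n))\<^sup>2)"
    by (intro sum.cong) auto
  moreover have "(\<lambda>n. (L2_norm \<Omega> (T_op G \<delta> (V n)))\<^sup>2) ` {first_index \<nu>..m} = (\<lambda>n. (L2_norm \<Omega> (T_op G \<delta> (V' n)))\<^sup>2) ` {first_index \<nu>..m}"
    using assms(1) by (intro image_cong) auto
  ultimately show E: "E_norm \<Omega> G \<nu> \<tau> \<delta> m V = E_norm \<Omega> G \<nu> \<tau> \<delta> m V'"
    unfolding E_norm_def by simp
  show "test_energy \<Omega> G \<nu> \<tau> \<delta> m V = test_energy \<Omega> G \<nu> \<tau> \<delta> m V'"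
    unfolding test_energy_def I E ..
qed

text \<open>
  Setting a sequence to zero after step \<open>m\<close> makes it admissible in the supremum for \<open>m\<close> and changes
  none of the quantities up to that step.
\<close>

lemma E_dual_norm_test:
  assumes "m \<in> {first_index \<nu>..N}" "\<And>n. n \<le> m \<Longrightarrow> V n \<in> X" "(\<lambda>_. 0) \<in> X" "0 < test_energy \<Omega> G \<nu> \<tau> \<delta> m V"
  shows "ereal (\<tau> * (\<Sum>n=first_index \<nu>..m. L2_inner \<Omega> (R n) (P_op G \<nu> \<tau> \<delta> V n)) / test_energy \<Omega> G \<nu> \<tau> \<delta> m V)
     \<le> E_dual_norm \<Omega> X G \<nu> \<tau> \<delta> N R"
proof -
  define W where "W n = (if n \<le> m then V n else (\<lambda>_. 0))" for n
  have WV: "V k = W k" if "k \<le> m" for k using that by (simp add: W_def)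
  have te: "test_energy \<Omega> G \<nu> \<tau> \<delta> m V = test_energy \<Omega> G \<nu> \<tau> \<delta> m W"
    using assms(1) by (intro scheme_norm_cong(3) WV) auto
  have P: "(\<Sum>n=first_index \<nu>..m. L2_inner \<Omega> (R n) (P_op G \<nu> \<tau> \<delta> V n)) = (\<Sum>n=first_index \<nu>..m. L2_inner \<Omega> (R n) (P_op G \<nu> \<tau> \<delta> W n))"
  proof (rule sum.cong[OF refl])
    fix n assume "n \<in> {first_index \<nu>..m}"
    then have "P_op G \<nu> \<tau> \<delta> V n = P_op G \<nu> \<tau> \<delta> W n" by (intro scheme_op_cong(4) WV) auto
    then show "L2_inner \<Omega> (R n) (P_op G \<nu> \<tau> \<delta> V n) = L2_inner \<Omega> (R n) (P_op G \<nu> \<tau> \<delta> W n)" by simp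
  qed
  define f where "f m V = ereal (\<tau> * (\<Sum>n=first_index \<nu>..m. L2_inner \<Omega> (R n) (P_op G \<nu> \<tau> \<delta> V n)) / test_energy \<Omega> G \<nu> \<tau> \<delta> m V)" for m V
  define S where "S m = {V. (\<forall>n. V n \<in> X) \<and> (\<forall>n>m. V n = (\<lambda>_. 0)) \<and> 0 < test_energy \<Omega> G \<nu> \<tau> \<delta> m V}" for m
  have "W \<in> S m" using assms(2-4) te by (auto simp: S_def W_def)
  then have "f m W \<le> (SUP V\<in>S m. f m V)" by (rule SUP_upper)
  also have "\<dots> \<le> (MAX m\<in>{first_index \<nu>..N}. SUP V\<in>S m. f m V)"
    using assms(1) by (intro Max_ge) auto
  finally show ?thesis
    unfolding E_dual_norm_def f_def S_def P te .
qed

theorem corollary5p1: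
  fixes \<Omega> :: "(real^'d) set"
    and X :: "(real^'d \<Rightarrow> real^'s) set"
    and A :: "'d \<Rightarrow> real^'s^'s"
    and G :: "(real^'d \<Rightarrow> real^'s) \<Rightarrow> (real^'d \<Rightarrow> real^'s)"
    and \<nu> :: nat
    and T C_td C_del C_G \<sigma> \<rho> :: real
  defines "G \<equiv> const_coeff_op \<Omega> A"
  assumes nu: "\<nu> \<in> {3, 4}"
    and domain: "lipschitz_domain \<Omega>"
    and X: "fun_subspace X" "X \<subseteq> H1_space \<Omega>" "dense_in_L2 \<Omega> X"
    and skew: "skew_on \<Omega> X G"
    and constants: "T > 0" "C_td > 0" "C_del > 0" "C_G > 0" "\<sigma> > 0" "\<rho> > 0"
  shows "\<exists>c0>0. \<exists>C>0.
    \<forall>(\<T> :: (real^'d) set set) (h::real) (Xh :: (real^'d \<Rightarrow> real^'s) set) (\<tau>::real) (\<delta>::real)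
      (N::nat) (V :: nat \<Rightarrow> real^'d \<Rightarrow> real^'s) (R :: nat \<Rightarrow> real^'d \<Rightarrow> real^'s).
      simplicial_mesh \<Omega> \<T> \<longrightarrow> shape_regular \<sigma> \<T> \<longrightarrow> quasi_uniform \<rho> \<T> \<longrightarrow>
      h = mesh_size \<T> \<longrightarrow>
      fun_subspace Xh \<longrightarrow> Xh \<subseteq> X \<longrightarrow> Xh \<subseteq> continuous_piecewise_affine \<Omega> \<T> \<longrightarrow>
      (\<forall>W\<in>Xh. L2_norm \<Omega> (G W) \<le> C_G * inverse h * L2_norm \<Omega> W) \<longrightarrow>
      0 < \<tau> \<longrightarrow> \<tau> \<le> C_td * \<delta> \<longrightarrow>
      0 < \<delta> \<longrightarrow> \<delta> \<le> C_del * h \<longrightarrow>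
      \<tau> \<le> c0 * inverse C_G * h \<longrightarrow>
      first_index \<nu> \<le> N \<longrightarrow> real N * \<tau> \<le> T \<longrightarrow>
      (\<forall>n\<le>N. V n \<in> Xh) \<longrightarrow>
      (\<forall>n\<in>{first_index \<nu>..N}. R n \<in> L2_space \<Omega>) \<longrightarrow>
      (\<forall>n\<in>{first_index \<nu>..N}. \<forall>W\<in>Xh.
         L2_inner \<Omega> (A_op G \<nu> \<tau> V n) (T_op G \<delta> W) = L2_inner \<Omega> (R n) (T_op G \<delta> W)) \<longrightarrow>
      ereal ((E_norm \<Omega> G \<nu> \<tau> \<delta> N V)\<^sup>2)
        \<le> ereal C * (ereal (init_energy \<Omega> G \<nu> \<delta> V) + (E_dual_norm \<Omega> Xh G \<nu> \<tau> \<delta> N R)\<^sup>2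
                      + ereal (\<tau> * (l2_norm_time \<Omega> \<tau> (first_index \<nu>) N R)\<^sup>2))"
proof -
  have op: "open \<Omega>" "bounded \<Omega>" using domain by (auto simp: lipschitz_domain_def)
  have \<Omega>l: "\<Omega> \<in> sets lebesgue" using op(1) by simp
  interpret H: skew_L2_operator \<Omega> X G
  proof
    show "G U \<in> L2_space \<Omega>" if "U \<in> X" for U
      unfolding G_def using op(1) X(2) that by (intro const_coeff_op_L2) auto
  qed (use \<Omega>l X skew in \<open>auto intro: H1_imp_L2\<close>)
  \<comment> \<open>The summand \<open>1\<close> keeps the constant positive even if all coefficient matrices vanish.\<close>
  define Ki where "Ki = sqrt (inverse_const A (4 * \<sigma> * \<rho>)) + 1"
  have Ki: "0 < Ki" "sqrt (inverse_const A (4 * \<sigma> * \<rho>)) \<le> Ki"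
    using constants inverse_const_nonneg[of "4 * \<sigma> * \<rho>" A] by (auto simp: Ki_def add_nonneg_pos)
  define L where "L = Ki * C_del"
  have L0: "0 < L" using Ki constants by (simp add: L_def)
  define c0 where "c0 = C_G / (192 * (1 + C_td + L) * Ki)"
  have c0: "0 < c0" using Ki constants L0 by (simp add: c0_def)
  define Cs :: real where "Cs = 10000 * 1200 ^ 5"
  show ?thesis
  proof (rule exI[of _ c0], rule conjI[OF c0], rule exI[of _ Cs], rule conjI, goal_cases)
    case 1
    show ?case by (simp add: Cs_def)
  next
    case 2
    show ?case
    proof (intro allI impI)
      fix \<T> :: "(real^'d) set set" and h :: real and Xh :: "(real^'d \<Rightarrow> real^'s) set" and \<tau> \<delta> :: real
        and N :: nat and V R :: "nat \<Rightarrow> real^'d \<Rightarrow> real^'s"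
      assume mesh: "simplicial_mesh \<Omega> \<T>" "shape_regular \<sigma> \<T>" "quasi_uniform \<rho> \<T>" and h: "h = mesh_size \<T>"
        and Xh: "fun_subspace Xh" "Xh \<subseteq> X" "Xh \<subseteq> continuous_piecewise_affine \<Omega> \<T>"
        and tau: "0 < \<tau>" "\<tau> \<le> C_td * \<delta>" and delta: "0 < \<delta>" "\<delta> \<le> C_del * h"
        and cfl: "\<tau> \<le> c0 * inverse C_G * h" and N: "first_index \<nu> \<le> N"
        and V: "\<forall>n\<le>N. V n \<in> Xh" and R: "\<forall>n\<in>{first_index \<nu>..N}. R n \<in> L2_space \<Omega>"
        and sol: "\<forall>n\<in>{first_index \<nu>..N}. \<forall>W\<in>Xh.
           L2_inner \<Omega> (A_op G \<nu> \<tau> V n) (T_op G \<delta> W) = L2_inner \<Omega> (R n) (T_op G \<delta> W)"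
      have h0: "0 < h" using delta constants by (smt (verit) mult_nonneg_nonpos)
      define V' where "V' n = (if n \<le> N then V n else (\<lambda>_. 0))" for n
      have VV': "V k = V' k" if "k \<le> N" for k using that by (simp add: V'_def)
      have zero: "(\<lambda>_. 0) \<in> Xh" using Xh(1) by (simp add: fun_subspace_def)
      have V'h: "V' n \<in> Xh" for n using V zero by (simp add: V'_def)
      have V': "V' n \<in> X" for n using V'h Xh(2) by blast
      define v where "v n = to_L2 \<Omega> (V' n)" for n
      define g where "g n = to_L2 \<Omega> (G (V' n))" for n
      define r where "r n = to_L2 \<Omega> (R n)" for n
      define \<theta> where "\<theta> = Ki / h * \<tau>"
      have th0: "0 \<le> \<theta>" using Ki h0 tau by (simp add: \<theta>_def)
      interpret q: am_sequences \<nu> \<tau> \<delta> v g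
        by standard (use nu tau delta in auto)
      have A: "to_L2 \<Omega> (A_op G \<nu> \<tau> V' n) = q.residual n" for n
        unfolding q.residual_def unfolding v_def[abs_def] g_def[abs_def] by (rule H.cls_A_op[OF V'])
      have T: "to_L2 \<Omega> (T_op G \<delta> (V' n)) = q.u n" for n
        unfolding q.u_def unfolding v_def g_def by (rule H.cls_T_op[OF V'])
      have P: "to_L2 \<Omega> (P_op G \<nu> \<tau> \<delta> V' n) = q.supg_test n" for n
        unfolding q.supg_test_def q.u_def[abs_def] unfolding v_def[abs_def] g_def[abs_def] by (rule H.cls_P_op[OF V'])
      have nA: "L2_norm \<Omega> (A_op G \<nu> \<tau> V' n) = norm (q.residual n)" for n
        unfolding A[symmetric] by (rule norm_to_L2[symmetric, OF \<Omega>l H.A_op_L2[OF V']])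
      have nT: "L2_norm \<Omega> (T_op G \<delta> (V' n)) = norm (q.u n)" for n
        unfolding T[symmetric] by (rule norm_to_L2[symmetric, OF \<Omega>l H.T_op_L2[OF V']])
      have init: "init_energy \<Omega> G \<nu> \<delta> V' = q.init"
        by (simp add: init_energy_def q.init_def nT)
      have En: "(E_norm \<Omega> G \<nu> \<tau> \<delta> m V')\<^sup>2 = q.energy m - q.init" if "first_index \<nu> \<le> m" for m
      proof -
        have "(E_norm \<Omega> G \<nu> \<tau> \<delta> m V')\<^sup>2 = (sqrt (q.energy m - q.init))\<^sup>2"
          unfolding E_norm_def q.energy_def q.dissipation_def nA nT Max_insert_0[OF that zero_le_power2]
          by simp
        also have "\<dots> = q.energy m - q.init"
          unfolding q.energy_def using q.dissipation_nonneg[of m] by (intro real_sqrt_pow2) simp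
        finally show ?thesis .
      qed
      have te: "test_energy \<Omega> G \<nu> \<tau> \<delta> m V' = sqrt (q.energy m)" if "first_index \<nu> \<le> m" for m
        using En[OF that] by (simp add: test_energy_def init)
      have rP: "inner (r n) (q.supg_test n) = L2_inner \<Omega> (R n) (P_op G \<nu> \<tau> \<delta> V' n)" if "n \<in> {first_index \<nu>..N}" for n
        unfolding r_def P[symmetric] using R that by (intro inner_to_L2 \<Omega>l H.P_op_L2 V') auto
      have EV: "E_norm \<Omega> G \<nu> \<tau> \<delta> N V = E_norm \<Omega> G \<nu> \<tau> \<delta> N V'" "init_energy \<Omega> G \<nu> \<delta> V = init_energy \<Omega> G \<nu> \<delta> V'"
        using scheme_norm_cong[of N V V' \<nu>] VV' N by auto
      let ?D = "E_dual_norm \<Omega> Xh G \<nu> \<tau> \<delta> N R"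
      show "ereal ((E_norm \<Omega> G \<nu> \<tau> \<delta> N V)\<^sup>2) \<le> ereal Cs * (ereal (init_energy \<Omega> G \<nu> \<delta> V) + ?D\<^sup>2
                      + ereal (\<tau> * (l2_norm_time \<Omega> \<tau> (first_index \<nu>) N R)\<^sup>2))"
      proof (cases ?D)
        \<comment> \<open>An infinite dual norm, of either sign (the supremum may be over the empty set), makes the right-hand side infinite.\<close>
        case PInf
        then show ?thesis by (simp add: Cs_def power2_eq_square)
      next
        case MInf
        then show ?thesis by (simp add: Cs_def power2_eq_square)
      next
        case (real d)
        define D where "D = \<bar>d\<bar>"
        interpret q: am_supg_sequences \<nu> \<tau> \<delta> v g N C_td L D \<theta> r
        proof
          show "0 \<le> C_td" "0 \<le> L" "0 \<le> D" "0 \<le> \<theta>" using constants L0 th0 by (auto simp: D_def)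
          show "inner (g i) (v j) = - inner (v i) (g j)" for i j
            unfolding v_def g_def by (rule H.skew_cls[OF V' V'])
          show "\<tau> \<le> C_td * \<delta>" by (rule tau)
          have "\<delta> * \<theta> = \<delta> * (Ki * \<tau> / h)" by (simp add: \<theta>_def)
          also have "\<dots> \<le> (C_del * h) * (Ki * \<tau> / h)"
            using delta Ki tau h0 by (intro mult_right_mono) auto
          also have "\<dots> = L * \<tau>" using h0 by (simp add: L_def)
          finally show "\<delta> * \<theta> \<le> L * \<tau>" .
        next
          fix n j assume n: "n \<in> {first_index \<nu>..N}" and j: "j \<le> N"
          have AV: "A_op G \<nu> \<tau> V n = A_op G \<nu> \<tau> V' n"
            using n VV' by (intro scheme_op_cong(3)) auto
          have "inner (q.residual n) (q.u j) = L2_inner \<Omega> (A_op G \<nu> \<tau> V' n) (T_op G \<delta> (V' j))"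
            unfolding A[symmetric] T[symmetric] by (intro inner_to_L2 \<Omega>l H.A_op_L2 H.T_op_L2 V')
          also have "\<dots> = L2_inner \<Omega> (R n) (T_op G \<delta> (V' j))"
            using sol[rule_format, OF n V'h[of j]] unfolding AV .
          also have "\<dots> = inner (r n) (q.u j)"
            unfolding r_def T[symmetric] using R n by (intro inner_to_L2[symmetric] \<Omega>l H.T_op_L2 V') auto
          finally show "inner (q.residual n) (q.u j) = inner (r n) (q.u j)" .
        next
          fix n assume n: "n \<in> {first_index \<nu>..N}"
          \<comment> \<open>The difference of two iterates and \<open>\<tau>\<close> times the mean are discrete functions whose residual combination is \<open>\<tau>\<close> times the residual of the step.\<close>
          define w where "w x = 1 *\<^sub>R V' n x + (- 1) *\<^sub>R V' (n - 1) x" for x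
          define z where "z x = \<tau> *\<^sub>R M_op \<nu> V' n x" for x
          have Xh_add: "(\<lambda>x. a *\<^sub>R U x + b *\<^sub>R W x) \<in> Xh" if "U \<in> Xh" "W \<in> Xh" for a b U W
          proof -
            have s: "\<And>c U. U \<in> Xh \<Longrightarrow> (\<lambda>x. c *\<^sub>R U x) \<in> Xh" "\<And>U W. U \<in> Xh \<Longrightarrow> W \<in> Xh \<Longrightarrow> (\<lambda>x. U x + W x) \<in> Xh"
              using Xh(1) by (simp_all add: fun_subspace_def)
            show ?thesis by (rule s(2)[OF s(1)[OF that(1)] s(1)[OF that(2)]])
          qed
          have wh: "w \<in> Xh" unfolding w_def[abs_def] by (intro Xh_add V'h)
          have Mh: "(\<lambda>x. \<Sum>j\<in>J. am_coeff \<nu> j *\<^sub>R V' (n - j) x) \<in> Xh" if "finite J" for J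
            using that
          proof induction
            case (insert j J)
            then show ?case using Xh_add[OF V'h[of "n - j"] insert.IH, of "am_coeff \<nu> j" 1] by simp
          qed (simp add: zero)
          have zh: "z \<in> Xh"
            using Xh_add[OF Mh[of "{..<\<nu>}"] zero, of \<tau> 0] by (simp add: z_def[abs_def] M_op_def)
          have wX: "w \<in> X" and zX: "z \<in> X" using wh zh Xh(2) by auto
          have cw: "to_L2 \<Omega> w = bdiff v n"
            unfolding w_def[abs_def] H.cls_lincomb[OF V' V'] by (simp add: bdiff_def v_def)
          have cGw: "to_L2 \<Omega> (G w) = bdiff g n"
            unfolding w_def[abs_def] H.cls_G_lincomb[OF V' V'] by (simp add: bdiff_def g_def)
          have cGz: "to_L2 \<Omega> (G z) = \<tau> *\<^sub>R am_mean \<nu> g n"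
            unfolding z_def[abs_def] H.cls_G_scaleR[OF H.M_op_X[OF V']] H.cls_G_M_op[OF V'] g_def[abs_def] ..
          have wz: "to_L2 \<Omega> (\<lambda>x. w x + G z x) = \<tau> *\<^sub>R q.residual n"
            unfolding to_L2_add[OF \<Omega>l H.in_L2[OF wX] H.G_L2[OF zX]] cw cGz q.residual_def
            using tau by (simp add: scaleR_add_right)
          have "norm (bdiff g n) = L2_norm \<Omega> (G w)"
            unfolding cGw[symmetric] by (rule norm_to_L2[OF \<Omega>l H.G_L2[OF wX]])
          also have "\<dots> \<le> sqrt (inverse_const A (4 * \<sigma> * \<rho>)) / h * L2_norm \<Omega> (\<lambda>x. w x + G z x)"
            unfolding G_def h
            by (rule inverse_estimate_by_residual[OF domain mesh])
              (use constants h0 h wh zh wX zX X(2) Xh(3) in auto)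
          also have "L2_norm \<Omega> (\<lambda>x. w x + G z x) = \<tau> * norm (q.residual n)"
            using norm_to_L2[OF \<Omega>l L2_space_add[OF \<Omega>l H.in_L2[OF wX] H.G_L2[OF zX]]] tau
            unfolding wz by simp
          also have "sqrt (inverse_const A (4 * \<sigma> * \<rho>)) / h * (\<tau> * norm (q.residual n)) \<le> Ki / h * (\<tau> * norm (q.residual n))"
            using Ki(2) h0 tau by (intro mult_right_mono divide_right_mono) auto
          finally show "norm (bdiff g n) \<le> \<theta> * norm (q.residual n)" by (simp add: \<theta>_def mult.assoc)
        next
          fix m assume m: "m \<in> {first_index \<nu>..N}"
          have mp: "first_index \<nu> \<le> m" using m by simp
          have sum: "(\<Sum>n=first_index \<nu>..m. inner (r n) (q.supg_test n)) =
              (\<Sum>n=first_index \<nu>..m. L2_inner \<Omega> (R n) (P_op G \<nu> \<tau> \<delta> V' n))"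
            using m by (intro sum.cong rP) auto
          show "\<tau> * (\<Sum>n=first_index \<nu>..m. inner (r n) (q.supg_test n)) \<le> D * sqrt (q.energy m)"
          proof (cases "q.energy m = 0")
            case True
            \<comment> \<open>A vanishing energy is not covered by the supremum, but then the test function vanishes as well.\<close>
            have "q.u k = 0" if "k \<le> m" for k
              using q.norm_u_le_energy[OF that] True by simp
            then have "q.supg_test n = 0" if "n \<le> m" for n
              using that by (simp add: q.supg_test_def bdiff_def am_mean_def)
            then show ?thesis using True by simp
          next
            case False
            then have pos: "0 < sqrt (q.energy m)" using q.energy_nonneg[of m] by simp
            have "ereal (\<tau> * (\<Sum>n=first_index \<nu>..m. L2_inner \<Omega> (R n) (P_op G \<nu> \<tau> \<delta> V' n)) / test_energy \<Omega> G \<nu> \<tau> \<delta> m V') \<le> ?D"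
              using pos te[OF mp] by (intro E_dual_norm_test m V'h zero) simp
            then have "\<tau> * (\<Sum>n=first_index \<nu>..m. L2_inner \<Omega> (R n) (P_op G \<nu> \<tau> \<delta> V' n)) / sqrt (q.energy m) \<le> D"
              unfolding real te[OF mp] by (simp add: D_def)
            then show ?thesis unfolding sum using pos by (simp add: divide_le_eq)
          qed
        qed
        have small: "192 * (1 + C_td + L) * \<theta> \<le> 1"
        proof -
          have "\<theta> = Ki * (\<tau> / h)" by (simp add: \<theta>_def)
          also have "\<tau> / h \<le> c0 * inverse C_G" using cfl h0 by (simp add: divide_le_eq)
          finally have "\<theta> \<le> Ki * (c0 * inverse C_G)" using Ki(1) by simp
          also have "\<dots> = 1 / (192 * (1 + C_td + L))"
          proof -
            have "Ki * (C_G / (e * Ki) * inverse C_G) = 1 / e" if "e > 0" for e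
              using Ki(1) constants that by (simp add: field_simps)
            then show ?thesis using constants L0 by (simp add: c0_def)
          qed
          finally show ?thesis using constants L0 by (simp add: field_simps)
        qed
        have rn: "(\<Sum>n=first_index \<nu>..N. (norm (r n))\<^sup>2) = (\<Sum>n=first_index \<nu>..N. (L2_norm \<Omega> (R n))\<^sup>2)"
          unfolding r_def using R by (intro sum.cong) (auto simp: norm_to_L2 \<Omega>l)
        have "\<tau> * (l2_norm_time \<Omega> \<tau> (first_index \<nu>) N R)\<^sup>2 = \<tau>\<^sup>2 * (\<Sum>n=first_index \<nu>..N. (norm (r n))\<^sup>2)"
          unfolding l2_norm_time_def rn[symmetric] using tau(1)
          by (simp add: sum_nonneg power2_eq_square)
        moreover have "(E_norm \<Omega> G \<nu> \<tau> \<delta> N V)\<^sup>2 \<le> q.energy N"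
          unfolding EV En[OF N] using q.init_nonneg by simp
        ultimately have "(E_norm \<Omega> G \<nu> \<tau> \<delta> N V)\<^sup>2 \<le> Cs * (init_energy \<Omega> G \<nu> \<delta> V + D\<^sup>2 + \<tau> * (l2_norm_time \<Omega> \<tau> (first_index \<nu>) N R)\<^sup>2)"
          using q.stability[OF small N] unfolding Cs_def EV(2) init by simp
        then show ?thesis unfolding real D_def by simp
      qed
    qed
  qed
qed

end
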